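(* Every unbounded abelian group $G$ admits a Hausdorff group topology $\tau$ such that $(G,\tau)$ is minimally almost periodic.
   Context: An abelian group $G$ is bounded (has finite exponent) if $mG=\{mg:g\in G\}=\{0\}$ for some integer $m\ge 1$, and unbounded otherwise. A character of a topological abelian group $G$ is a continuous homomorphism $G\to\mathbb{T}$, where $\mathbb{T}=\mathbb{R}/\mathbb{Z}$ is the circle group with its usual topology. A topological abelian group is minimally almost periodic if all its characters are trivial. *)

theory Defs
  imports "HOL-Analysis.Analysis" "HOL-Algebra.Elementary_Groups"
begin

definition bounded_group :: "('a, 'b) monoid_scheme \<Rightarrow> bool" where
  "bounded_group G \<longleftrightarrow>
     (\<exists>m::nat. m \<ge> 1 \<and> (\<lambda>g. g [^]\<^bsub>G\<^esub> m) ` carrier G = {\<one>\<^bsub>G\<^esub>})"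

locale topological_abelian_group = comm_group G for G (structure) +
  fixes T :: "'a topology"
  assumes topspace_eq_carrier: "topspace T = carrier G"
    and continuous_map_mult:
      "continuous_map (prod_topology T T) T (\<lambda>(x, y). x \<otimes> y)"
    and continuous_map_inv: "continuous_map T T (\<lambda>x. inv x)"

definition real_group :: "real monoid" where
  "real_group = \<lparr>carrier = UNIV, monoid.mult = (+), one = 0\<rparr>"

definition circle_group :: "real set monoid" where
  "circle_group = real_group Mod \<int>"

definition circle_proj :: "real \<Rightarrow> real set" where
  "circle_proj x = \<int> #>\<^bsub>real_group\<^esub> x"

text \<open>The usual topology of the circle is the quotient topology along the projection
  (see \<open>quotient_map_circle_proj\<close> below).\<close>

definition circle_topology :: "real set topology" where
  "circle_topology =
     topology (\<lambda>U. U \<subseteq> carrier circle_group \<and> open (circle_proj -` U))"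

definition character ::
    "('a, 'b) monoid_scheme \<Rightarrow> 'a topology \<Rightarrow> ('a \<Rightarrow> real set) \<Rightarrow> bool" where
  "character G T \<phi> \<longleftrightarrow>
     \<phi> \<in> hom G circle_group \<and> continuous_map T circle_topology \<phi>"

text \<open>Triviality is required on the carrier only, since the values of \<open>\<phi>\<close> elsewhere are
  junk.\<close>

definition minimally_almost_periodic ::
    "('a, 'b) monoid_scheme \<Rightarrow> 'a topology \<Rightarrow> bool" where
  "minimally_almost_periodic G T \<longleftrightarrow>
     (\<forall>\<phi>. character G T \<phi> \<longrightarrow> (\<forall>x\<in>carrier G. \<phi> x = \<one>\<^bsub>circle_group\<^esub>))"

lemma comm_group_real_group: "comm_group real_group"
proof (rule comm_groupI)
  fix x assume "x \<in> carrier real_group"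
  show "\<exists>y\<in>carrier real_group. y \<otimes>\<^bsub>real_group\<^esub> x = \<one>\<^bsub>real_group\<^esub>"
    by (rule bexI[of _ "- x"]) (auto simp: real_group_def)
qed (auto simp: real_group_def)

lemma subgroup_Ints: "subgroup \<int> real_group"
proof -
  interpret comm_group real_group by (rule comm_group_real_group)
  have inv_eq: "inv\<^bsub>real_group\<^esub> x = - x" for x
    by (rule inv_equality) (auto simp: real_group_def)
  show ?thesis
    by unfold_locales (auto simp: inv_eq, auto simp: real_group_def)
qed

lemma comm_group_circle_group: "comm_group circle_group"
  unfolding circle_group_def
  by (rule comm_group.abelian_FactGroup[OF comm_group_real_group subgroup_Ints])

lemma carrier_circle_group: "carrier circle_group = range circle_proj"
  by (auto simp: circle_group_def carrier_FactGroup circle_proj_def real_group_def)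

lemma openin_circle_topology:
  "openin circle_topology U \<longleftrightarrow>
     U \<subseteq> carrier circle_group \<and> open (circle_proj -` U)"
proof -
  have "istopology (\<lambda>U. U \<subseteq> carrier circle_group \<and> open (circle_proj -` U))"
    unfolding istopology_def by (auto simp: vimage_Int vimage_Union)
  then show ?thesis
    by (simp add: circle_topology_def)
qed

lemma topspace_circle_topology: "topspace circle_topology = carrier circle_group"
proof (rule antisym)
  show "topspace circle_topology \<subseteq> carrier circle_group"
    using openin_circle_topology openin_topspace by blast
  have "circle_proj -` carrier circle_group = UNIV"
    by (auto simp: carrier_circle_group)
  then have "openin circle_topology (carrier circle_group)"
    by (simp add: openin_circle_topology)
  then show "carrier circle_group \<subseteq> topspace circle_topology"
    by (rule openin_subset)
qed

lemma quotient_map_circle_proj: "quotient_map euclidean circle_topology circle_proj"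
  by (auto simp: quotient_map_def openin_circle_topology topspace_circle_topology
      carrier_circle_group vimage_def)

end

theory Submission
  imports Defs "HOL-Algebra.Multiplicative_Group"
begin

text \<open>The continuous functions from the 2-adic integers to the circle, with the \<open>L\<^sup>1\<close> metric, form
  a divisible group without continuous characters: every element is a product of elements
  supported on residue classes of small measure, and such elements generate small subgroups.
  Infinite cyclic groups and countable unbounded torsion groups embed densely into it. Write \<open>G\<close>
  additively. Take a maximal independent family of such subgroups of \<open>G\<close>, with span \<open>C\<close>; by
  divisibility the embeddings extend to \<open>G\<close>, and jointly they separate the points of \<open>C\<close>. For a suitable
  \<open>d \<ge> 1\<close> every subgroup of \<open>dG\<close> disjoint from \<open>C\<close> is finite. The bounded group \<open>G/dG\<close> is up
  to a finite group a sum of infinite homocyclic groups, which carry analogous norms. The finite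
  group left over is absorbed into a member of the family. The embeddings and the norms on \<open>G/dG\<close>
  together give a Hausdorff topology. A continuous character vanishes on the \<open>d\<close>-th multiples of
  every member of the family, whose images are still dense; correcting by these multiples reduces
  it to a continuous character of \<open>G/dG\<close>.\<close>

section \<open>Extending homomorphisms\<close>

text \<open>Under the sup metric evaluation at a point would be a continuous character. Under the L1
  metric a change on a set of small measure is cheap whatever its size there, so all powers of such
  a piece stay small, while the circle has no small subgroups. The 2-adic integers split into
  \<open>2 ^ n\<close> classes of equal measure for every \<open>n\<close>, and their integral is a
  limit of finite averages. Divisibility is needed to extend maps from \<open>C\<close> to all of G;
  the price is that the extensions may kill elements outside \<open>C\<close>. So further norms are
  required, and these must not admit characters either. Norms vanishing on dG cannot disturb the
  members of the family, whose d-th multiples stay dense. A nontrivial finite group, however, has no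
  Hausdorff topology without characters, so finite homocyclic summands of G/dG receive no norm; what
  this leaves unseparated can be separated only by an embedding, hence the enlargement of one member
  of the family. Continuity of a character enters only through one neighbourhood on which it is
  within 1/4 of 1: two such errors still add up to less than 1.\<close>

definition divisible_group :: "('a, 'b) monoid_scheme \<Rightarrow> bool" where
  "divisible_group E \<longleftrightarrow> (\<forall>u\<in>carrier E. \<forall>n::nat. n > 0 \<longrightarrow> (\<exists>v\<in>carrier E. v [^]\<^bsub>E\<^esub> n = u))"

lemma hom_eq_one:
  assumes "group G" "group E" "subgroup H G" "\<phi> \<in> hom (G\<lparr>carrier := H\<rparr>) E"
  shows "\<phi> \<one>\<^bsub>G\<^esub> = \<one>\<^bsub>E\<^esub>"
  using hom_one[OF assms(4) group.subgroup_imp_group[OF assms(1,3)] assms(2)] by simp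

lemma mem_set_mult: "x \<in> A <#>\<^bsub>G\<^esub> B \<longleftrightarrow> (\<exists>a\<in>A. \<exists>b\<in>B. x = a \<otimes>\<^bsub>G\<^esub> b)"
  by (auto simp: set_mult_def)

context comm_group
begin

lemma set_mult_incl:
  assumes "subgroup A G" "subgroup B G"
  shows "A \<subseteq> A <#> B" "B \<subseteq> A <#> B"
proof -
  note AB = subgroup.mem_carrier[OF assms(1)] subgroup.mem_carrier[OF assms(2)]
    subgroup.one_closed[OF assms(1)] subgroup.one_closed[OF assms(2)]
  show "A \<subseteq> A <#> B"
    unfolding mem_set_mult subset_iff using AB by (metis r_one)
  show "B \<subseteq> A <#> B"
    unfolding mem_set_mult subset_iff using AB by (metis l_one)
qed

text \<open>Two factorizations of the same element differ by an element of the intersection of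
  \<open>A\<close> and \<open>B\<close>, where the maps agree; so the product of the values does not
  depend on the choice. Agreement on the intersection covers both the extension of a map by one
  element and the case of independent subgroups.\<close>

lemma hom_glue:
  assumes A: "subgroup A G" and B: "subgroup B G" and E: "comm_group E"
    and \<phi>: "\<phi> \<in> hom (G\<lparr>carrier := A\<rparr>) E" and \<psi>: "\<psi> \<in> hom (G\<lparr>carrier := B\<rparr>) E"
    and agree: "\<And>x. x \<in> A \<Longrightarrow> x \<in> B \<Longrightarrow> \<phi> x = \<psi> x"
  obtains \<theta> where "\<theta> \<in> hom (G\<lparr>carrier := A <#> B\<rparr>) E"
    "\<And>a. a \<in> A \<Longrightarrow> \<theta> a = \<phi> a" "\<And>b. b \<in> B \<Longrightarrow> \<theta> b = \<psi> b"
proof -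
  interpret E: comm_group E by (rule E)
  note memA = subgroup.mem_carrier[OF A] and memB = subgroup.mem_carrier[OF B]
  have \<phi>E: "\<phi> a \<in> carrier E" if "a \<in> A" for a using \<phi> that by (auto simp: hom_def)
  have \<psi>E: "\<psi> b \<in> carrier E" if "b \<in> B" for b using \<psi> that by (auto simp: hom_def)
  have \<phi>m: "\<phi> (a \<otimes> a') = \<phi> a \<otimes>\<^bsub>E\<^esub> \<phi> a'" if "a \<in> A" "a' \<in> A" for a a'
    using \<phi> that by (auto simp: hom_def)
  have \<psi>m: "\<psi> (a \<otimes> a') = \<psi> a \<otimes>\<^bsub>E\<^esub> \<psi> a'" if "a \<in> B" "a' \<in> B" for a a'
    using \<psi> that by (auto simp: hom_def)
  define \<theta> where "\<theta> x = (let p = (SOME p. fst p \<in> A \<and> snd p \<in> B \<and> x = fst p \<otimes> snd p)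
    in \<phi> (fst p) \<otimes>\<^bsub>E\<^esub> \<psi> (snd p))" for x
  have wd: "\<phi> a \<otimes>\<^bsub>E\<^esub> \<psi> b = \<phi> a' \<otimes>\<^bsub>E\<^esub> \<psi> b'"
    if "a \<in> A" "b \<in> B" "a' \<in> A" "b' \<in> B" and eq: "a \<otimes> b = a' \<otimes> b'" for a b a' b'
  proof -
    define c where "c = inv a' \<otimes> a"
    have car: "a \<in> carrier G" "b \<in> carrier G" "a' \<in> carrier G" "b' \<in> carrier G"
      using that memA memB by auto
    have cA: "c \<in> A"
      unfolding c_def using that A by (simp add: subgroup.m_closed subgroup.m_inv_closed)
    have ac: "a = a' \<otimes> c"
      unfolding c_def using car by (simp add: m_assoc[symmetric])
    then have "a' \<otimes> (c \<otimes> b) = a' \<otimes> b'"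
      using eq car memA[OF cA] by (simp add: m_assoc)
    then have bc: "b' = c \<otimes> b"
      using car memA[OF cA] by simp
    then have "c = b' \<otimes> inv b"
      using car memA[OF cA] by (simp add: m_assoc)
    then have cB: "c \<in> B"
      using that B by (simp add: subgroup.m_closed subgroup.m_inv_closed)
    have "\<phi> a = \<phi> a' \<otimes>\<^bsub>E\<^esub> \<phi> c" "\<psi> b' = \<phi> c \<otimes>\<^bsub>E\<^esub> \<psi> b"
      using \<phi>m \<psi>m ac bc cA cB that agree by auto
    then show ?thesis
      using \<phi>E \<psi>E that cA by (simp add: E.m_assoc)
  qed
  have \<theta>: "\<theta> (a \<otimes> b) = \<phi> a \<otimes>\<^bsub>E\<^esub> \<psi> b" if "a \<in> A" "b \<in> B" for a b
  proof -
    define p where "p = (SOME p. fst p \<in> A \<and> snd p \<in> B \<and> a \<otimes> b = fst p \<otimes> snd p)"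
    have "fst p \<in> A \<and> snd p \<in> B \<and> a \<otimes> b = fst p \<otimes> snd p"
      unfolding p_def by (rule someI[of _ "(a, b)"]) (use that in auto)
    then show ?thesis
      unfolding \<theta>_def p_def[symmetric] Let_def using wd that by metis
  qed
  have oneE: "\<phi> \<one> = \<one>\<^bsub>E\<^esub>" "\<psi> \<one> = \<one>\<^bsub>E\<^esub>"
    using hom_eq_one[OF is_group E.is_group A \<phi>] hom_eq_one[OF is_group E.is_group B \<psi>] by auto
  have one: "\<one> \<in> A" "\<one> \<in> B" using A B by (auto simp: subgroup.one_closed)
  show ?thesis
  proof
    show "\<theta> a = \<phi> a" if "a \<in> A" for a
      using \<theta>[OF that one(2)] that memA \<phi>E oneE by simp
    show "\<theta> b = \<psi> b" if "b \<in> B" for b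
      using \<theta>[OF one(1) that] that memB \<psi>E oneE by simp
    show "\<theta> \<in> hom (G\<lparr>carrier := A <#> B\<rparr>) E"
    proof (rule homI)
      fix x assume "x \<in> carrier (G\<lparr>carrier := A <#> B\<rparr>)"
      then show "\<theta> x \<in> carrier E"
        by (auto simp: mem_set_mult \<theta> \<phi>E \<psi>E)
    next
      fix x y assume "x \<in> carrier (G\<lparr>carrier := A <#> B\<rparr>)" "y \<in> carrier (G\<lparr>carrier := A <#> B\<rparr>)"
      then obtain a b a' b' where ab: "a \<in> A" "b \<in> B" "a' \<in> A" "b' \<in> B"
        and x: "x = a \<otimes> b" and y: "y = a' \<otimes> b'"
        by (auto simp: mem_set_mult)
      have "x \<otimes> y = (a \<otimes> a') \<otimes> (b \<otimes> b')"
        unfolding x y using ab memA memB by (simp add: m_ac)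
      then have "\<theta> (x \<otimes> y) = (\<phi> a \<otimes>\<^bsub>E\<^esub> \<phi> a') \<otimes>\<^bsub>E\<^esub> (\<psi> b \<otimes>\<^bsub>E\<^esub> \<psi> b')"
        using \<theta> ab \<phi>m \<psi>m A B by (simp add: subgroup.m_closed)
      also have "\<dots> = (\<phi> a \<otimes>\<^bsub>E\<^esub> \<psi> b) \<otimes>\<^bsub>E\<^esub> (\<phi> a' \<otimes>\<^bsub>E\<^esub> \<psi> b')"
        using ab \<phi>E \<psi>E by (simp add: E.m_ac)
      finally show "\<theta> (x \<otimes>\<^bsub>G\<lparr>carrier := A <#> B\<rparr>\<^esub> y) = \<theta> x \<otimes>\<^bsub>E\<^esub> \<theta> y"
        by (simp add: x y \<theta> ab)
    qed
  qed
qed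

lemma mem_generate_singleton:
  assumes "x \<in> carrier G"
  shows "y \<in> generate G {x} \<longleftrightarrow> (\<exists>k::int. y = x [^] k)"
  using generate_pow[OF assms] by auto

lemma subgroup_generate_singleton: "x \<in> carrier G \<Longrightarrow> subgroup (generate G {x}) G"
  by (rule generate_is_subgroup) auto

lemma hom_cyclic:
  assumes x: "x \<in> carrier G" and E: "comm_group E" and u: "u \<in> carrier E"
    and rel: "\<And>k::int. x [^] k = \<one> \<Longrightarrow> u [^]\<^bsub>E\<^esub> k = \<one>\<^bsub>E\<^esub>"
  obtains \<psi> where "\<psi> \<in> hom (G\<lparr>carrier := generate G {x}\<rparr>) E"
    "\<And>k::int. \<psi> (x [^] k) = u [^]\<^bsub>E\<^esub> k"
proof -
  interpret E: comm_group E by (rule E)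
  define \<psi> where "\<psi> y = u [^]\<^bsub>E\<^esub> (SOME k::int. y = x [^] k)" for y
  have \<psi>: "\<psi> (x [^] k) = u [^]\<^bsub>E\<^esub> k" for k :: int
  proof -
    define l where "l = (SOME l::int. x [^] k = x [^] l)"
    have l: "x [^] k = x [^] l" unfolding l_def by (rule someI[of _ k]) simp
    then have "x [^] (l - k) = \<one>"
      using x by (simp add: int_pow_diff)
    then have "u [^]\<^bsub>E\<^esub> l = u [^]\<^bsub>E\<^esub> (l - k) \<otimes>\<^bsub>E\<^esub> u [^]\<^bsub>E\<^esub> k" "u [^]\<^bsub>E\<^esub> (l - k) = \<one>\<^bsub>E\<^esub>"
      using E.int_pow_mult[OF u, of "l - k" k] rel by auto
    then show ?thesis
      unfolding \<psi>_def l_def[symmetric] using u by simp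
  qed
  have "\<psi> \<in> hom (G\<lparr>carrier := generate G {x}\<rparr>) E"
    using x u by (auto intro!: homI simp: mem_generate_singleton \<psi> int_pow_mult[symmetric]
        E.int_pow_mult[symmetric])
  then show ?thesis using that \<psi> by blast
qed

text \<open>Consistency has to be checked only on the powers of \<open>x\<close> that fall into
  \<open>H\<close>. Those equal to \<open>\<one>\<close> make the map on the cyclic group well
  defined, and the others give the agreement needed for gluing.\<close>

lemma hom_adjoin:
  assumes H: "subgroup H G" and E: "comm_group E" and \<phi>: "\<phi> \<in> hom (G\<lparr>carrier := H\<rparr>) E"
    and x: "x \<in> carrier G" and u: "u \<in> carrier E"
    and rel: "\<And>k::int. x [^] k \<in> H \<Longrightarrow> \<phi> (x [^] k) = u [^]\<^bsub>E\<^esub> k"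
  obtains \<psi> where "\<psi> \<in> hom (G\<lparr>carrier := H <#> generate G {x}\<rparr>) E"
    "\<And>h. h \<in> H \<Longrightarrow> \<psi> h = \<phi> h" "\<And>k::int. \<psi> (x [^] k) = u [^]\<^bsub>E\<^esub> k"
proof -
  interpret E: comm_group E by (rule E)
  have "u [^]\<^bsub>E\<^esub> k = \<one>\<^bsub>E\<^esub>" if "x [^] k = \<one>" for k :: int
    using rel[of k] that hom_eq_one[OF is_group E.is_group H \<phi>] subgroup.one_closed[OF H] by simp
  then obtain \<eta> where \<eta>: "\<eta> \<in> hom (G\<lparr>carrier := generate G {x}\<rparr>) E"
    and \<eta>x: "\<And>k::int. \<eta> (x [^] k) = u [^]\<^bsub>E\<^esub> k"
    using hom_cyclic[OF x E u] by metis
  have "\<phi> y = \<eta> y" if "y \<in> H" "y \<in> generate G {x}" for y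
    using that x rel \<eta>x by (auto simp: mem_generate_singleton)
  then obtain \<theta> where \<theta>: "\<theta> \<in> hom (G\<lparr>carrier := H <#> generate G {x}\<rparr>) E"
    "\<And>a. a \<in> H \<Longrightarrow> \<theta> a = \<phi> a" "\<And>b. b \<in> generate G {x} \<Longrightarrow> \<theta> b = \<eta> b"
    using hom_glue[OF H subgroup_generate_singleton[OF x] E \<phi> \<eta>] by blast
  have "\<theta> (x [^] k) = u [^]\<^bsub>E\<^esub> k" for k :: int
    using \<theta>(3)[of "x [^] k"] \<eta>x x by (auto simp: mem_generate_singleton)
  then show ?thesis using that \<theta> by blast
qed

text \<open>The exponents that bring \<open>x\<close> into \<open>H\<close> form an ideal of the
  integers, and \<open>d\<close> is its positive generator. With \<open>H = {\<one>}\<close> this is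
  the ordinary order.\<close>

lemma relative_order:
  assumes H: "subgroup H G" and x: "x \<in> carrier G" and n: "n > (0::nat)" "x [^] n \<in> H"
  obtains d :: nat where "d > 0" "x [^] d \<in> H" "\<And>k::int. x [^] k \<in> H \<longleftrightarrow> int d dvd k"
    "\<And>j. 0 < j \<Longrightarrow> j < d \<Longrightarrow> x [^] j \<notin> H"
proof -
  define d where "d = (LEAST m::nat. m > 0 \<and> x [^] m \<in> H)"
  have d: "d > 0" "x [^] d \<in> H"
    unfolding d_def using LeastI[of "\<lambda>m. m > 0 \<and> x [^] m \<in> H" n] n by auto
  have least: "x [^] j \<notin> H" if "0 < j" "j < d" for j
    using not_less_Least[of j "\<lambda>m. m > 0 \<and> x [^] m \<in> H"] that unfolding d_def by blast
  have mult: "x [^] (int d * l) \<in> H" for l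
    using subgroup_int_pow_closed[OF H d(2), of l] x by (simp add: int_pow_pow flip: int_pow_int)
  have "int d dvd k" if "x [^] k \<in> H" for k :: int
  proof -
    have "x [^] (k mod int d) = x [^] k \<otimes> inv (x [^] (int d * (k div int d)))"
      using x by (simp add: minus_mult_div_eq_mod[symmetric] int_pow_diff)
    then have "x [^] (k mod int d) \<in> H"
      using that mult H by (simp add: subgroup.m_closed subgroup.m_inv_closed)
    then have "x [^] nat (k mod int d) \<in> H"
      using d(1) by (simp add: int_pow_def2 split: if_splits)
    moreover have "nat (k mod int d) < d"
      using d(1) by (simp add: nat_less_iff)
    ultimately have "nat (k mod int d) = 0"
      using least by blast
    then show ?thesis
      using d(1) by (metis Euclidean_Rings.pos_mod_sign dvd_eq_mod_eq_0 nat_eq_iff2 of_nat_0 of_nat_0_less_iff order_antisym_conv nat_0_iff)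
  qed
  moreover have "x [^] k \<in> H" if "int d dvd k" for k
    using that mult by auto
  ultimately show ?thesis using that d least by blast
qed

text \<open>A single equation suffices: every power of \<open>x\<close> in \<open>H\<close> is a
  power of \<open>x [^] d\<close>, so its prescribed value follows from the one at
  \<open>x [^] d\<close>.\<close>

lemma hom_adjoin_root:
  assumes H: "subgroup H G" and E: "comm_group E" and \<phi>: "\<phi> \<in> hom (G\<lparr>carrier := H\<rparr>) E"
    and x: "x \<in> carrier G" and u: "u \<in> carrier E"
    and d: "x [^] d \<in> H" "u [^]\<^bsub>E\<^esub> (d::nat) = \<phi> (x [^] d)"
    and dvd: "\<And>k::int. x [^] k \<in> H \<Longrightarrow> int d dvd k"
  obtains \<psi> where "\<psi> \<in> hom (G\<lparr>carrier := H <#> generate G {x}\<rparr>) E"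
    "\<And>h. h \<in> H \<Longrightarrow> \<psi> h = \<phi> h" "\<And>k::int. \<psi> (x [^] k) = u [^]\<^bsub>E\<^esub> k"
proof -
  interpret E: comm_group E by (rule E)
  have *: "\<phi> (x [^] (int d * l)) = u [^]\<^bsub>E\<^esub> (int d * l)" for l
  proof -
    have "x [^] (int d * l) = (x [^] d) [^]\<^bsub>G\<lparr>carrier := H\<rparr>\<^esub> l"
      using x int_pow_consistent[OF H d(1)] by (simp add: int_pow_pow flip: int_pow_int)
    then have "\<phi> (x [^] (int d * l)) = \<phi> (x [^] d) [^]\<^bsub>E\<^esub> l"
      using hom_int_pow[OF \<phi>, of "x [^] d" l] d subgroup_imp_group[OF H] E.is_group by simp
    moreover have "u [^]\<^bsub>E\<^esub> (int d * l) = (u [^]\<^bsub>E\<^esub> d) [^]\<^bsub>E\<^esub> l"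
      using E.int_pow_pow[OF u, of "int d" l] by (simp add: int_pow_int)
    ultimately show ?thesis
      by (simp only: d(2))
  qed
  have "\<phi> (x [^] k) = u [^]\<^bsub>E\<^esub> k" if kH: "x [^] k \<in> H" for k :: int
  proof -
    obtain l where "k = int d * l" using dvd[OF kH] by (auto elim: dvdE)
    then show ?thesis by (simp only: *)
  qed
  then show ?thesis using hom_adjoin[OF H E \<phi> x u] that by metis
qed

text \<open>Division of the exponent by \<open>d\<close> with remainder; the multiple of
  \<open>d\<close> is moved into \<open>H\<close>.\<close>

lemma mem_adjoin:
  assumes H: "subgroup H G" and x: "x \<in> carrier G" and d: "d > (0::nat)" "x [^] d \<in> H"
    and y: "y \<in> H <#> generate G {x}"
  obtains h j where "h \<in> H" "j < d" "y = h \<otimes> x [^] j"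
proof -
  obtain h and k :: int where h: "h \<in> H" "y = h \<otimes> x [^] k"
    using y x by (auto simp: mem_set_mult mem_generate_singleton)
  define q where "q = k div int d"
  have "x [^] (int d * q) \<in> H"
    using subgroup_int_pow_closed[OF H d(2), of q] x by (simp add: int_pow_pow flip: int_pow_int)
  then have "h \<otimes> x [^] (int d * q) \<in> H" using h H by (simp add: subgroup.m_closed)
  moreover have "nat (k mod int d) < d" using d(1) by (simp add: nat_less_iff)
  moreover have "y = (h \<otimes> x [^] (int d * q)) \<otimes> x [^] nat (k mod int d)"
  proof -
    have "x [^] nat (k mod int d) = x [^] (k mod int d)"
      using d(1) by (simp flip: int_pow_int)
    moreover have "k = int d * q + k mod int d" by (simp add: q_def)
    then have "x [^] k = x [^] (int d * q) \<otimes> x [^] (k mod int d)"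
      using int_pow_mult[OF x, of "int d * q" "k mod int d"] by simp
    ultimately show ?thesis
      using h x subgroup.mem_carrier[OF H] by (simp add: m_assoc)
  qed
  ultimately show ?thesis by (rule that)
qed

lemma finite_adjoin:
  assumes H: "subgroup H G" and x: "x \<in> carrier G" and d: "d > (0::nat)" "x [^] d \<in> H"
    and fin: "finite H"
  shows "finite (H <#> generate G {x})"
proof (rule finite_subset)
  show "H <#> generate G {x} \<subseteq> (\<lambda>(h, j). h \<otimes> x [^] j) ` (H \<times> {..<d})"
  proof
    fix y assume "y \<in> H <#> generate G {x}"
    then obtain h j where "h \<in> H" "j < d" "y = h \<otimes> x [^] j"
      by (rule mem_adjoin[OF H x d])
    then show "y \<in> (\<lambda>(h, j). h \<otimes> x [^] j) ` (H \<times> {..<d})" by auto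
  qed
qed (use fin in simp)

text \<open>If some positive power of \<open>x\<close> lies in \<open>H\<close>, divisibility
  supplies a \<open>d\<close>-th root of the value already prescribed at \<open>x [^] d\<close>. If
  none does, nothing constrains the value at \<open>x\<close>, and the identity is taken.\<close>

lemma hom_extend_step:
  assumes H: "subgroup H G" and E: "comm_group E" and \<phi>: "\<phi> \<in> hom (G\<lparr>carrier := H\<rparr>) E"
    and div: "divisible_group E" and x: "x \<in> carrier G"
  obtains \<psi> where "\<psi> \<in> hom (G\<lparr>carrier := H <#> generate G {x}\<rparr>) E"
    "\<And>h. h \<in> H \<Longrightarrow> \<psi> h = \<phi> h"
proof (cases "\<exists>n::nat. n > 0 \<and> x [^] n \<in> H")
  case True
  then obtain d :: nat where d: "d > 0" "x [^] d \<in> H"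
    and dvd: "\<And>k::int. x [^] k \<in> H \<longleftrightarrow> int d dvd k"
    using relative_order[OF H x] by metis
  have "\<phi> (x [^] d) \<in> carrier E" using \<phi> d by (auto simp: hom_def)
  then obtain u where u: "u \<in> carrier E" "u [^]\<^bsub>E\<^esub> d = \<phi> (x [^] d)"
    using div d unfolding divisible_group_def by metis
  show ?thesis
    using hom_adjoin_root[OF H E \<phi> x u(1) d(2) u(2)] dvd that by metis
next
  case False
  interpret E: comm_group E by (rule E)
  have "k = 0" if "x [^] k \<in> H" for k :: int
  proof (rule ccontr)
    assume "k \<noteq> 0"
    obtain n where k: "k = int n \<or> k = - int n" by (metis int_cases2)
    have "x [^] (- k) \<in> H"
      using that x subgroup.m_inv_closed[OF H that] by (simp add: int_pow_neg)
    then have "x [^] n \<in> H"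
      using k that int_pow_int[of G x n] by auto
    moreover have "n > 0" using \<open>k \<noteq> 0\<close> k by auto
    ultimately show False using False by blast
  qed
  then have "\<phi> (x [^] k) = \<one>\<^bsub>E\<^esub> [^]\<^bsub>E\<^esub> k" if "x [^] k \<in> H" for k :: int
    using hom_eq_one[OF is_group E.is_group H \<phi>] that by fastforce
  then show ?thesis
    using hom_adjoin[OF H E \<phi> x E.one_closed] that by metis
qed

text \<open>Divisible abelian groups are injective: Zorn's lemma on partial extensions, where the
  one-element step excludes a maximal domain that is proper.\<close>

lemma hom_extend:
  assumes H: "subgroup H G" and E: "comm_group E" and \<phi>: "\<phi> \<in> hom (G\<lparr>carrier := H\<rparr>) E"
    and div: "divisible_group E"
  obtains \<psi> where "\<psi> \<in> hom G E" "\<And>h. h \<in> H \<Longrightarrow> \<psi> h = \<phi> h"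
proof -
  \<comment> \<open>Partial maps are ordered by their graphs over the domain; total functions would
    also be compared at their junk values outside it.\<close>
  define gr where "gr K \<psi> = {(x, \<psi> x) | x. x \<in> K}" for K :: "'a set" and \<psi> :: "'a \<Rightarrow> 'c"
  have gr: "(a, b) \<in> gr K \<psi> \<longleftrightarrow> a \<in> K \<and> b = \<psi> a" for a b K \<psi>
    by (auto simp: gr_def)
  define ok where "ok K \<psi> \<longleftrightarrow> subgroup K G \<and> H \<subseteq> K \<and> \<psi> \<in> hom (G\<lparr>carrier := K\<rparr>) E \<and>
    (\<forall>h\<in>H. \<psi> h = \<phi> h)" for K \<psi>
  define Z where "Z = {gr K \<psi> | K \<psi>. ok K \<psi>}"
  have "\<exists>M\<in>Z. \<forall>X\<in>Z. M \<subseteq> X \<longrightarrow> X = M"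
  proof (rule subset_Zorn_nonempty)
    have "ok H \<phi>" using H \<phi> by (simp add: ok_def)
    then show "Z \<noteq> {}" unfolding Z_def by blast
  next
    fix C assume "C \<noteq> {}" and C: "subset.chain Z C"
    define K where "K = fst ` \<Union>C"
    define \<psi> where "\<psi> x = (SOME y. (x, y) \<in> \<Union>C)" for x
    have CZ: "\<exists>L \<eta>. X = gr L \<eta> \<and> ok L \<eta>" if "X \<in> C" for X
      using C that unfolding subset.chain_def Z_def by blast
    have cmp: "X \<subseteq> Y \<or> Y \<subseteq> X" if "X \<in> C" "Y \<in> C" for X Y
      using C that unfolding subset_chain_def by blast
    have mem: "x \<in> K \<and> \<psi> x = \<eta> x" if "gr L \<eta> \<in> C" "x \<in> L" for L \<eta> x
    proof -
      have xin: "(x, \<eta> x) \<in> \<Union>C" using that unfolding gr_def by blast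
      then have "(x, \<psi> x) \<in> \<Union>C" unfolding \<psi>_def by (rule someI)
      then obtain Y where Y: "Y \<in> C" "(x, \<psi> x) \<in> Y" by blast
      obtain M \<mu> where M: "Y = gr M \<mu>" using CZ[OF Y(1)] by blast
      have "\<psi> x = \<eta> x"
        using cmp[OF that(1) Y(1)]
      proof
        assume "gr L \<eta> \<subseteq> Y"
        then have "(x, \<eta> x) \<in> gr M \<mu>" using that(2) gr unfolding M by blast
        then show ?thesis using Y(2) unfolding M by (simp add: gr)
      next
        assume "Y \<subseteq> gr L \<eta>"
        then have "(x, \<psi> x) \<in> gr L \<eta>" using Y(2) by blast
        then show ?thesis by (simp add: gr)
      qed
      then show ?thesis using xin unfolding K_def by force
    qed
    have two: "\<exists>L \<eta>. gr L \<eta> \<in> C \<and> ok L \<eta> \<and> x \<in> L \<and> y \<in> L" if xy: "x \<in> K" "y \<in> K" for x y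
    proof -
      obtain X Y where "X \<in> C" "x \<in> fst ` X" "Y \<in> C" "y \<in> fst ` Y"
        using xy unfolding K_def by blast
      then obtain W where W: "W \<in> C" "x \<in> fst ` W" "y \<in> fst ` W"
        using cmp by blast
      then obtain L \<eta> where "W = gr L \<eta>" "ok L \<eta>" using CZ by blast
      then show ?thesis using W unfolding gr_def by force
    qed
    obtain X where "X \<in> C" using \<open>C \<noteq> {}\<close> by blast
    then obtain L0 \<eta>0 where L0: "gr L0 \<eta>0 \<in> C" "ok L0 \<eta>0" using CZ by blast
    have HK: "H \<subseteq> K" "\<forall>h\<in>H. \<psi> h = \<phi> h"
      using mem[OF L0(1)] L0(2) unfolding ok_def by (blast, metis subsetD)
    have "subgroup K G"
    proof (rule subgroupI)
      show "K \<subseteq> carrier G" using two unfolding ok_def by (meson subgroup.mem_carrier subsetI)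
      show "K \<noteq> {}" using HK subgroup.one_closed[OF H] by blast
      show "inv a \<in> K" if "a \<in> K" for a
        using two[OF that that] mem unfolding ok_def by (meson subgroup.m_inv_closed)
      show "a \<otimes> b \<in> K" if "a \<in> K" "b \<in> K" for a b
        using two[OF that] mem unfolding ok_def by (meson subgroup.m_closed)
    qed
    moreover have "\<psi> \<in> hom (G\<lparr>carrier := K\<rparr>) E"
    proof (rule homI)
      fix x assume "x \<in> carrier (G\<lparr>carrier := K\<rparr>)"
      then obtain L \<eta> where L: "gr L \<eta> \<in> C" "ok L \<eta>" "x \<in> L" using two by fastforce
      then have "\<eta> x \<in> carrier E" unfolding ok_def hom_def by auto
      then show "\<psi> x \<in> carrier E" using mem L by metis
    next
      fix x y assume "x \<in> carrier (G\<lparr>carrier := K\<rparr>)" "y \<in> carrier (G\<lparr>carrier := K\<rparr>)"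
      then obtain L \<eta> where L: "gr L \<eta> \<in> C" "ok L \<eta>" "x \<in> L" "y \<in> L" using two by fastforce
      then have "x \<otimes> y \<in> L" "\<eta> (x \<otimes> y) = \<eta> x \<otimes>\<^bsub>E\<^esub> \<eta> y"
        unfolding ok_def hom_def by (auto simp: subgroup.m_closed)
      then show "\<psi> (x \<otimes>\<^bsub>G\<lparr>carrier := K\<rparr>\<^esub> y) = \<psi> x \<otimes>\<^bsub>E\<^esub> \<psi> y"
        using mem L by simp
    qed
    ultimately have "ok K \<psi>" using HK unfolding ok_def by blast
    moreover have "\<Union>C = gr K \<psi>"
    proof -
      have fwd: "x \<in> K \<and> y = \<psi> x" if xy: "(x, y) \<in> \<Union>C" for x y
      proof -
        obtain Y where Y: "Y \<in> C" "(x, y) \<in> Y" using xy by blast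
        then obtain L \<eta> where L: "Y = gr L \<eta>" "ok L \<eta>" using CZ by blast
        then have "y = \<eta> x" "x \<in> L" using Y unfolding gr_def by auto
        then show ?thesis using mem[of L \<eta> x] Y(1) L(1) by simp
      qed
      have bwd: "(x, \<psi> x) \<in> \<Union>C" if "x \<in> K" for x
      proof -
        have "\<exists>y. (x, y) \<in> \<Union>C" using \<open>x \<in> K\<close> unfolding K_def by force
        then show ?thesis unfolding \<psi>_def by (rule someI_ex)
      qed
      have eq: "(x, y) \<in> \<Union>C \<longleftrightarrow> (x, y) \<in> gr K \<psi>" for x y
        unfolding gr
      proof (rule iffI, rule fwd)
        assume "x \<in> K \<and> y = \<psi> x"
        then show "(x, y) \<in> \<Union>C" using bwd[of x] by simp
      qed
      show ?thesis
      proof (rule Set.set_eqI)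
        show "p \<in> \<Union>C \<longleftrightarrow> p \<in> gr K \<psi>" for p by (cases p) (simp only: eq)
      qed
    qed
    ultimately show "\<Union>C \<in> Z" unfolding Z_def by blast
  qed
  then obtain M where M: "M \<in> Z" "\<And>X. X \<in> Z \<Longrightarrow> M \<subseteq> X \<Longrightarrow> X = M" by blast
  then obtain K \<psi> where K: "ok K \<psi>" "M = gr K \<psi>" unfolding Z_def by blast
  have max: "gr L \<eta> = gr K \<psi>" if "ok L \<eta>" "gr K \<psi> \<subseteq> gr L \<eta>" for L \<eta>
  proof -
    have "gr L \<eta> \<in> Z" unfolding Z_def using that(1) by blast
    then show ?thesis using M(2) that(2) K(2) by simp
  qed
  have "x \<in> K" if x: "x \<in> carrier G" for x
  proof -
    have sK: "subgroup K G" "\<psi> \<in> hom (G\<lparr>carrier := K\<rparr>) E" using K unfolding ok_def by auto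
    obtain \<eta> where \<eta>: "\<eta> \<in> hom (G\<lparr>carrier := K <#> generate G {x}\<rparr>) E" "\<And>h. h \<in> K \<Longrightarrow> \<eta> h = \<psi> h"
      using hom_extend_step[OF sK(1) E sK(2) div x] by blast
    note inc = set_mult_incl[OF sK(1) subgroup_generate_singleton[OF x]]
    have "ok (K <#> generate G {x}) \<eta>"
      using K \<eta> inc mult_subgroups[OF sK(1) subgroup_generate_singleton[OF x]]
      unfolding ok_def by auto
    moreover have "gr K \<psi> \<subseteq> gr (K <#> generate G {x}) \<eta>"
      using inc \<eta> unfolding gr_def by auto
    ultimately have "gr (K <#> generate G {x}) \<eta> = gr K \<psi>" by (rule max)
    moreover have "x \<in> K <#> generate G {x}"
      using inc(2) generate.incl[of x "{x}" G] by blast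
    then have "(x, \<eta> x) \<in> gr (K <#> generate G {x}) \<eta>" by (simp add: gr)
    ultimately show ?thesis by (simp add: gr)
  qed
  moreover have "K \<subseteq> carrier G"
    using K(1) unfolding ok_def by (simp add: subgroup.subset)
  ultimately have "K = carrier G" by (intro antisym subsetI) auto
  then have "\<psi> \<in> hom G E" "\<And>h. h \<in> H \<Longrightarrow> \<psi> h = \<phi> h"
    using K(1) unfolding ok_def by (simp_all add: hom_def)
  then show ?thesis by (rule that)
qed

end

section \<open>Nearly periodic circle-valued functions\<close>

text \<open>Uniform continuity for the 2-adic metric on the natural numbers. These are dense in the
  2-adic integers, so exactly the restrictions of continuous functions are obtained.\<close>

definition nearly_periodic :: "(nat \<Rightarrow> complex) \<Rightarrow> bool" where
  "nearly_periodic u \<longleftrightarrow>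
     (\<forall>e>0. \<exists>n. \<forall>i j. i mod 2 ^ n = j mod 2 ^ n \<longrightarrow> cmod (u i - u j) < e)"

definition periodic :: "nat \<Rightarrow> (nat \<Rightarrow> complex) \<Rightarrow> bool" where
  "periodic n u \<longleftrightarrow> (\<forall>i j. i mod 2 ^ n = j mod 2 ^ n \<longrightarrow> u i = u j)"

definition circle_fun :: "(nat \<Rightarrow> complex) monoid" where
  "circle_fun = \<lparr>carrier = {u. (\<forall>i. cmod (u i) = 1) \<and> nearly_periodic u},
     monoid.mult = (\<lambda>u v i. u i * v i), one = (\<lambda>i. 1)\<rparr>"

section \<open>Integration over the 2-adic integers by averaging over residues\<close>

definition avg :: "(nat \<Rightarrow> complex) \<Rightarrow> nat \<Rightarrow> real" where
  "avg u n = (\<Sum>i<2 ^ n. cmod (u i - 1)) / 2 ^ n"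

text \<open>The Haar integral of the distance from \<open>u i\<close> to 1, that is, the L1 distance
  of \<open>u\<close> from the identity.\<close>

definition mean :: "(nat \<Rightarrow> complex) \<Rightarrow> real" where
  "mean u = lim (avg u)"

lemma mod_pow_le:
  fixes i j :: nat
  assumes "m \<le> n" and "i mod 2 ^ n = j mod 2 ^ n"
  shows "i mod 2 ^ m = j mod 2 ^ m"
  using assms by (metis le_imp_power_dvd mod_mod_cancel)

lemma periodic_mono: "periodic m u \<Longrightarrow> m \<le> n \<Longrightarrow> periodic n u"
  unfolding periodic_def using mod_pow_le by blast

lemma periodic_nearly: "periodic n u \<Longrightarrow> nearly_periodic u"
  unfolding periodic_def nearly_periodic_def by (metis norm_zero right_minus_eq)

lemma mem_circle_fun: "u \<in> carrier circle_fun \<longleftrightarrow> (\<forall>i. cmod (u i) = 1) \<and> nearly_periodic u"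
  by (simp add: circle_fun_def)

lemma mult_circle_fun: "u \<otimes>\<^bsub>circle_fun\<^esub> v = (\<lambda>i. u i * v i)"
  by (simp add: circle_fun_def)

lemma one_circle_fun: "\<one>\<^bsub>circle_fun\<^esub> = (\<lambda>i. 1)"
  by (simp add: circle_fun_def)

lemma nearly_periodic_mult:
  assumes "nearly_periodic u" "nearly_periodic v"
    and "\<And>i. cmod (u i) = 1" "\<And>i. cmod (v i) = 1"
  shows "nearly_periodic (\<lambda>i. u i * v i)"
  unfolding nearly_periodic_def
proof (intro allI impI)
  fix e :: real assume "e > 0"
  then have "e / 2 > 0" by simp
  then obtain m n where m: "\<And>i j. i mod 2 ^ m = j mod 2 ^ m \<Longrightarrow> cmod (u i - u j) < e / 2"
    and n: "\<And>i j. i mod 2 ^ n = j mod 2 ^ n \<Longrightarrow> cmod (v i - v j) < e / 2"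
    using assms(1,2) unfolding nearly_periodic_def by metis
  have "cmod (u i * v i - u j * v j) < e" if "i mod 2 ^ max m n = j mod 2 ^ max m n" for i j
  proof -
    have 1: "cmod (u i - u j) < e / 2" "cmod (v i - v j) < e / 2"
      using m n mod_pow_le[OF _ that] by auto
    have "u i * v i - u j * v j = (u i - u j) * v i + u j * (v i - v j)"
      by (simp add: algebra_simps)
    then have "cmod (u i * v i - u j * v j) \<le> cmod ((u i - u j) * v i) + cmod (u j * (v i - v j))"
      by (metis norm_triangle_ineq)
    also have "\<dots> = cmod (u i - u j) + cmod (v i - v j)"
      by (simp add: norm_mult assms)
    finally show ?thesis using 1 by linarith
  qed
  then show "\<exists>n. \<forall>i j. i mod 2 ^ n = j mod 2 ^ n \<longrightarrow> cmod (u i * v i - u j * v j) < e"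
    by blast
qed

lemma nearly_periodic_cnj: "nearly_periodic u \<Longrightarrow> nearly_periodic (\<lambda>i. cnj (u i))"
  unfolding nearly_periodic_def by (metis complex_cnj_diff complex_mod_cnj)

lemma comm_group_circle_fun: "comm_group circle_fun"
proof (rule comm_groupI)
  fix u assume u: "u \<in> carrier circle_fun"
  have "cnj (u i) * u i = 1" for i
    using u by (metis complex_norm_square mem_circle_fun mult.commute of_real_1 power_one)
  then have "(\<lambda>i. cnj (u i)) \<otimes>\<^bsub>circle_fun\<^esub> u = \<one>\<^bsub>circle_fun\<^esub>"
    by (simp add: mult_circle_fun one_circle_fun)
  moreover have "(\<lambda>i. cnj (u i)) \<in> carrier circle_fun"
    using u by (simp add: mem_circle_fun nearly_periodic_cnj)
  ultimately show "\<exists>v\<in>carrier circle_fun. v \<otimes>\<^bsub>circle_fun\<^esub> u = \<one>\<^bsub>circle_fun\<^esub>"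
    by blast
qed (auto simp: circle_fun_def nearly_periodic_mult norm_mult mult_ac
    intro: periodic_nearly[of 0] simp: periodic_def)

interpretation CF: comm_group circle_fun
  by (rule comm_group_circle_fun)

lemma cmod_circle_fun: "u \<in> carrier circle_fun \<Longrightarrow> cmod (u i) = 1"
  by (simp add: mem_circle_fun)

lemma nonzero_circle_fun: "u \<in> carrier circle_fun \<Longrightarrow> u i \<noteq> 0"
  using cmod_circle_fun[of u i] by auto

lemma inv_circle_fun:
  assumes "u \<in> carrier circle_fun"
  shows "inv\<^bsub>circle_fun\<^esub> u = (\<lambda>i. inverse (u i))"
proof -
  have "(inv\<^bsub>circle_fun\<^esub> u) i * u i = 1" for i
    using CF.l_inv[OF assms] by (metis mult_circle_fun one_circle_fun)
  then show ?thesis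
    by (metis inverse_unique mult.commute)
qed

lemma pow_circle_fun: "u [^]\<^bsub>circle_fun\<^esub> (n::nat) = (\<lambda>i. u i ^ n)"
  by (induction n) (auto simp: one_circle_fun mult_circle_fun mult.commute)

lemma cmod_mult_sub_one:
  assumes "cmod a = 1"
  shows "cmod (a * b - 1) \<le> cmod (a - 1) + cmod (b - 1)"
proof -
  have "a * b - 1 = a * (b - 1) + (a - 1)"
    by (simp add: algebra_simps)
  then have "cmod (a * b - 1) \<le> cmod (a * (b - 1)) + cmod (a - 1)"
    by (metis norm_triangle_ineq)
  then show ?thesis
    by (simp add: norm_mult assms)
qed

lemma cmod_inverse_sub_one:
  assumes "cmod a = 1"
  shows "cmod (inverse a - 1) = cmod (a - 1)"
proof -
  have "a \<noteq> 0" using assms by auto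
  then have "inverse a - 1 = inverse a * (1 - a)"
    by (simp add: algebra_simps)
  then show ?thesis
    by (simp add: norm_mult norm_inverse assms norm_minus_commute)
qed

lemma avg_nonneg: "avg u n \<ge> 0"
  by (simp add: avg_def sum_nonneg)

text \<open>A complete residue system modulo \<open>2 ^ m\<close> splits into blocks of length
  \<open>2 ^ n\<close>, and on each block \<open>u\<close> differs from its values on the first
  block by at most \<open>e\<close>. For nearly periodic functions the averages therefore form a
  Cauchy sequence.\<close>

lemma avg_diff_le:
  assumes e: "\<And>i j. i mod 2 ^ n = j mod 2 ^ n \<Longrightarrow> cmod (u i - u j) \<le> e" and "n \<le> m"
  shows "\<bar>avg u m - avg u n\<bar> \<le> e"
proof -
  let ?g = "\<lambda>i. cmod (u i - 1)"
  let ?k = "2 ^ n :: nat" and ?q = "2 ^ (m - n) :: nat"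
  have pw: "(2::nat) ^ m = ?q * ?k" "(2::real) ^ m = 2 ^ (m - n) * 2 ^ n"
    using \<open>n \<le> m\<close> by (simp_all flip: power_add)
  have blk: "(\<Sum>i\<in>{b * ?k..<b * ?k + ?k}. ?g i) = (\<Sum>r<?k. ?g (b * ?k + r))" for b
    using sum.shift_bounds_nat_ivl[of ?g 0 "b * ?k" ?k]
    by (simp add: lessThan_atLeast0 add.commute)
  have "(\<Sum>i<2 ^ m. ?g i) = (\<Sum>b<?q. \<Sum>r<?k. ?g (b * ?k + r))"
    unfolding pw(1) by (subst sum.nat_group[symmetric]) (simp only: blk)
  moreover have "2 ^ (m - n) * (\<Sum>i<2 ^ n. ?g i) = (\<Sum>b<?q. \<Sum>r<?k. ?g r)"
    by simp
  ultimately have "(\<Sum>i<2 ^ m. ?g i) - 2 ^ (m - n) * (\<Sum>i<2 ^ n. ?g i)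
      = (\<Sum>b<?q. \<Sum>r<?k. ?g (b * ?k + r) - ?g r)"
    by (simp only: sum_subtractf)
  also have "\<bar>\<dots>\<bar> \<le> (\<Sum>b<?q. \<Sum>r<?k. e)"
  proof (intro order_trans[OF sum_abs] sum_mono)
    fix b r
    have "\<bar>?g (b * ?k + r) - ?g r\<bar> \<le> cmod (u (b * ?k + r) - u r)"
      using norm_triangle_ineq3[of "u (b * ?k + r) - 1" "u r - 1"] by simp
    then show "\<bar>?g (b * ?k + r) - ?g r\<bar> \<le> e"
      using e[of "b * ?k + r" r] by simp
  qed
  also have "\<dots> = 2 ^ m * e"
    by (simp add: pw(2))
  finally have *: "\<bar>(\<Sum>i<2 ^ m. ?g i) - 2 ^ (m - n) * (\<Sum>i<2 ^ n. ?g i)\<bar> \<le> 2 ^ m * e" .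
  have "avg u m - avg u n = ((\<Sum>i<2 ^ m. ?g i) - 2 ^ (m - n) * (\<Sum>i<2 ^ n. ?g i)) / 2 ^ m"
    unfolding avg_def pw(2) by (simp add: field_simps)
  then show ?thesis
    using * by (simp add: abs_divide divide_le_eq mult.commute)
qed

lemma avg_convergent:
  assumes "nearly_periodic u"
  shows "avg u \<longlonglongrightarrow> mean u"
proof -
  have "Cauchy (avg u)"
  proof (rule CauchyI')
    fix e :: real assume "e > 0"
    then obtain n where n: "\<And>i j. i mod 2 ^ n = j mod 2 ^ n \<Longrightarrow> cmod (u i - u j) < e / 3"
      using assms unfolding nearly_periodic_def by (meson divide_pos_pos zero_less_numeral)
    have "norm (avg u m - avg u k) < e" if "m \<ge> n" "k > m" for m k
    proof -
      have "\<bar>avg u m - avg u n\<bar> \<le> e / 3" "\<bar>avg u k - avg u n\<bar> \<le> e / 3"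
        using that avg_diff_le[of n u "e / 3", OF less_imp_le[OF n]] by auto
      then show ?thesis using \<open>e > 0\<close> unfolding real_norm_def by linarith
    qed
    then show "\<exists>M. \<forall>m\<ge>M. \<forall>n>m. dist (avg u m) (avg u n) < e"
      unfolding dist_norm by blast
  qed
  then show ?thesis
    unfolding mean_def by (rule convergent_LIMSEQ_iff[THEN iffD1, OF Cauchy_convergent])
qed

lemma avg_circle_fun: "u \<in> carrier circle_fun \<Longrightarrow> avg u \<longlonglongrightarrow> mean u"
  by (simp add: avg_convergent mem_circle_fun)

lemma mean_nonneg: "u \<in> carrier circle_fun \<Longrightarrow> mean u \<ge> 0"
  by (rule LIMSEQ_le_const[OF avg_circle_fun]) (auto simp: avg_nonneg)

lemma mean_one: "mean (\<lambda>i. 1) = 0"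
proof -
  have "avg (\<lambda>i. 1) = (\<lambda>n. 0)"
    by (simp add: avg_def fun_eq_iff)
  then show ?thesis
    by (simp add: mean_def)
qed

lemma mean_mult:
  assumes u: "u \<in> carrier circle_fun" and v: "v \<in> carrier circle_fun"
  shows "mean (u \<otimes>\<^bsub>circle_fun\<^esub> v) \<le> mean u + mean v"
proof (rule LIMSEQ_le[OF avg_circle_fun tendsto_add[OF avg_circle_fun[OF u] avg_circle_fun[OF v]]])
  show "u \<otimes>\<^bsub>circle_fun\<^esub> v \<in> carrier circle_fun"
    using u v by simp
  have "avg (u \<otimes>\<^bsub>circle_fun\<^esub> v) n \<le> avg u n + avg v n" for n
    unfolding avg_def mult_circle_fun add_divide_distrib[symmetric] sum.distrib[symmetric]
    by (intro divide_right_mono sum_mono cmod_mult_sub_one)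
      (auto simp: cmod_circle_fun[OF u])
  then show "\<exists>N. \<forall>n\<ge>N. avg (u \<otimes>\<^bsub>circle_fun\<^esub> v) n \<le> avg u n + avg v n"
    by blast
qed

lemma mean_inv:
  assumes "u \<in> carrier circle_fun"
  shows "mean (inv\<^bsub>circle_fun\<^esub> u) = mean u"
proof -
  have "avg (inv\<^bsub>circle_fun\<^esub> u) = avg u"
    by (simp add: avg_def fun_eq_iff inv_circle_fun assms cmod_inverse_sub_one cmod_circle_fun)
  then show ?thesis
    by (simp add: mean_def)
qed

lemma mean_le:
  assumes "u \<in> carrier circle_fun" and "\<And>i. cmod (u i - 1) \<le> e"
  shows "mean u \<le> e"
proof (rule LIMSEQ_le_const2[OF avg_circle_fun[OF assms(1)]])
  have "avg u n \<le> e" for n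
  proof -
    have "(\<Sum>i<2 ^ n. cmod (u i - 1)) \<le> (\<Sum>i<(2::nat) ^ n. e)"
      by (intro sum_mono assms)
    then show ?thesis
      by (simp add: avg_def divide_le_eq mult.commute)
  qed
  then show "\<exists>N. \<forall>n\<ge>N. avg u n \<le> e" by blast
qed

lemma card_class:
  fixes r :: nat
  assumes "n \<le> m"
  shows "card {i \<in> {..<2 ^ m}. i mod 2 ^ n = r} \<le> (2::nat) ^ (m - n)"
proof -
  have "{i \<in> {..<2 ^ m}. i mod 2 ^ n = r} \<subseteq> (\<lambda>q. q * 2 ^ n + r) ` {..<(2::nat) ^ (m - n)}"
  proof
    fix i :: nat assume i: "i \<in> {i \<in> {..<2 ^ m}. i mod 2 ^ n = r}"
    then have "i div 2 ^ n < 2 ^ (m - n)"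
      using assms by (simp add: less_mult_imp_div_less flip: power_add)
    moreover have "i = i div 2 ^ n * 2 ^ n + r"
      using i by (metis (mono_tags, lifting) div_mult_mod_eq mem_Collect_eq)
    ultimately show "i \<in> (\<lambda>q. q * 2 ^ n + r) ` {..<2 ^ (m - n)}"
      by (intro image_eqI) auto
  qed
  then show ?thesis
    by (rule order_trans[OF surj_card_le[OF finite_lessThan]]) simp
qed

text \<open>A residue class modulo \<open>2 ^ n\<close> has measure \<open>1 / 2 ^ n\<close>, and
  two points of the unit circle have distance at most 2. The bound does not involve the values of
  \<open>u\<close> on the class, so it holds for all powers of \<open>u\<close> at once.\<close>

lemma mean_class:
  assumes u: "u \<in> carrier circle_fun" and one: "\<And>i. i mod 2 ^ n \<noteq> r \<Longrightarrow> u i = 1"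
  shows "mean u \<le> 2 / 2 ^ n"
proof (rule LIMSEQ_le_const2[OF avg_circle_fun[OF u]])
  have "avg u m \<le> 2 / 2 ^ n" if "m \<ge> n" for m
  proof -
    have le2: "cmod (u i - 1) \<le> 2" for i
      using norm_triangle_ineq4[of "u i" 1] cmod_circle_fun[OF u] by simp
    have "(\<Sum>i<2 ^ m. cmod (u i - 1)) = (\<Sum>i | i \<in> {..<2 ^ m} \<and> i mod 2 ^ n = r. cmod (u i - 1))"
      by (rule sum.mono_neutral_right) (auto simp: one)
    also have "\<dots> \<le> of_nat (card {i \<in> {..<2 ^ m}. i mod 2 ^ n = r}) * 2"
      using sum_bounded_above[OF le2] by simp
    also have "\<dots> \<le> of_nat (2 ^ (m - n)) * (2::real)"
      using card_class[OF that, of r] by (intro mult_right_mono) (simp_all del: of_nat_power)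
    finally have "(\<Sum>i<2 ^ m. cmod (u i - 1)) \<le> 2 ^ (m - n) * 2"
      by simp
    moreover have "(2::real) ^ m = 2 ^ (m - n) * 2 ^ n"
      using that by (simp flip: power_add)
    ultimately show ?thesis
      by (simp add: avg_def field_simps)
  qed
  then show "\<exists>N. \<forall>m\<ge>N. avg u m \<le> 2 / 2 ^ n" by blast
qed

text \<open>Near periodicity keeps \<open>u\<close> away from 1 on a whole residue class around a
  point where it differs from 1, and that class has positive measure. This is the source of the
  Hausdorff property.\<close>

lemma mean_pos:
  assumes u: "u \<in> carrier circle_fun" and ne: "u \<noteq> (\<lambda>i. 1)"
  shows "mean u > 0"
proof -
  obtain i0 where i0: "u i0 \<noteq> 1" using ne by auto
  define d where "d = cmod (u i0 - 1)"
  have "d > 0" using i0 by (simp add: d_def)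
  then obtain n where n: "\<And>i j. i mod 2 ^ n = j mod 2 ^ n \<Longrightarrow> cmod (u i - u j) < d / 2"
    using u unfolding mem_circle_fun nearly_periodic_def by (meson half_gt_zero)
  let ?r = "i0 mod 2 ^ n"
  have "avg u m \<ge> d / 2 / 2 ^ n" if "m \<ge> n" for m
  proof -
    let ?S = "(\<lambda>q. q * 2 ^ n + ?r) ` {..<(2::nat) ^ (m - n)}"
    have inj: "inj_on (\<lambda>q. q * 2 ^ n + ?r) {..<(2::nat) ^ (m - n)}"
      by (auto simp: inj_on_def)
    have sub: "?S \<subseteq> {..<2 ^ m}"
    proof (rule image_subsetI)
      fix q :: nat assume "q \<in> {..<2 ^ (m - n)}"
      then have "Suc q * 2 ^ n \<le> 2 ^ (m - n) * 2 ^ n"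
        by (intro mult_right_mono) auto
      also have "\<dots> = 2 ^ m" using that by (simp flip: power_add)
      finally show "q * 2 ^ n + ?r \<in> {..<2 ^ m}"
        using mod_less_divisor[of "2 ^ n" i0] by (auto simp del: mod_less_divisor)
    qed
    have "d / 2 * 2 ^ (m - n) = (\<Sum>i\<in>?S. d / 2)"
      by (simp add: card_image[OF inj])
    also have "\<dots> \<le> (\<Sum>i\<in>?S. cmod (u i - 1))"
    proof (rule sum_mono)
      fix i assume "i \<in> ?S"
      then have "i mod 2 ^ n = i0 mod 2 ^ n" by auto
      then have "cmod (u i0 - u i) < d / 2" by (intro n) simp
      then show "d / 2 \<le> cmod (u i - 1)"
        using norm_triangle_ineq[of "u i0 - u i" "u i - 1"] by (simp add: d_def)
    qed
    also have "\<dots> \<le> (\<Sum>i<2 ^ m. cmod (u i - 1))"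
      by (rule sum_mono2[OF _ sub]) auto
    finally have "d / 2 * 2 ^ (m - n) \<le> (\<Sum>i<2 ^ m. cmod (u i - 1))" .
    moreover have "(2::real) ^ m = 2 ^ (m - n) * 2 ^ n"
      using that by (simp flip: power_add)
    ultimately show ?thesis
      by (simp add: avg_def field_simps)
  qed
  then have "mean u \<ge> d / 2 / 2 ^ n"
    by (intro LIMSEQ_le_const[OF avg_circle_fun[OF u]]) auto
  moreover have "0 < d / 2 / 2 ^ n"
    using \<open>d > 0\<close> by simp
  ultimately show ?thesis
    by (rule less_le_trans[rotated])
qed

section \<open>Roots of circle-valued functions\<close>

lemma norm_cis_diff_le: "cmod (cis a - cis b) \<le> \<bar>a - b\<bar>"
proof -
  have "cis a - cis b = cis b * (cis (a - b) - 1)"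
    by (simp add: algebra_simps cis_mult)
  then have "cmod (cis a - cis b) = cmod (exp (\<i> * of_real (a - b)) - 1)"
    by (simp add: norm_mult cis_conv_exp)
  also have "\<dots> = 2 * \<bar>sin ((a - b) / 2)\<bar>"
    using dist_exp_i_1[of "a - b"] by simp
  also have "\<dots> \<le> \<bar>a - b\<bar>"
    using abs_sin_x_le_abs_x[of "(a - b) / 2"] by simp
  finally show ?thesis .
qed

definition principal_root :: "nat \<Rightarrow> complex \<Rightarrow> complex" where
  "principal_root n z = cis (Arg z / n)"

lemma cmod_principal_root [simp]: "cmod (principal_root n z) = 1"
  by (simp add: principal_root_def)

lemma principal_root_pow: "cmod z = 1 \<Longrightarrow> n > 0 \<Longrightarrow> principal_root n z ^ n = z"
  using rcis_cmod_Arg[of z] unfolding principal_root_def Complex.DeMoivre by (simp add: rcis_def)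

text \<open>The constant 4 is a bound for \<open>pi\<close>, which bounds \<open>Arg\<close>.
  However far \<open>z\<close> is from 1, its principal roots of high degree are close to 1.\<close>

lemma principal_root_near_one: "n > 0 \<Longrightarrow> cmod (principal_root n z - 1) \<le> 4 / n"
proof -
  assume "n > 0"
  have "cmod (principal_root n z - 1) \<le> \<bar>Arg z\<bar> / n"
    using norm_cis_diff_le[of "Arg z / n" 0] by (simp add: principal_root_def abs_divide)
  also have "\<dots> \<le> 4 / n"
    using mpi_less_Arg[of z] Arg_le_pi[of z] pi_less_4 by (intro divide_right_mono) auto
  finally show ?thesis .
qed

text \<open>The closed disc of radius 1/2 about 1 avoids the branch cut of \<open>Arg\<close> along
  the nonpositive reals, and on a compact set continuity is uniform.\<close>

lemma principal_root_uniformly_continuous: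
  assumes "n > 0" "e > 0"
  obtains d where "d > 0"
    "\<And>z w. cmod (z - 1) \<le> 1 / 2 \<Longrightarrow> cmod (w - 1) \<le> 1 / 2 \<Longrightarrow> cmod (z - w) < d \<Longrightarrow>
       cmod (principal_root n z - principal_root n w) < e"
proof -
  have "z \<notin> \<real>\<^sub>\<le>\<^sub>0" if "z \<in> cball 1 (1 / 2)" for z :: complex
  proof
    assume "z \<in> \<real>\<^sub>\<le>\<^sub>0"
    then have "Re z \<le> 0" by (auto simp: complex_nonpos_Reals_iff)
    then show False
      using abs_Re_le_cmod[of "1 - z"] that by (simp add: dist_norm)
  qed
  then have "continuous_on (cball 1 (1 / 2)) (principal_root n)"
    unfolding principal_root_def cis_conv_exp
    using \<open>n > 0\<close>
    by (intro continuous_intros continuous_at_imp_continuous_on ballI continuous_at_Arg) auto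
  then have "uniformly_continuous_on (cball 1 (1 / 2)) (principal_root n)"
    by (rule compact_uniformly_continuous) simp
  then obtain d where "d > 0" "\<forall>x\<in>cball 1 (1 / 2). \<forall>x'\<in>cball 1 (1 / 2). dist x' x < d \<longrightarrow>
      dist (principal_root n x') (principal_root n x) < e"
    unfolding uniformly_continuous_on_def using assms by metis
  then show ?thesis
    by (intro that[of d]) (auto simp: dist_norm norm_minus_commute)
qed

text \<open>A pointwise principal root of \<open>u\<close> may jump where \<open>u\<close> crosses
  -1. So \<open>u\<close> is written as \<open>v\<close> times \<open>q\<close>, with
  \<open>v\<close> periodic, where any pointwise root is periodic again, and \<open>q\<close> within
  1/2 of 1, where the principal root is uniformly continuous.\<close>

lemma divisible_circle_fun: "divisible_group circle_fun"
  unfolding divisible_group_def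
proof (intro ballI allI impI)
  fix u and n :: nat assume u: "u \<in> carrier circle_fun" and "n > 0"
  obtain p where p: "\<And>i j. i mod 2 ^ p = j mod 2 ^ p \<Longrightarrow> cmod (u i - u j) < 1 / 2"
    using u unfolding mem_circle_fun nearly_periodic_def by (meson half_gt_zero zero_less_one)
  define v where "v i = u (i mod 2 ^ p)" for i
  have v: "periodic p v" "\<And>i. cmod (v i) = 1"
    using u by (auto simp: periodic_def v_def mem_circle_fun)
  have vC: "v \<in> carrier circle_fun"
    using v periodic_nearly by (auto simp: mem_circle_fun)
  define q where "q = u \<otimes>\<^bsub>circle_fun\<^esub> inv\<^bsub>circle_fun\<^esub> v"
  have q: "q \<in> carrier circle_fun" using u vC by (simp add: q_def)
  have qi: "q i = u i / v i" for i
    by (simp add: q_def mult_circle_fun inv_circle_fun vC divide_inverse)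
  have q1: "cmod (q i - 1) \<le> 1 / 2" for i
  proof -
    have "q i - 1 = (u i - v i) / v i"
      using v(2)[of i] by (auto simp: qi diff_divide_distrib)
    then have "cmod (q i - 1) = cmod (u i - v i)"
      by (simp add: norm_divide v)
    then show ?thesis using p[of i "i mod 2 ^ p"] by (simp add: v_def)
  qed
  define w where "w i = principal_root n (v i) * principal_root n (q i)" for i
  have "nearly_periodic (\<lambda>i. principal_root n (q i))"
    unfolding nearly_periodic_def
  proof (intro allI impI)
    fix e :: real assume "e > 0"
    then obtain d where d: "d > 0"
      "\<And>z w. cmod (z - 1) \<le> 1 / 2 \<Longrightarrow> cmod (w - 1) \<le> 1 / 2 \<Longrightarrow> cmod (z - w) < d \<Longrightarrow>
       cmod (principal_root n z - principal_root n w) < e"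
      using principal_root_uniformly_continuous[OF \<open>n > 0\<close> \<open>e > 0\<close>] by metis
    then obtain N where "\<And>i j. i mod 2 ^ N = j mod 2 ^ N \<Longrightarrow> cmod (q i - q j) < d"
      using q unfolding mem_circle_fun nearly_periodic_def by metis
    then show "\<exists>N. \<forall>i j. i mod 2 ^ N = j mod 2 ^ N \<longrightarrow>
        cmod (principal_root n (q i) - principal_root n (q j)) < e"
      using d(2)[OF q1 q1] by blast
  qed
  moreover have "nearly_periodic (\<lambda>i. principal_root n (v i))"
  proof (rule periodic_nearly)
    show "periodic p (\<lambda>i. principal_root n (v i))"
      using v(1) unfolding periodic_def by metis
  qed
  ultimately have "w \<in> carrier circle_fun"
    unfolding w_def[abs_def] by (auto simp: mem_circle_fun norm_mult intro: nearly_periodic_mult)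
  moreover have "w [^]\<^bsub>circle_fun\<^esub> n = u"
  proof
    fix i
    have "cmod (q i) = 1" using q by (simp add: mem_circle_fun)
    then show "(w [^]\<^bsub>circle_fun\<^esub> n) i = u i"
      using \<open>n > 0\<close> v(2)[of i] by (auto simp: pow_circle_fun w_def power_mult_distrib principal_root_pow qi)
  qed
  ultimately show "\<exists>v\<in>carrier circle_fun. v [^]\<^bsub>circle_fun\<^esub> n = u" by blast
qed

section \<open>The invariant L1 metric and a countable dense family\<close>

definition mdist :: "(nat \<Rightarrow> complex) \<Rightarrow> (nat \<Rightarrow> complex) \<Rightarrow> real" where
  "mdist u v = mean (u \<otimes>\<^bsub>circle_fun\<^esub> inv\<^bsub>circle_fun\<^esub> v)"

lemma mdist_one: "u \<in> carrier circle_fun \<Longrightarrow> mdist u \<one>\<^bsub>circle_fun\<^esub> = mean u"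
  by (simp add: mdist_def)

lemma mdist_triangle:
  assumes "u \<in> carrier circle_fun" "v \<in> carrier circle_fun" "w \<in> carrier circle_fun"
  shows "mdist u w \<le> mdist u v + mdist v w"
proof -
  have "u \<otimes>\<^bsub>circle_fun\<^esub> inv\<^bsub>circle_fun\<^esub> w
      = (u \<otimes>\<^bsub>circle_fun\<^esub> inv\<^bsub>circle_fun\<^esub> v) \<otimes>\<^bsub>circle_fun\<^esub> (v \<otimes>\<^bsub>circle_fun\<^esub> inv\<^bsub>circle_fun\<^esub> w)"
    using assms by (simp add: CF.m_assoc) (simp add: CF.m_assoc[symmetric])
  then show ?thesis
    unfolding mdist_def using assms by (metis CF.inv_closed CF.m_closed mean_mult)
qed

lemma mdist_commute:
  assumes "u \<in> carrier circle_fun" "v \<in> carrier circle_fun"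
  shows "mdist u v = mdist v u"
proof -
  have "inv\<^bsub>circle_fun\<^esub> (u \<otimes>\<^bsub>circle_fun\<^esub> inv\<^bsub>circle_fun\<^esub> v) = v \<otimes>\<^bsub>circle_fun\<^esub> inv\<^bsub>circle_fun\<^esub> u"
    using assms by (simp add: CF.inv_mult CF.m_comm)
  then show ?thesis
    unfolding mdist_def using assms by (metis CF.inv_closed CF.m_closed mean_inv)
qed

lemma mdist_mult:
  assumes "u \<in> carrier circle_fun" "v \<in> carrier circle_fun"
    "u' \<in> carrier circle_fun" "v' \<in> carrier circle_fun"
  shows "mdist (u \<otimes>\<^bsub>circle_fun\<^esub> u') (v \<otimes>\<^bsub>circle_fun\<^esub> v') \<le> mdist u v + mdist u' v'"
proof -
  have "(u \<otimes>\<^bsub>circle_fun\<^esub> u') \<otimes>\<^bsub>circle_fun\<^esub> inv\<^bsub>circle_fun\<^esub> (v \<otimes>\<^bsub>circle_fun\<^esub> v')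
      = (u \<otimes>\<^bsub>circle_fun\<^esub> inv\<^bsub>circle_fun\<^esub> v) \<otimes>\<^bsub>circle_fun\<^esub> (u' \<otimes>\<^bsub>circle_fun\<^esub> inv\<^bsub>circle_fun\<^esub> v')"
    using assms by (simp add: CF.inv_mult CF.m_ac)
  then show ?thesis
    unfolding mdist_def using assms by (metis CF.inv_closed CF.m_closed mean_mult)
qed

lemma mdist_pow:
  assumes "u \<in> carrier circle_fun" "v \<in> carrier circle_fun"
  shows "mdist (u [^]\<^bsub>circle_fun\<^esub> (n::nat)) (v [^]\<^bsub>circle_fun\<^esub> n) \<le> n * mdist u v"
proof (induction n)
  case 0
  then show ?case using assms by (simp add: mdist_def) (simp add: one_circle_fun mean_one)
next
  case (Suc n)
  then show ?case
    using mdist_mult[of "u [^]\<^bsub>circle_fun\<^esub> n" "v [^]\<^bsub>circle_fun\<^esub> n" u v] assms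
    by (simp add: algebra_simps)
qed

lemma mdist_le:
  assumes u: "u \<in> carrier circle_fun" and v: "v \<in> carrier circle_fun"
    and le: "\<And>i. cmod (u i - v i) \<le> e"
  shows "mdist u v \<le> e"
  unfolding mdist_def
proof (rule mean_le)
  show "u \<otimes>\<^bsub>circle_fun\<^esub> inv\<^bsub>circle_fun\<^esub> v \<in> carrier circle_fun"
    using u v by simp
  fix i
  have "(u \<otimes>\<^bsub>circle_fun\<^esub> inv\<^bsub>circle_fun\<^esub> v) i - 1 = (u i - v i) / v i"
    using nonzero_circle_fun[OF v, of i]
    by (simp add: mult_circle_fun inv_circle_fun v divide_inverse left_diff_distrib)
  then show "cmod ((u \<otimes>\<^bsub>circle_fun\<^esub> inv\<^bsub>circle_fun\<^esub> v) i - 1) \<le> e"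
    using le by (simp add: norm_divide cmod_circle_fun[OF v])
qed

text \<open>Locally constant functions with rational angles, a countable family that is dense even
  in the sup norm. Classes beyond the end of the list get angle 0. Countability lets a recursive
  construction meet the targets one by one.\<close>

definition target :: "nat \<Rightarrow> nat \<Rightarrow> complex" where
  "target k i = (case from_nat k of (n, qs :: rat list) \<Rightarrow>
     cis (2 * pi * (if i mod 2 ^ n < length qs then of_rat (qs ! (i mod 2 ^ n)) else 0)))"

lemma periodic_target: "\<exists>n. periodic n (target k)"
proof -
  obtain n :: nat and qs :: "rat list" where "from_nat k = (n, qs)" by fastforce
  then have "periodic n (target k)" by (simp add: periodic_def target_def)
  then show ?thesis ..
qed

lemma target_circle_fun: "target k \<in> carrier circle_fun"
  using periodic_target periodic_nearly
  by (auto simp: mem_circle_fun) (simp add: target_def case_prod_unfold)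

lemma target_dense:
  assumes u: "u \<in> carrier circle_fun" and e: "e > 0"
  obtains k where "\<And>i. cmod (u i - target k i) < e"
proof -
  obtain n where n: "\<And>i j. i mod 2 ^ n = j mod 2 ^ n \<Longrightarrow> cmod (u i - u j) < e / 2"
    using u e unfolding mem_circle_fun nearly_periodic_def by (meson half_gt_zero)
  have "\<exists>q::rat. cmod (u r - cis (2 * pi * of_rat q)) < e / 2" for r
  proof -
    have ur: "u r = cis (Arg (u r))"
      using rcis_cmod_Arg[of "u r"] cmod_circle_fun[OF u] by (simp add: rcis_def)
    have "Arg (u r) / (2 * pi) < Arg (u r) / (2 * pi) + e / (4 * pi)"
      using e by simp
    then obtain q where q: "Arg (u r) / (2 * pi) < of_rat q" "of_rat q < Arg (u r) / (2 * pi) + e / (4 * pi)"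
      using of_rat_dense by blast
    have "Arg (u r) < 2 * pi * of_rat q" "2 * pi * of_rat q < Arg (u r) + e / 2"
      using q by (auto simp: field_simps)
    then have "\<bar>Arg (u r) - 2 * pi * of_rat q\<bar> < e / 2" by linarith
    then show ?thesis
      using norm_cis_diff_le ur by (metis le_less_trans)
  qed
  then obtain q where q: "\<And>r. cmod (u r - cis (2 * pi * of_rat (q r))) < e / 2"
    by metis
  define k where "k = to_nat (n, map q [0..<2 ^ n])"
  have "cmod (u i - target k i) < e" for i
  proof -
    have "target k i = cis (2 * pi * of_rat (q (i mod 2 ^ n)))"
      by (simp add: target_def k_def)
    then have "cmod (u (i mod 2 ^ n) - target k i) < e / 2"
      using q by simp
    moreover have "cmod (u i - u (i mod 2 ^ n)) < e / 2"
      by (rule n) simp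
    ultimately show ?thesis
      using norm_triangle_ineq[of "u i - u (i mod 2 ^ n)" "u (i mod 2 ^ n) - target k i"] by simp
  qed
  then show ?thesis by (rule that)
qed

text \<open>On the unit circle, distance at most 1 from 1 forces real part at least 1/2, so
  \<open>z + 1\<close> has modulus at least 3/2. As \<open>z ^ 2 - 1\<close> is the product of
  \<open>z - 1\<close> and \<open>z + 1\<close>, each squaring that stays within distance 1 improves
  the estimate for \<open>z - 1\<close> by the factor 2/3.\<close>

lemma cmod_doubling:
  fixes z :: complex
  assumes "cmod z = 1" and "\<And>k. k \<le> K \<Longrightarrow> cmod (z ^ (2 ^ k) - 1) \<le> 1"
  shows "cmod (z - 1) \<le> (2 / 3) ^ K"
  using assms
proof (induction K arbitrary: z)
  case 0
  then show ?case using "0.prems"(2)[of 0] by simp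
next
  case (Suc K)
  have z1: "cmod (z - 1) \<le> 1" using Suc.prems(2)[of 0] by simp
  have sq: "(Re z)\<^sup>2 + (Im z)\<^sup>2 = 1"
    using Suc.prems(1) cmod_power2[of z] by simp
  have "(cmod (z - 1))\<^sup>2 \<le> 1" using z1 by (simp add: power_le_one)
  then have "(Re z - 1)\<^sup>2 + (Im z)\<^sup>2 \<le> 1" by (simp add: cmod_power2)
  then have "Re z \<ge> 1 / 2" using sq by (simp add: power2_eq_square algebra_simps)
  then have "Re (z + 1) \<ge> 3 / 2" by simp
  then have z2: "cmod (z + 1) \<ge> 3 / 2" using complex_Re_le_cmod order_trans by blast
  have "cmod (z\<^sup>2 - 1) \<le> (2 / 3) ^ K"
  proof (rule Suc.IH)
    show "cmod (z\<^sup>2) = 1" using Suc.prems(1) by (simp add: norm_power)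
    show "cmod ((z\<^sup>2) ^ 2 ^ k - 1) \<le> 1" if "k \<le> K" for k
      using Suc.prems(2)[of "Suc k"] that by (simp add: power_mult)
  qed
  moreover have "z\<^sup>2 - 1 = (z - 1) * (z + 1)" by (simp add: power2_eq_square algebra_simps)
  ultimately have "cmod (z - 1) * cmod (z + 1) \<le> (2 / 3) ^ K" by (simp add: norm_mult)
  then have "cmod (z - 1) * (3 / 2) \<le> (2 / 3) ^ K"
    using mult_left_mono[OF z2, of "cmod (z - 1)"] by simp
  then show ?case by simp
qed

text \<open>The circle has no small subgroups: repeated squaring drives the distance to 1 below
  every bound.\<close>

lemma small_powers_imp_one:
  fixes z :: complex
  assumes z: "cmod z = 1" and small: "\<And>k. cmod (z ^ k - 1) \<le> 1"
  shows "z = 1"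
proof (rule ccontr)
  assume "z \<noteq> 1"
  then have "cmod (z - 1) > 0" by simp
  then obtain K where "(2 / 3) ^ K < cmod (z - 1)"
    using real_arch_pow_inv[of "cmod (z - 1)" "2 / 3"] by auto
  then show False using cmod_doubling[of z K] assms by fastforce
qed

section \<open>Pieces on residue classes, and the triviality of characters\<close>

definition cut :: "nat set \<Rightarrow> nat \<Rightarrow> (nat \<Rightarrow> complex) \<Rightarrow> nat \<Rightarrow> complex" where
  "cut A n u i = (if i mod 2 ^ n \<in> A then u i else 1)"

lemma cut_circle_fun:
  assumes u: "u \<in> carrier circle_fun"
  shows "cut A n u \<in> carrier circle_fun"
  unfolding mem_circle_fun nearly_periodic_def
proof (intro conjI allI impI)
  show "cmod (cut A n u i) = 1" for i
    using u by (simp add: cut_def mem_circle_fun)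
  fix e :: real assume "e > 0"
  then obtain N where N: "\<And>i j. i mod 2 ^ N = j mod 2 ^ N \<Longrightarrow> cmod (u i - u j) < e"
    using u unfolding mem_circle_fun nearly_periodic_def by metis
  have "cmod (cut A n u i - cut A n u j) < e" if "i mod 2 ^ max n N = j mod 2 ^ max n N" for i j
  proof -
    have "i mod 2 ^ n = j mod 2 ^ n" "i mod 2 ^ N = j mod 2 ^ N"
      by (rule mod_pow_le[OF _ that]; simp)+
    then show ?thesis using N \<open>e > 0\<close> by (simp add: cut_def)
  qed
  then show "\<exists>N. \<forall>i j. i mod 2 ^ N = j mod 2 ^ N \<longrightarrow> cmod (cut A n u i - cut A n u j) < e"
    by blast
qed

lemma cut_pow: "cut A n u [^]\<^bsub>circle_fun\<^esub> (k::nat) = cut A n (u [^]\<^bsub>circle_fun\<^esub> k)"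
  by (auto simp: pow_circle_fun cut_def)

lemma cut_Suc: "cut {..<Suc m} n u = cut {..<m} n u \<otimes>\<^bsub>circle_fun\<^esub> cut {m} n u"
  by (auto simp: mult_circle_fun cut_def fun_eq_iff less_Suc_eq)

lemma cut_0: "cut {..<0} n u = \<one>\<^bsub>circle_fun\<^esub>"
  by (auto simp: one_circle_fun cut_def)

lemma cut_all: "cut {..<2 ^ n} n u = u"
  by (simp add: cut_def fun_eq_iff)

lemma mean_cut: "u \<in> carrier circle_fun \<Longrightarrow> mean (cut {r} n u) \<le> 2 / 2 ^ n"
  by (rule mean_class[where r = r, OF cut_circle_fun]) (auto simp: cut_def)

definition mean_dense :: "'a set \<Rightarrow> ('a \<Rightarrow> nat \<Rightarrow> complex) \<Rightarrow> bool" where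
  "mean_dense D J \<longleftrightarrow> (\<forall>v\<in>carrier circle_fun. \<forall>e>0. \<exists>a\<in>D. mdist (J a) v < e)"

text \<open>A character as an abstract homomorphism into the unit circle. What continuity would
  provide is always supplied as an explicit smallness hypothesis.\<close>

definition unitary_char :: "('a, 'b) monoid_scheme \<Rightarrow> 'a set \<Rightarrow> ('a \<Rightarrow> complex) \<Rightarrow> bool" where
  "unitary_char G H f \<longleftrightarrow> (\<forall>x\<in>H. \<forall>y\<in>H. f (x \<otimes>\<^bsub>G\<^esub> y) = f x * f y) \<and> (\<forall>x\<in>H. cmod (f x) = 1)"

lemma unitary_char_mono: "unitary_char G H f \<Longrightarrow> K \<subseteq> H \<Longrightarrow> unitary_char G K f"
  unfolding unitary_char_def by blast

context comm_group
begin

lemma subgroup_pow_closed: "subgroup H G \<Longrightarrow> x \<in> H \<Longrightarrow> x [^] (n::nat) \<in> H"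
  by (induction n) (auto simp: subgroup.one_closed subgroup.m_closed)

lemma hom_on_pow:
  assumes H: "subgroup H G" and E: "comm_group E" and J: "J \<in> hom (G\<lparr>carrier := H\<rparr>) E" and x: "x \<in> H"
  shows "J (x [^] (n::nat)) = J x [^]\<^bsub>E\<^esub> n"
proof -
  interpret E: comm_group E by (rule E)
  show ?thesis
    using hom_eq_one[OF is_group E.is_group H J] J x subgroup_pow_closed[OF H x]
    by (induction n) (auto simp: hom_def)
qed

lemma unitary_char_one:
  assumes "subgroup H G" "unitary_char G H f"
  shows "f \<one> = 1"
proof -
  have "\<one> \<in> H" using assms by (simp add: subgroup.one_closed)
  then have "f \<one> * f \<one> = f \<one>" "f \<one> \<noteq> 0"
    using assms unfolding unitary_char_def by (metis l_one one_closed, force)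
  then show ?thesis by simp
qed

lemma unitary_char_pow:
  assumes H: "subgroup H G" and f: "unitary_char G H f" and x: "x \<in> H"
  shows "f (x [^] (n::nat)) = f x ^ n"
  using unitary_char_one[OF H f] f x subgroup_pow_closed[OF H x]
  by (induction n) (auto simp: unitary_char_def)

lemma unitary_char_trivial:
  assumes H: "subgroup H G" and f: "unitary_char G H f" and small: "\<And>x. x \<in> H \<Longrightarrow> cmod (f x - 1) \<le> 1"
    and x: "x \<in> H"
  shows "f x = 1"
proof (rule small_powers_imp_one)
  show "cmod (f x) = 1" using f x by (simp add: unitary_char_def)
  show "cmod (f x ^ k - 1) \<le> 1" for k
    using small[OF subgroup_pow_closed[OF H x]] by (simp add: unitary_char_pow[OF H f x])
qed

text \<open>Every function is the product of \<open>2 ^ n\<close> pieces supported on residue classes. All powers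
  of a piece have small mean, so a character that is small near the identity is nearly trivial
  at each piece.\<close>

lemma unitary_char_trivial_of_mean_dense:
  assumes D: "subgroup D G" and J: "J \<in> hom (G\<lparr>carrier := D\<rparr>) circle_fun"
    and dense: "mean_dense D J" and f: "unitary_char G D f" and e: "e > 0"
    and small: "\<And>x. x \<in> D \<Longrightarrow> mean (J x) < e \<Longrightarrow> cmod (f x - 1) \<le> 1 / 4"
    and g: "g \<in> D"
  shows "f g = 1"
proof (rule unitary_char_trivial[OF D f _ g])
  fix g assume g: "g \<in> D"
  have JC: "J x \<in> carrier circle_fun" if "x \<in> D" for x using J that by (auto simp: hom_def)
  have Jm: "J (x \<otimes> y) = J x \<otimes>\<^bsub>circle_fun\<^esub> J y" if "x \<in> D" "y \<in> D" for x y
    using J that by (auto simp: hom_def)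
  have fm: "f (x \<otimes> y) = f x * f y" "cmod (f x) = 1" if "x \<in> D" "y \<in> D" for x y
    using f that by (auto simp: unitary_char_def)
  have "(\<lambda>n. 2 / 2 ^ n :: real) \<longlonglongrightarrow> 0"
    using tendsto_mult_right[OF LIMSEQ_realpow_zero[of "1 / 2 :: real"], of 2]
    by (simp add: power_divide mult.commute)
  then obtain n where n: "2 / 2 ^ n < e / 2"
    using e order_tendstoD(2)[of "\<lambda>n. 2 / 2 ^ n :: real" 0 sequentially "e / 2"]
    by (auto simp: eventually_sequentially)
  \<comment> \<open>The character will be off by at most \<open>(2 / 3) ^ K\<close> on each of
    \<open>2 ^ n\<close> pieces; this \<open>K\<close> keeps the total error below 1/4.\<close>
  obtain K where K: "(2 / 3) ^ K < (1 / 4 / 2 ^ n :: real)"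
    using real_arch_pow_inv[of "1 / 4 / 2 ^ n :: real" "2 / 3"] by auto
  have piece: "\<exists>x\<in>D. mdist (J x) (cut {r} n u) < \<eta> \<and> cmod (f x - 1) \<le> (2 / 3) ^ K"
    if u: "u \<in> carrier circle_fun" and \<eta>: "\<eta> > 0" for u r \<eta>
  proof -
    note c = cut_circle_fun[OF u, of "{r}" n]
    \<comment> \<open>Taking powers with exponent up to \<open>2 ^ K\<close> multiplies the distance
      by that much, hence the division by \<open>2 ^ K\<close>. The other half of \<open>e\<close>
      is reserved for the powers of the piece itself, which have small support.\<close>
    have "min \<eta> (e / 2 / 2 ^ K) > 0" using \<eta> e by simp
    then obtain x where x: "x \<in> D" "mdist (J x) (cut {r} n u) < min \<eta> (e / 2 / 2 ^ K)"
      using dense c unfolding mean_dense_def by blast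
    have "cmod (f x - 1) \<le> (2 / 3) ^ K"
    proof (rule cmod_doubling)
      show "cmod (f x) = 1" using fm x by blast
      fix k assume "k \<le> K"
      define j where "j = (2::nat) ^ k"
      have "real j \<le> 2 ^ K" using \<open>k \<le> K\<close> by (simp add: j_def)
      have xj: "x [^] j \<in> D" using subgroup_pow_closed[OF D x(1)] .
      have "mean (J (x [^] j)) = mdist (J x [^]\<^bsub>circle_fun\<^esub> j) \<one>\<^bsub>circle_fun\<^esub>"
        using JC x xj hom_on_pow[OF D comm_group_circle_fun J x(1)] by (simp add: mdist_one)
      also have "\<dots> \<le> mdist (J x [^]\<^bsub>circle_fun\<^esub> j) (cut {r} n u [^]\<^bsub>circle_fun\<^esub> j)
          + mdist (cut {r} n u [^]\<^bsub>circle_fun\<^esub> j) \<one>\<^bsub>circle_fun\<^esub>"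
        using JC[OF x(1)] c by (intro mdist_triangle) auto
      also have "\<dots> \<le> real j * mdist (J x) (cut {r} n u) + mean (cut {r} n (u [^]\<^bsub>circle_fun\<^esub> j))"
        using mdist_pow[OF JC[OF x(1)] c, of j] u by (simp add: cut_pow mdist_one cut_circle_fun)
      also have "\<dots> \<le> 2 ^ K * (e / 2 / 2 ^ K) + 2 / 2 ^ n"
      proof (intro add_mono mean_cut)
        have "real j * mdist (J x) (cut {r} n u) \<le> real j * (e / 2 / 2 ^ K)"
          using x(2) by (intro mult_left_mono) auto
        also have "\<dots> \<le> 2 ^ K * (e / 2 / 2 ^ K)"
          using \<open>real j \<le> 2 ^ K\<close> e by (intro mult_right_mono) auto
        finally show "real j * mdist (J x) (cut {r} n u) \<le> 2 ^ K * (e / 2 / 2 ^ K)" .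
      qed (use u in auto)
      also have "\<dots> < e" using n by simp
      finally have "cmod (f (x [^] j) - 1) \<le> 1 / 4" using small xj by blast
      then show "cmod (f x ^ 2 ^ k - 1) \<le> 1"
        using unitary_char_pow[OF D f x(1), of j] by (simp add: j_def)
    qed
    then show ?thesis using x by auto
  qed
  define u where "u = J g"
  have u: "u \<in> carrier circle_fun" unfolding u_def using JC g by blast
  define \<eta> where "\<eta> = e / 2 / 2 ^ n"
  have "\<eta> > 0" using e by (simp add: \<eta>_def)
  have "\<exists>x\<in>D. mdist (J x) (cut {..<m} n u) \<le> real m * \<eta> \<and> cmod (f x - 1) \<le> real m * (2 / 3) ^ K" for m
  proof (induction m)
    case 0
    show ?case
      unfolding cut_0
      using hom_eq_one[OF is_group CF.is_group D J] unitary_char_one[OF D f] subgroup.one_closed[OF D]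
      by (intro bexI[of _ \<one>]) (auto simp: mdist_one, simp add: one_circle_fun mean_one)
  next
    case (Suc m)
    then obtain x where x: "x \<in> D" "mdist (J x) (cut {..<m} n u) \<le> real m * \<eta>"
      "cmod (f x - 1) \<le> real m * (2 / 3) ^ K" by blast
    obtain y where y: "y \<in> D" "mdist (J y) (cut {m} n u) < \<eta>" "cmod (f y - 1) \<le> (2 / 3) ^ K"
      using piece[OF u \<open>\<eta> > 0\<close>] by blast
    have "mdist (J (x \<otimes> y)) (cut {..<Suc m} n u) \<le> real (Suc m) * \<eta>"
      using mdist_mult[OF JC[OF x(1)] cut_circle_fun[OF u] JC[OF y(1)] cut_circle_fun[OF u],
          of "{..<m}" n "{m}" n] x y
      unfolding Jm[OF x(1) y(1)] cut_Suc by (simp add: algebra_simps)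
    moreover have "cmod (f (x \<otimes> y) - 1) \<le> real (Suc m) * (2 / 3) ^ K"
      using cmod_mult_sub_one[of "f x" "f y"] fm[OF x(1) y(1)] x(3) y(3) by (simp add: algebra_simps)
    ultimately show ?case using D x y by (meson subgroup.m_closed)
  qed
  from this[of "2 ^ n"] obtain x where x: "x \<in> D" "mdist (J x) u \<le> 2 ^ n * \<eta>"
    "cmod (f x - 1) \<le> 2 ^ n * (2 / 3) ^ K"
    by (auto simp: cut_all)
  have "2 ^ n * (2 / 3) ^ K \<le> 2 ^ n * (1 / 4 / 2 ^ n :: real)"
    using K by (intro mult_left_mono) auto
  then have fx: "cmod (f x - 1) \<le> 1 / 4" using x(3) by simp
  \<comment> \<open>The quotient of \<open>g\<close> by the product of the approximating elements
    has mean at most \<open>e / 2\<close>, so the hypothesis applies to it. Adding the error of the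
    product gives 1/2, enough for the absence of small subgroups.\<close>
  define y where "y = g \<otimes> inv x"
  have xG: "x \<in> carrier G" "g \<in> carrier G" using x g subgroup.mem_carrier[OF D] by auto
  have y: "y \<in> D" unfolding y_def using x g D by (simp add: subgroup.m_closed subgroup.m_inv_closed)
  have gy: "g = y \<otimes> x" using xG by (simp add: y_def m_assoc)
  have "u = J y \<otimes>\<^bsub>circle_fun\<^esub> J x"
    unfolding u_def using gy Jm[OF y x(1)] by simp
  then have "mdist u (J x) = mean (J y)"
    using JC y x(1) by (simp add: mdist_def CF.m_assoc)
  then have "mean (J y) \<le> e / 2"
    using mdist_commute[OF u JC[OF x(1)]] x(2) by (simp add: \<eta>_def)
  then have "cmod (f y - 1) \<le> 1 / 4" using small[OF y] e by simp
  then show "cmod (f g - 1) \<le> 1"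
    using cmod_mult_sub_one[of "f y" "f x"] fm[OF y x(1)] fx gy by simp
qed

text \<open>Divisibility yields a \<open>d\<close>-th root of the function to be approximated, and
  raising to the \<open>d\<close>-th power multiplies distances by at most \<open>d\<close>.\<close>

lemma mean_dense_pow:
  assumes H: "subgroup H G" and J: "J \<in> hom (G\<lparr>carrier := H\<rparr>) circle_fun"
    and dense: "mean_dense H J" and d: "d > (0::nat)"
  shows "mean_dense ((\<lambda>x. x [^] d) ` H) J"
  unfolding mean_dense_def
proof (intro ballI allI impI)
  fix v and e :: real assume v: "v \<in> carrier circle_fun" and "e > 0"
  obtain w where w: "w \<in> carrier circle_fun" "w [^]\<^bsub>circle_fun\<^esub> d = v"
    using divisible_circle_fun v d unfolding divisible_group_def by blast
  obtain a where a: "a \<in> H" "mdist (J a) w < e / d"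
    using dense w \<open>e > 0\<close> d unfolding mean_dense_def by (metis divide_pos_pos of_nat_0_less_iff)
  have "J a \<in> carrier circle_fun" using a J by (auto simp: hom_def)
  then have "mdist (J (a [^] d)) v \<le> d * mdist (J a) w"
    using mdist_pow[of "J a" w d] w hom_on_pow[OF H comm_group_circle_fun J a(1)] by simp
  also have "\<dots> < e" using a(2) d by (simp add: field_simps)
  finally show "\<exists>a\<in>(\<lambda>x. x [^] d) ` H. mdist (J a) v < e" using a by blast
qed

end

section \<open>Dense embeddings of countable groups\<close>

lemma periodic_circle_fun: "periodic n u \<Longrightarrow> (\<And>i. cmod (u i) = 1) \<Longrightarrow> u \<in> carrier circle_fun"
  by (simp add: mem_circle_fun periodic_nearly)

lemma root_of_unity_eq_one:
  fixes d j :: nat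
  assumes "cis (2 * pi / d) ^ j = 1" "j < d"
  shows "j = 0"
proof -
  have "exp (2 * of_real pi * \<i> * of_nat j / of_nat d) = cis (2 * pi / d) ^ j"
    unfolding Complex.DeMoivre unfolding cis_conv_exp by (rule arg_cong[where f = exp]) simp
  then have "exp (2 * of_real pi * \<i> * of_nat j / of_nat d) = 1"
    using assms(1) by simp
  then have "d dvd j" using complex_root_unity_eq_1[of d j] assms(2) by simp
  then show ?thesis using assms(2) by (auto dest: dvd_imp_le)
qed

context comm_group
begin

lemma set_mult_least: "subgroup C G \<Longrightarrow> A \<subseteq> C \<Longrightarrow> B \<subseteq> C \<Longrightarrow> A <#> B \<subseteq> C"
  by (auto simp: mem_set_mult intro!: subgroup.m_closed)

definition circle_embeddable :: "'a set \<Rightarrow> bool" where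
  "circle_embeddable A \<longleftrightarrow> subgroup A G \<and> (\<exists>j\<in>hom (G\<lparr>carrier := A\<rparr>) circle_fun.
     (\<forall>a\<in>A. j a = \<one>\<^bsub>circle_fun\<^esub> \<longrightarrow> a = \<one>) \<and> mean_dense A j)"

text \<open>Multiplying the new value by a primitive root of unity on one fine residue class makes its
  powers aperiodic, which keeps the extension injective.\<close>

lemma periodic_adjoin:
  assumes F: "subgroup F G" and J: "J \<in> hom (G\<lparr>carrier := F\<rparr>) circle_fun"
    and inj: "\<And>h. h \<in> F \<Longrightarrow> J h = \<one>\<^bsub>circle_fun\<^esub> \<Longrightarrow> h = \<one>"
    and per: "\<And>h. h \<in> F \<Longrightarrow> periodic P (J h)"
    and x: "x \<in> carrier G" "x [^] (n::nat) \<in> F" "n > 0"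
    and v: "v \<in> carrier circle_fun" "periodic Q v"
  shows "\<exists>J' P'. J' \<in> hom (G\<lparr>carrier := F <#> generate G {x}\<rparr>) circle_fun \<and>
    (\<forall>h\<in>F. J' h = J h) \<and>
    (\<forall>h\<in>F <#> generate G {x}. J' h = \<one>\<^bsub>circle_fun\<^esub> \<longrightarrow> h = \<one>) \<and>
    (\<forall>h\<in>F <#> generate G {x}. periodic P' (J' h)) \<and>
    (\<forall>N>0. (\<forall>j. 0 < j \<longrightarrow> j \<le> N \<longrightarrow> x [^] j \<notin> F) \<longrightarrow> mdist (J' x) v \<le> 4 / real N + 2 / 2 ^ k)"
proof -
  obtain d where d: "d > 0" "x [^] d \<in> F" and dvd: "\<And>k::int. x [^] k \<in> F \<longleftrightarrow> int d dvd k"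
    using relative_order[OF F x(1) x(3) x(2)] by metis
  define s where "s = J (x [^] d)"
  define p where "p = max P Q"
  \<comment> \<open>Taking at least \<open>Suc p\<close> makes 0 and \<open>2 ^ p\<close> distinct
    modulo \<open>2 ^ M\<close>, though they agree modulo \<open>2 ^ p\<close>; taking at least
    \<open>k\<close> makes the class that carries the root of unity small.\<close>
  define M where "M = max (Suc p) k"
  \<comment> \<open>The correction that turns the \<open>d\<close>-th power of \<open>v\<close> into
    the prescribed value \<open>s\<close>. It is within \<open>4 / d\<close> of 1, so it is harmless
    when \<open>x\<close> has large order relative to \<open>F\<close>.\<close>
  define r where "r (i :: nat) = principal_root d (s i / v i ^ d)" for i
  define c where "c (i :: nat) = (if i mod 2 ^ M = 0 then cis (2 * pi / d) else 1)" for i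
  define u where "u (i :: nat) = v i * r i * c i" for i
  have JC: "J h \<in> carrier circle_fun" if "h \<in> F" for h using J that by (auto simp: hom_def)
  have s: "s \<in> carrier circle_fun" unfolding s_def using JC d by blast
  have sp: "periodic p s" unfolding s_def p_def using per[OF d(2)] periodic_mono by fastforce
  have vp: "periodic p v" unfolding p_def using v(2) periodic_mono by fastforce
  have rp: "periodic p r" using sp vp unfolding periodic_def r_def by metis
  have cp: "periodic M c" unfolding periodic_def c_def by simp
  have pM: "p \<le> M" "p < M" "k \<le> M" by (auto simp: M_def)
  have up: "periodic M u"
    using periodic_mono[OF vp pM(1)] periodic_mono[OF rp pM(1)] cp
    unfolding periodic_def u_def by metis
  have c1: "cmod (c i) = 1" for i by (simp add: c_def)
  have r1: "cmod (r i) = 1" for i by (simp add: r_def)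
  have uC: "u \<in> carrier circle_fun"
    by (rule periodic_circle_fun[OF up])
      (simp add: u_def norm_mult c1 r1 cmod_circle_fun[OF v(1)])
  have cC: "c \<in> carrier circle_fun" using periodic_circle_fun[OF cp c1] .
  have rC: "r \<in> carrier circle_fun" using periodic_circle_fun[OF rp r1] .
  have cd: "c i ^ d = 1" for i
    using d(1) by (auto simp: c_def Complex.DeMoivre)
  have rd: "r i ^ d = s i / v i ^ d" for i
    unfolding r_def using s v(1) d(1)
    by (intro principal_root_pow) (auto simp: norm_divide norm_power cmod_circle_fun)
  have ud: "u [^]\<^bsub>circle_fun\<^esub> d = J (x [^] d)"
    unfolding s_def[symmetric] pow_circle_fun u_def power_mult_distrib cd rd
    using nonzero_circle_fun[OF v(1)] by (auto simp: fun_eq_iff)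
  obtain J' where J': "J' \<in> hom (G\<lparr>carrier := F <#> generate G {x}\<rparr>) circle_fun"
    "\<And>h. h \<in> F \<Longrightarrow> J' h = J h" "\<And>k::int. J' (x [^] k) = u [^]\<^bsub>circle_fun\<^esub> k"
    using hom_adjoin_root[OF F comm_group_circle_fun J x(1) uC d(2) ud] dvd by metis
  have J'x: "J' (x [^] j) = u [^]\<^bsub>circle_fun\<^esub> j" for j :: nat
    using J'(3)[of "int j"] by (simp add: int_pow_int)
  note inc = set_mult_incl[OF F subgroup_generate_singleton[OF x(1)]]
  have mem: "\<exists>h j. h \<in> F \<and> j < d \<and> y = h \<otimes> x [^] j \<and> J' y = (\<lambda>i. J h i * u i ^ j)"
    if y: "y \<in> F <#> generate G {x}" for y
  proof -
    obtain h j where h: "h \<in> F" "j < d" "y = h \<otimes> x [^] j"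
      using mem_adjoin[OF F x(1) d y] by metis
    have "x [^] j \<in> generate G {x}"
      unfolding mem_generate_singleton[OF x(1)] by (metis int_pow_int)
    then have "h \<in> F <#> generate G {x}" "x [^] j \<in> F <#> generate G {x}"
      using h(1) inc by (blast, blast)
    then have "J' y = J' h \<otimes>\<^bsub>circle_fun\<^esub> J' (x [^] j)"
      using J'(1) by (simp add: hom_def h(3))
    then show ?thesis
      using h J'(2) J'x by (auto simp: mult_circle_fun pow_circle_fun)
  qed
  show ?thesis
  proof (intro exI[of _ J'] exI[of _ M] conjI ballI allI impI)
    show "J' \<in> hom (G\<lparr>carrier := F <#> generate G {x}\<rparr>) circle_fun" by (rule J'(1))
    show "J' h = J h" if "h \<in> F" for h by (rule J'(2)[OF that])
    show "y = \<one>" if y: "y \<in> F <#> generate G {x}" "J' y = \<one>\<^bsub>circle_fun\<^esub>" for y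
    proof -
      obtain h j where h: "h \<in> F" "j < d" "y = h \<otimes> x [^] j" "J' y = (\<lambda>i. J h i * u i ^ j)"
        using mem[OF y(1)] by blast
      have Jh: "periodic p (J h)" using per[OF h(1)] periodic_mono by (fastforce simp: p_def)
      \<comment> \<open>At 0 and at \<open>2 ^ p\<close> all factors agree except \<open>c\<close>,
        so comparing the two values isolates the power of the root of unity.\<close>
      have "(2::nat) ^ p mod 2 ^ p = 0 mod 2 ^ p" by simp
      then have eq: "J h (2 ^ p) = J h 0" "v (2 ^ p) = v 0" "r (2 ^ p) = r 0"
        using Jh vp rp unfolding periodic_def by metis+
      have 1: "J h 0 * u 0 ^ j = 1" "J h (2 ^ p) * u (2 ^ p) ^ j = 1"
        using y(2) h(4) by (auto simp: one_circle_fun fun_eq_iff)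
      have "c (2 ^ p) = 1" "c 0 = cis (2 * pi / d)"
        using pM by (auto simp: c_def power_strict_increasing)
      then have u: "u (2 ^ p) = v 0 * r 0" "u 0 = v 0 * r 0 * cis (2 * pi / d)"
        by (simp_all add: eq u_def)
      have "J h 0 * (v 0 * r 0) ^ j * cis (2 * pi / d) ^ j = 1"
        using 1(1) unfolding u power_mult_distrib by (simp only: mult.assoc)
      moreover have "J h 0 * (v 0 * r 0) ^ j = 1"
        using 1(2) unfolding u eq .
      ultimately have "cis (2 * pi / d) ^ j = 1" by simp
      then have "j = 0" using root_of_unity_eq_one h(2) by blast
      then have "y = h" "J h = \<one>\<^bsub>circle_fun\<^esub>"
        using h y(2) subgroup.mem_carrier[OF F] by (auto simp: one_circle_fun)
      then show ?thesis using inj h(1) by blast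
    qed
    show "periodic M (J' y)" if y: "y \<in> F <#> generate G {x}" for y
    proof -
      obtain h j where h: "h \<in> F" "J' y = (\<lambda>i. J h i * u i ^ j)"
        using mem[OF y] by blast
      have "P \<le> M" using pM by (auto simp: p_def)
      then have "periodic M (J h)" using per[OF h(1)] periodic_mono by blast
      then show ?thesis using up unfolding h(2) periodic_def by metis
    qed
    show "mdist (J' x) v \<le> 4 / real N + 2 / 2 ^ k"
      if N: "N > 0" "\<forall>j. 0 < j \<longrightarrow> j \<le> N \<longrightarrow> x [^] j \<notin> F" for N
    proof -
      have dN: "d > N" using N(2) d by (meson not_le)
      have "u \<otimes>\<^bsub>circle_fun\<^esub> inv\<^bsub>circle_fun\<^esub> v = r \<otimes>\<^bsub>circle_fun\<^esub> c"
        using nonzero_circle_fun[OF v(1)]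
        by (auto simp: mult_circle_fun inv_circle_fun v(1) u_def fun_eq_iff)
      then have "mdist (J' x) v \<le> mean r + mean c"
        using J'x[of 1] x(1) uC mean_mult[OF rC cC] by (simp add: mdist_def)
      also have "\<dots> \<le> 4 / d + 2 / 2 ^ M"
      proof (intro add_mono)
        show "mean r \<le> 4 / d"
          using d(1) by (intro mean_le[OF rC]) (simp add: r_def principal_root_near_one)
        show "mean c \<le> 2 / 2 ^ M"
          by (rule mean_class[where r = 0, OF cC]) (simp add: c_def)
      qed
      also have "\<dots> \<le> 4 / N + 2 / 2 ^ k"
        using dN N(1) pM(3) by (intro add_mono divide_left_mono power_increasing) auto
      finally show ?thesis .
    qed
  qed
qed

lemma finite_subgroup_exponent:
  assumes F: "subgroup F G" "finite F" and x: "x \<in> F"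
  shows "x [^] card F = \<one>"
proof -
  interpret FG: group "G\<lparr>carrier := F\<rparr>" by (rule subgroup_imp_group[OF F(1)])
  have "x [^]\<^bsub>G\<lparr>carrier := F\<rparr>\<^esub> order (G\<lparr>carrier := F\<rparr>) = \<one>"
    using FG.pow_order_eq_1[of x] x by simp
  then show ?thesis by (simp add: order_def nat_pow_consistent[symmetric])
qed

text \<open>The map grows along a chain of finite subgroups, always with periodic values. Each stage
  adjoins an element sent close to the next target and then the next element of an enumeration of
  \<open>A\<close>. An element of large order relative to the current subgroup can be sent near any
  target, and such elements exist when the exponent is unbounded. For finite groups only the
  injectivity is of interest.\<close>

lemma torsion_embedding:
  assumes A: "subgroup A G" and count: "countable A"
    and tors: "\<And>a. a \<in> A \<Longrightarrow> \<exists>n>0. a [^] (n::nat) = \<one>"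
  obtains j where "j \<in> hom (G\<lparr>carrier := A\<rparr>) circle_fun"
    "\<And>a. a \<in> A \<Longrightarrow> j a = \<one>\<^bsub>circle_fun\<^esub> \<Longrightarrow> a = \<one>"
    "(\<And>n::nat. n > 0 \<Longrightarrow> \<exists>a\<in>A. a [^] n \<noteq> \<one>) \<Longrightarrow> mean_dense A j"
proof -
  define unb where "unb \<longleftrightarrow> (\<forall>n::nat. n > 0 \<longrightarrow> (\<exists>a\<in>A. a [^] n \<noteq> \<one>))"
  \<comment> \<open>Decoding pairs repeats every target at infinitely many stages. The error depends
    on the stage and so becomes arbitrarily small for each target.\<close>
  define tg where "tg n = target (fst (prod_decode n))" for n
  define enum where "enum = from_nat_into A"
  have oneA: "\<one> \<in> A" using A by (rule subgroup.one_closed)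
  then have enumA: "range enum = A"
    unfolding enum_def using count by (intro range_from_nat_into) auto
  define P where "P n FJ \<longleftrightarrow> (case FJ of (F, J) \<Rightarrow> subgroup F G \<and> F \<subseteq> A \<and> finite F \<and>
     J \<in> hom (G\<lparr>carrier := F\<rparr>) circle_fun \<and> (\<forall>h\<in>F. J h = \<one>\<^bsub>circle_fun\<^esub> \<longrightarrow> h = \<one>) \<and>
     (\<exists>q. \<forall>h\<in>F. periodic q (J h)))" for n :: nat and FJ
  define Q where "Q n FJ FJ' \<longleftrightarrow> (case FJ of (F, J) \<Rightarrow> case FJ' of (F', J') \<Rightarrow>
     F \<subseteq> F' \<and> (\<forall>h\<in>F. J' h = J h) \<and> enum n \<in> F' \<and>
     (unb \<longrightarrow> (\<exists>w\<in>F'. mdist (J' w) (tg n) \<le> 6 / real (Suc n))))" for n FJ FJ'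
  have ext: "\<exists>F' J'. P m (F', J') \<and> F \<subseteq> F' \<and> (\<forall>h\<in>F. J' h = J h) \<and> x \<in> F' \<and>
      (\<forall>N>0. (\<forall>j. 0 < j \<longrightarrow> j \<le> N \<longrightarrow> x [^] j \<notin> F) \<longrightarrow> mdist (J' x) (tg k) \<le> 4 / real N + 2 / 2 ^ k)"
    if P: "P l (F, J)" and x: "x \<in> A" for l m k F J x
  proof -
    have F: "subgroup F G" "F \<subseteq> A" "finite F" "J \<in> hom (G\<lparr>carrier := F\<rparr>) circle_fun"
      "\<And>h. h \<in> F \<Longrightarrow> J h = \<one>\<^bsub>circle_fun\<^esub> \<Longrightarrow> h = \<one>"
      using P unfolding P_def by auto
    obtain q where q: "\<And>h. h \<in> F \<Longrightarrow> periodic q (J h)" using P unfolding P_def by auto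
    have xG: "x \<in> carrier G" using A x by (rule subgroup.mem_carrier)
    obtain n :: nat where "n > 0" "x [^] n = \<one>" using tors x by blast
    then have n: "n > 0" "x [^] n \<in> F" using subgroup.one_closed[OF F(1)] by auto
    obtain Q' where Q': "periodic Q' (tg k)" using periodic_target unfolding tg_def by blast
    have tgk: "tg k \<in> carrier circle_fun" unfolding tg_def by (rule target_circle_fun)
    obtain J' P' where J': "J' \<in> hom (G\<lparr>carrier := F <#> generate G {x}\<rparr>) circle_fun"
      "\<forall>h\<in>F. J' h = J h"
      "\<forall>h\<in>F <#> generate G {x}. J' h = \<one>\<^bsub>circle_fun\<^esub> \<longrightarrow> h = \<one>"
      "\<forall>h\<in>F <#> generate G {x}. periodic P' (J' h)"
      "\<forall>N>0. (\<forall>j. 0 < j \<longrightarrow> j \<le> N \<longrightarrow> x [^] j \<notin> F) \<longrightarrow> mdist (J' x) (tg k) \<le> 4 / real N + 2 / 2 ^ k"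
      using periodic_adjoin[OF F(1,4,5) q xG n(2,1) tgk Q', where k = k] by auto
    note gx = subgroup_generate_singleton[OF xG]
    note inc = set_mult_incl[OF F(1) gx]
    have "F <#> generate G {x} \<subseteq> A"
    proof -
      have "generate G {x} \<subseteq> A" using x A by (intro generate_subgroup_incl) auto
      then show ?thesis
        by (rule set_mult_least[OF A F(2)])
    qed
    moreover have "finite (F <#> generate G {x})" using finite_adjoin[OF F(1) xG n F(3)] .
    ultimately have "P m (F <#> generate G {x}, J')"
      unfolding P_def using J' mult_subgroups[OF F(1) gx] by auto
    moreover have "x \<in> F <#> generate G {x}" using inc(2) generate.incl[of x "{x}" G] by blast
    ultimately show ?thesis using J' inc(1) by (intro exI[of _ "F <#> generate G {x}"] exI[of _ J']) auto
  qed
  have "\<exists>S. \<forall>n. P n (S n) \<and> Q n (S n) (S (Suc n))"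
  proof (rule dependent_nat_choice)
    have "(\<lambda>_. \<one>\<^bsub>circle_fun\<^esub>) \<in> hom (G\<lparr>carrier := {\<one>}\<rparr>) circle_fun" by (auto simp: hom_def)
    moreover have "periodic 0 \<one>\<^bsub>circle_fun\<^esub>" by (simp add: periodic_def one_circle_fun)
    ultimately have "P 0 ({\<one>}, \<lambda>_. \<one>\<^bsub>circle_fun\<^esub>)"
      unfolding P_def using oneA triv_subgroup by auto
    then show "\<exists>x. P 0 x" ..
  next
    fix FJ n assume Pn: "P n FJ"
    obtain F J where FJ: "FJ = (F, J)" by fastforce
    have F: "subgroup F G" "finite F" using Pn unfolding FJ P_def by auto
    \<comment> \<open>If every element of \<open>A\<close> had order at most \<open>Suc n\<close>
      relative to \<open>F\<close>, then \<open>fact (Suc n) * card F\<close> would be an exponent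
      of \<open>A\<close>.\<close>
    have "\<exists>w\<in>A. unb \<longrightarrow> (\<forall>j. 0 < j \<longrightarrow> j \<le> Suc n \<longrightarrow> w [^] j \<notin> F)"
    proof (rule ccontr)
      assume neg: "\<not> ?thesis"
      have "a [^] (fact (Suc n) * card F) = \<one>" if a: "a \<in> A" for a
      proof -
        have aG: "a \<in> carrier G" using A a by (rule subgroup.mem_carrier)
        obtain j where j: "0 < j" "j \<le> Suc n" "a [^] j \<in> F" using neg a by auto
        have "j dvd fact (Suc n)" using j by (intro dvd_fact) auto
        then obtain q where "fact (Suc n) = j * q" by (rule dvdE)
        then have q: "fact (Suc n) * card F = j * card F * q" by (simp only: mult_ac)
        have "(a [^] j) [^] card F = \<one>" using finite_subgroup_exponent[OF F j(3)] .
        then have "a [^] (j * card F) = \<one>" using aG by (simp add: nat_pow_pow)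
        then show ?thesis unfolding q nat_pow_pow[OF aG, symmetric] by simp
      qed
      moreover have "card F > 0" using F subgroup.one_closed[OF F(1)] by (auto simp: card_gt_0_iff)
      then have "fact (Suc n) * card F > 0" by simp
      ultimately have "\<not> unb" unfolding unb_def by blast
      then show False using neg oneA by blast
    qed
    then obtain w where w: "w \<in> A" "unb \<Longrightarrow> \<forall>j. 0 < j \<longrightarrow> j \<le> Suc n \<longrightarrow> w [^] j \<notin> F" by blast
    from ext[OF Pn[unfolded FJ] w(1), of n n] obtain F1 J1 where 1: "P n (F1, J1)" "F \<subseteq> F1" "\<forall>h\<in>F. J1 h = J h" "w \<in> F1"
      "\<forall>N>0. (\<forall>j. 0 < j \<longrightarrow> j \<le> N \<longrightarrow> w [^] j \<notin> F) \<longrightarrow> mdist (J1 w) (tg n) \<le> 4 / real N + 2 / 2 ^ n"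
      by metis
    have "enum n \<in> A" using enumA by blast
    from ext[OF 1(1) this, of "Suc n" n] obtain F2 J2 where 2: "P (Suc n) (F2, J2)" "F1 \<subseteq> F2" "\<forall>h\<in>F1. J2 h = J1 h" "enum n \<in> F2"
      by metis
    have wF2: "w \<in> F2" using 1(4) 2(2) by blast
    \<comment> \<open>The root correction costs \<open>4 / Suc n\<close> and the root of unity
      \<open>2 / 2 ^ n\<close>, which is at most \<open>2 / Suc n\<close>; hence the 6.\<close>
    have m2: "mdist (J2 w) (tg n) \<le> 6 / real (Suc n)" if unb
    proof -
      have "mdist (J1 w) (tg n) \<le> 4 / real (Suc n) + 2 / 2 ^ n"
        using 1(5)[rule_format, of "Suc n"] w(2)[OF that] by auto
      also have "2 / 2 ^ n \<le> 2 / real (Suc n)"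
      proof (rule divide_left_mono)
        have "Suc n \<le> 2 ^ n" using less_exp[of n] by (simp add: Suc_le_eq)
        then show "real (Suc n) \<le> 2 ^ n" by (metis of_nat_le_iff of_nat_numeral of_nat_power)
      qed auto
      finally show ?thesis using 2(3) 1(4) by (simp add: add_divide_distrib[symmetric])
    qed
    then have "Q n FJ (F2, J2)"
      unfolding Q_def FJ using 1(2,3) 2(2,3,4) wF2 m2 by auto
    then show "\<exists>y. P (Suc n) y \<and> Q n FJ y" using 2(1) by blast
  qed
  then obtain S where S: "\<And>n. P n (S n)" "\<And>n. Q n (S n) (S (Suc n))" by blast
  define F where "F n = fst (S n)" for n
  define J where "J n = snd (S n)" for n
  have SFJ: "S n = (F n, J n)" for n by (simp add: F_def J_def)
  have F: "subgroup (F n) G" "F n \<subseteq> A" "J n \<in> hom (G\<lparr>carrier := F n\<rparr>) circle_fun"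
    "\<And>h. h \<in> F n \<Longrightarrow> J n h = \<one>\<^bsub>circle_fun\<^esub> \<Longrightarrow> h = \<one>" for n
    using S(1)[of n] unfolding SFJ P_def by auto
  have FS: "F n \<subseteq> F (Suc n)" "\<And>h. h \<in> F n \<Longrightarrow> J (Suc n) h = J n h" "enum n \<in> F (Suc n)"
    "unb \<Longrightarrow> \<exists>w\<in>F (Suc n). mdist (J (Suc n) w) (tg n) \<le> 6 / real (Suc n)" for n
    using S(2)[of n] unfolding SFJ Q_def by auto
  have mono: "F n \<subseteq> F (n + m) \<and> (\<forall>h\<in>F n. J (n + m) h = J n h)" for n m
  proof (induction m)
    case (Suc m)
    then have "F n \<subseteq> F (Suc (n + m))" using FS(1)[of "n + m"] by blast
    moreover have "J (Suc (n + m)) h = J n h" if "h \<in> F n" for h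
      using FS(2)[of h "n + m"] Suc that by auto
    ultimately show ?case by simp
  qed simp
  define j where "j a = J (SOME n. a \<in> F n) a" for a
  have j: "j a = J n a" if "a \<in> F n" for a n
  proof -
    define m where "m = (SOME n. a \<in> F n)"
    have m: "a \<in> F m" unfolding m_def using that by (rule someI)
    have "J m a = J n a"
      using mono[of m "n - m"] mono[of n "m - n"] m that by (cases "m \<le> n") auto
    then show ?thesis by (simp add: j_def m_def)
  qed
  have cover: "\<exists>n. a \<in> F n \<and> b \<in> F n" if ab: "a \<in> A" "b \<in> A" for a b
  proof -
    obtain n m where nm: "a = enum n" "b = enum m" using ab enumA by blast
    have "a \<in> F (Suc n + m)" "b \<in> F (Suc m + n)"
      unfolding nm using FS(3) mono by (blast, blast)
    then show ?thesis by (intro exI[of _ "Suc (n + m)"]) (simp add: add.commute)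
  qed
  show ?thesis
  proof (rule that)
    show "j \<in> hom (G\<lparr>carrier := A\<rparr>) circle_fun"
    proof (rule homI)
      fix a assume "a \<in> carrier (G\<lparr>carrier := A\<rparr>)"
      then obtain n where "a \<in> F n" using cover by fastforce
      then show "j a \<in> carrier circle_fun" using j F(3)[of n] by (auto simp: hom_def)
    next
      fix a b assume "a \<in> carrier (G\<lparr>carrier := A\<rparr>)" "b \<in> carrier (G\<lparr>carrier := A\<rparr>)"
      then obtain n where n: "a \<in> F n" "b \<in> F n" using cover by fastforce
      then have "a \<otimes> b \<in> F n" using F(1) by (simp add: subgroup.m_closed)
      then show "j (a \<otimes>\<^bsub>G\<lparr>carrier := A\<rparr>\<^esub> b) = j a \<otimes>\<^bsub>circle_fun\<^esub> j b"
        using j n F(3)[of n] by (auto simp: hom_def)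
    qed
    show "a = \<one>" if "a \<in> A" "j a = \<one>\<^bsub>circle_fun\<^esub>" for a
      using cover[OF that(1) that(1)] j F(4) that(2) by metis
    assume "\<And>n::nat. n > 0 \<Longrightarrow> \<exists>a\<in>A. a [^] n \<noteq> \<one>"
    then have unb unfolding unb_def by blast
    show "mean_dense A j"
      unfolding mean_dense_def
    proof (intro ballI allI impI)
      fix v and e :: real assume v: "v \<in> carrier circle_fun" and e: "e > 0"
      obtain k where k: "\<And>i. cmod (v i - target k i) < e / 2" using target_dense[OF v, of "e / 2"] e by auto
      obtain m :: nat where m: "12 / e < real m" using reals_Archimedean2 by blast
      define n where "n = prod_encode (k, m)"
      have "m \<le> n" unfolding n_def by (rule le_prod_encode_2)
      have tgn: "tg n = target k" by (simp add: tg_def n_def)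
      obtain w where w: "w \<in> F (Suc n)" "mdist (J (Suc n) w) (tg n) \<le> 6 / real (Suc n)"
        using FS(4)[OF \<open>unb\<close>] by blast
      have jw: "j w \<in> carrier circle_fun" using j[OF w(1)] w(1) F(3)[of "Suc n"] by (auto simp: hom_def)
      have "mdist v (target k) \<le> e / 2"
        using mdist_le[OF v target_circle_fun] k less_imp_le by blast
      moreover have "mdist (j w) (target k) < e / 2"
      proof -
        have "6 / real (Suc n) < e / 2"
        proof -
          have "12 / e < real (Suc n)" using m \<open>m \<le> n\<close> by linarith
          then show ?thesis using e by (simp add: field_simps)
        qed
        then show ?thesis using w(2) j[OF w(1)] tgn by simp
      qed
      ultimately have "mdist (j w) v < e"
        using mdist_triangle[OF jw target_circle_fun v, of k] mdist_commute[OF v target_circle_fun, of k]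
        by linarith
      then show "\<exists>a\<in>A. mdist (j a) v < e" using w(1) F(2) by blast
    qed
  qed
qed

end

text \<open>A topological generator: \<open>gen_seq (Suc n)\<close> is a small modification of \<open>gen_seq n\<close> whose
  power with exponent \<open>2 ^ (n * n)\<close> is the \<open>n\<close>-th target. The exponents grow so fast that later
  modifications do not disturb this.\<close>

primrec gen_seq :: "nat \<Rightarrow> nat \<Rightarrow> complex" where
  "gen_seq 0 i = 1"
| "gen_seq (Suc n) i = gen_seq n i *
     principal_root (2 ^ (n * n)) (target (fst (prod_decode n)) i / gen_seq n i ^ 2 ^ (n * n))"

lemma cmod_target: "cmod (target k i) = 1"
  using target_circle_fun cmod_circle_fun by blast

lemma cmod_gen_seq: "cmod (gen_seq n i) = 1"
  by (induction n) (auto simp: norm_mult)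

lemma gen_seq_pow: "gen_seq (Suc n) i ^ 2 ^ (n * n) = target (fst (prod_decode n)) i"
proof -
  have "principal_root (2 ^ (n * n)) (target (fst (prod_decode n)) i / gen_seq n i ^ 2 ^ (n * n)) ^ 2 ^ (n * n)
      = target (fst (prod_decode n)) i / gen_seq n i ^ 2 ^ (n * n)"
    by (rule principal_root_pow) (auto simp: norm_divide norm_power cmod_gen_seq cmod_target)
  moreover have "gen_seq n i \<noteq> 0" using cmod_gen_seq[of n i] by auto
  ultimately show ?thesis by (simp add: power_mult_distrib)
qed

lemma periodic_gen_seq: "\<exists>p. periodic p (gen_seq n)"
proof (induction n)
  case 0
  have "periodic 0 (gen_seq 0)" by (simp add: periodic_def)
  then show ?case ..
next
  case (Suc n)
  then obtain p q where "periodic p (gen_seq n)" "periodic q (target (fst (prod_decode n)))"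
    using periodic_target by blast
  then have "periodic (max p q) (gen_seq n)" "periodic (max p q) (target (fst (prod_decode n)))"
    using periodic_mono by (metis max.cobounded1, metis max.cobounded2)
  then have "periodic (max p q) (gen_seq (Suc n))"
    unfolding periodic_def gen_seq.simps by metis
  then show ?case ..
qed

lemma gen_seq_step: "cmod (gen_seq (Suc n) i - gen_seq n i) \<le> 4 / 2 ^ (n * n)"
proof -
  let ?r = "principal_root (2 ^ (n * n)) (target (fst (prod_decode n)) i / gen_seq n i ^ 2 ^ (n * n))"
  have "gen_seq (Suc n) i - gen_seq n i = gen_seq n i * (?r - 1)"
    by (simp add: algebra_simps)
  then have "cmod (gen_seq (Suc n) i - gen_seq n i) = cmod (?r - 1)"
    by (simp add: norm_mult cmod_gen_seq)
  also have "\<dots> \<le> 4 / real (2 ^ (n * n))"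
    by (rule principal_root_near_one) simp
  finally show ?thesis by simp
qed

text \<open>A geometric series: since \<open>n * n + m \<le> (n + m) * (n + m)\<close>, the bounds
  for successive steps shrink at least by halves.\<close>

lemma gen_seq_close: "cmod (gen_seq (n + m) i - gen_seq n i) \<le> 8 / 2 ^ (n * n) * (1 - 1 / 2 ^ m)"
proof (induction m)
  case (Suc m)
  have "n * n + m \<le> (n + m) * (n + m)" by (simp add: algebra_simps trans_le_add1 le_square)
  then have "(2::real) ^ (n * n + m) \<le> 2 ^ ((n + m) * (n + m))" by (rule power_increasing) simp
  then have "4 / 2 ^ ((n + m) * (n + m)) \<le> (4 / 2 ^ (n * n + m) :: real)"
    by (intro divide_left_mono) auto
  then have "cmod (gen_seq (Suc (n + m)) i - gen_seq (n + m) i) \<le> 4 / 2 ^ (n * n + m)"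
    using gen_seq_step[of "n + m" i] by linarith
  then have "cmod (gen_seq (Suc (n + m)) i - gen_seq n i)
      \<le> 8 / 2 ^ (n * n) * (1 - 1 / 2 ^ m) + 4 / 2 ^ (n * n + m)"
    using Suc norm_triangle_ineq[of "gen_seq (Suc (n + m)) i - gen_seq (n + m) i" "gen_seq (n + m) i - gen_seq n i"]
    by simp
  also have "\<dots> = 8 / 2 ^ (n * n) * (1 - 1 / 2 ^ Suc m)"
    by (simp add: field_simps power_add)
  finally show ?case by simp
qed simp

text \<open>After stage \<open>Suc n\<close> the limit is within
  \<open>8 / 2 ^ (Suc n * Suc n)\<close>, and raising to the power \<open>2 ^ (n * n)\<close> costs
  that factor. As \<open>Suc n * Suc n\<close> exceeds \<open>n * n\<close> by
  \<open>2 * n + 1\<close>, the error at the \<open>n\<close>-th target is at most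
  \<open>4 / 2 ^ (n + n)\<close>.\<close>

lemma topological_generator:
  obtains u where "u \<in> carrier circle_fun" "mean_dense UNIV (\<lambda>k::nat. u [^]\<^bsub>circle_fun\<^esub> k)"
proof -
  define L where "L i = lim (\<lambda>n. gen_seq n i)" for i
  have close: "cmod (gen_seq m i - gen_seq n i) \<le> 8 / 2 ^ (n * n)" if "n \<le> m" for m n i
  proof -
    have "8 / 2 ^ (n * n) * (1 - 1 / 2 ^ (m - n)) \<le> (8 / 2 ^ (n * n) :: real)"
      by (rule mult_left_le) auto
    then show ?thesis using gen_seq_close[of n "m - n" i] that by simp
  qed
  have small: "\<exists>n. 8 / 2 ^ (n * n) < e" if e: "e > 0" for e :: real
  proof -
    obtain n where n: "(1 / 2) ^ n < e / 8" using real_arch_pow_inv[of "e / 8" "1 / 2"] e by auto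
    have "(2::real) ^ n \<le> 2 ^ (n * n)" by (rule power_increasing) (auto simp: le_square)
    then have "8 / 2 ^ (n * n) \<le> (8 / 2 ^ n :: real)" by (intro divide_left_mono) auto
    also have "\<dots> < e" using n by (simp add: power_divide field_simps)
    finally show ?thesis ..
  qed
  have conv: "(\<lambda>n. gen_seq n i) \<longlonglongrightarrow> L i" for i
  proof -
    have "Cauchy (\<lambda>n. gen_seq n i)"
    proof (rule CauchyI')
      fix e :: real assume "e > 0"
      then obtain N where N: "8 / 2 ^ (N * N) < e / 2" using small[of "e / 2"] by auto
      have "dist (gen_seq m i) (gen_seq n i) < e" if "m \<ge> N" "n > m" for m n
      proof -
        have "cmod (gen_seq m i - gen_seq N i) < e / 2" "cmod (gen_seq n i - gen_seq N i) < e / 2"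
          using close[of N m i] close[of N n i] that N by auto
        then show ?thesis
          using dist_triangle2[of "gen_seq m i" "gen_seq n i" "gen_seq N i"] by (simp add: dist_norm)
      qed
      then show "\<exists>M. \<forall>m\<ge>M. \<forall>n>m. dist (gen_seq m i) (gen_seq n i) < e" by blast
    qed
    then show ?thesis
      unfolding L_def by (rule convergent_LIMSEQ_iff[THEN iffD1, OF Cauchy_convergent])
  qed
  have Lclose: "cmod (L i - gen_seq n i) \<le> 8 / 2 ^ (n * n)" for i n
  proof (rule LIMSEQ_le_const2)
    show "(\<lambda>m. cmod (gen_seq m i - gen_seq n i)) \<longlonglongrightarrow> cmod (L i - gen_seq n i)"
      by (intro tendsto_intros conv)
    show "\<exists>N. \<forall>m\<ge>N. cmod (gen_seq m i - gen_seq n i) \<le> 8 / 2 ^ (n * n)"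
      using close by blast
  qed
  have L1: "cmod (L i) = 1" for i
    using tendsto_norm[OF conv[of i]] by (simp add: cmod_gen_seq LIMSEQ_const_iff)
  have "nearly_periodic L"
    unfolding nearly_periodic_def
  proof (intro allI impI)
    fix e :: real assume "e > 0"
    then obtain n where n: "8 / 2 ^ (n * n) < e / 2" using small[of "e / 2"] by auto
    obtain p where p: "periodic p (gen_seq n)" using periodic_gen_seq by blast
    have "cmod (L i - L j) < e" if "i mod 2 ^ p = j mod 2 ^ p" for i j
    proof -
      have "gen_seq n i = gen_seq n j" using p that unfolding periodic_def by blast
      then have "cmod (L i - L j) \<le> cmod (L i - gen_seq n i) + cmod (L j - gen_seq n j)"
        using norm_triangle_ineq4[of "L i - gen_seq n i" "L j - gen_seq n j"] by simp
      then show ?thesis using Lclose[of i n] Lclose[of j n] n by linarith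
    qed
    then show "\<exists>p. \<forall>i j. i mod 2 ^ p = j mod 2 ^ p \<longrightarrow> cmod (L i - L j) < e" by blast
  qed
  then have L: "L \<in> carrier circle_fun" using L1 by (simp add: mem_circle_fun)
  moreover have "mean_dense UNIV (\<lambda>k::nat. L [^]\<^bsub>circle_fun\<^esub> k)"
    unfolding mean_dense_def
  proof (intro ballI allI impI)
    fix v and e :: real assume v: "v \<in> carrier circle_fun" and e: "e > 0"
    obtain k where k: "\<And>i. cmod (v i - target k i) < e / 3" using target_dense[OF v, of "e / 3"] e by auto
    obtain m where m: "(1 / 2) ^ m < e / 12" using real_arch_pow_inv[of "e / 12" "1 / 2"] e by auto
    \<comment> \<open>The second component only pushes the stage \<open>n\<close> up to
      \<open>m\<close> or beyond, where the error is below \<open>e / 3\<close>.\<close>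
    define n where "n = prod_encode (k, m)"
    have "m \<le> n" unfolding n_def by (rule le_prod_encode_2)
    let ?w = "L [^]\<^bsub>circle_fun\<^esub> (2 ^ (n * n) :: nat)"
    have "cmod (?w i - target k i) < e / 3" for i
    proof -
      have "cmod (?w i - target k i) = cmod (L i ^ 2 ^ (n * n) - gen_seq (Suc n) i ^ 2 ^ (n * n))"
        unfolding gen_seq_pow by (simp add: pow_circle_fun n_def)
      also have "\<dots> \<le> real (2 ^ (n * n)) * cmod (L i - gen_seq (Suc n) i)"
        by (rule norm_power_diff) (auto simp: L1 cmod_gen_seq simp del: gen_seq.simps)
      also have "\<dots> \<le> real (2 ^ (n * n)) * (8 / 2 ^ (Suc n * Suc n))"
        by (intro mult_left_mono Lclose) auto
      also have "\<dots> = 4 / 2 ^ (n + n)"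
      proof -
        have "Suc n * Suc n = n * n + (n + n) + 1" by simp
        then have "(2::real) ^ (Suc n * Suc n) = 2 ^ (n * n) * 2 ^ (n + n) * 2"
          by (simp only: power_add power_one_right)
        then show ?thesis by simp
      qed
      also have "\<dots> \<le> 4 / 2 ^ m"
        using \<open>m \<le> n\<close> by (intro divide_left_mono power_increasing) auto
      also have "\<dots> < e / 3" using m by (simp add: power_divide field_simps)
      finally show ?thesis .
    qed
    moreover have "?w \<in> carrier circle_fun" using L by simp
    ultimately have "mdist ?w (target k) \<le> e / 3" "mdist v (target k) \<le> e / 3"
      using mdist_le[OF _ target_circle_fun] v k less_imp_le by blast+
    then have "mdist ?w v < e"
      using mdist_triangle[OF CF.nat_pow_closed[OF L] target_circle_fun v, of "2 ^ (n * n)" k]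
        mdist_commute[OF v target_circle_fun, of k] e by linarith
    then show "\<exists>a\<in>UNIV. mdist (L [^]\<^bsub>circle_fun\<^esub> (a::nat)) v < e" by blast
  qed
  ultimately show ?thesis by (rule that)
qed

context comm_group
begin

lemma circle_embeddable_torsion:
  assumes "subgroup A G" "countable A" "\<And>a. a \<in> A \<Longrightarrow> \<exists>n>0. a [^] (n::nat) = \<one>"
    and "\<And>n::nat. n > 0 \<Longrightarrow> \<exists>a\<in>A. a [^] n \<noteq> \<one>"
  shows "circle_embeddable A"
proof -
  obtain j where "j \<in> hom (G\<lparr>carrier := A\<rparr>) circle_fun"
    "\<And>a. a \<in> A \<Longrightarrow> j a = \<one>\<^bsub>circle_fun\<^esub> \<Longrightarrow> a = \<one>"
    "(\<And>n::nat. n > 0 \<Longrightarrow> \<exists>a\<in>A. a [^] n \<noteq> \<one>) \<Longrightarrow> mean_dense A j"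
    using torsion_embedding[OF assms(1-3)] by metis
  then show ?thesis
    unfolding circle_embeddable_def using assms(1,4) by blast
qed

lemma int_pow_eq_one_iff:
  assumes x: "x \<in> carrier G" and inf: "\<And>n::nat. n > 0 \<Longrightarrow> x [^] n \<noteq> \<one>"
  shows "x [^] (k::int) = \<one> \<longleftrightarrow> k = 0"
proof
  assume k: "x [^] k = \<one>"
  obtain n where n: "k = int n \<or> k = - int n" by (metis int_cases2)
  have "x [^] (- k) = \<one>" using k x by (simp add: int_pow_neg)
  then have "x [^] n = \<one>" using k n int_pow_int[of G x n] by auto
  then have "n = 0" using inf[of n] by (metis neq0_conv)
  then show "k = 0" using n by auto
qed simp

text \<open>Injectivity on the infinite cyclic part comes for free: if \<open>u\<close> had finite order \<open>m\<close>, its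
  powers could not approximate a function of constant value \<open>cis (pi / m)\<close>.\<close>

lemma circle_embeddable_cyclic:
  assumes x: "x \<in> carrier G" and inf: "\<And>n::nat. n > 0 \<Longrightarrow> x [^] n \<noteq> \<one>"
    and W: "subgroup W G" "finite W" and disj: "generate G {x} \<inter> W \<subseteq> {\<one>}"
  shows "circle_embeddable (generate G {x} <#> W)"
proof -
  obtain u where u: "u \<in> carrier circle_fun" "mean_dense UNIV (\<lambda>k::nat. u [^]\<^bsub>circle_fun\<^esub> k)"
    using topological_generator by blast
  have uinf: "m = 0" if m: "u [^]\<^bsub>circle_fun\<^esub> m = \<one>\<^bsub>circle_fun\<^esub>" for m :: nat
  proof (rule ccontr)
    assume "m \<noteq> 0"
    define v where "v = (\<lambda>i::nat. cis (pi / m))"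
    have v: "v \<in> carrier circle_fun"
      by (rule periodic_circle_fun[of 0]) (auto simp: v_def periodic_def)
    then obtain k :: nat where k: "mdist (u [^]\<^bsub>circle_fun\<^esub> k) v < 1 / m"
      using u(2) \<open>m \<noteq> 0\<close> unfolding mean_dense_def by (metis divide_pos_pos of_nat_0_less_iff zero_less_one neq0_conv)
    have "v [^]\<^bsub>circle_fun\<^esub> m = (\<lambda>i. -1)"
      using \<open>m \<noteq> 0\<close> by (auto simp: pow_circle_fun v_def Complex.DeMoivre)
    moreover have "(u [^]\<^bsub>circle_fun\<^esub> k) [^]\<^bsub>circle_fun\<^esub> m = \<one>\<^bsub>circle_fun\<^esub>"
      using m u(1) by (metis CF.nat_pow_one CF.nat_pow_pow mult.commute)
    ultimately have "mdist \<one>\<^bsub>circle_fun\<^esub> (\<lambda>i. -1) \<le> m * mdist (u [^]\<^bsub>circle_fun\<^esub> k) v"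
      using mdist_pow[of "u [^]\<^bsub>circle_fun\<^esub> k" v m] u(1) v by simp
    also have "\<dots> < 1" using k \<open>m \<noteq> 0\<close> by (simp add: field_simps)
    also have "mdist \<one>\<^bsub>circle_fun\<^esub> (\<lambda>i. -1) = 2"
    proof -
      have "(\<lambda>i::nat. -1) \<in> carrier circle_fun"
        by (rule periodic_circle_fun[of 0]) (auto simp: periodic_def)
      then have "mdist \<one>\<^bsub>circle_fun\<^esub> (\<lambda>i. -1) = mean (\<lambda>i. -1)"
        by (simp add: mdist_commute[of "\<one>\<^bsub>circle_fun\<^esub>"] mdist_one)
      also have "avg (\<lambda>i. -1) = (\<lambda>n. 2)" by (simp add: avg_def fun_eq_iff)
      then have "mean (\<lambda>i. -1) = 2" by (simp add: mean_def)
      finally show ?thesis .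
    qed
    finally show False by simp
  qed
  have "u [^]\<^bsub>circle_fun\<^esub> k = \<one>\<^bsub>circle_fun\<^esub>" if "x [^] k = \<one>" for k :: int
    using that int_pow_eq_one_iff[OF x inf] by simp
  then obtain \<psi> where \<psi>: "\<psi> \<in> hom (G\<lparr>carrier := generate G {x}\<rparr>) circle_fun"
    "\<And>k::int. \<psi> (x [^] k) = u [^]\<^bsub>circle_fun\<^esub> k"
    using hom_cyclic[OF x comm_group_circle_fun u(1)] by metis
  have \<psi>n: "\<psi> (x [^] k) = u [^]\<^bsub>circle_fun\<^esub> k" for k :: nat
    using \<psi>(2)[of "int k"] by (simp add: int_pow_int)
  have \<psi>inj: "y = \<one>" if y: "y \<in> generate G {x}" "\<psi> y = \<one>\<^bsub>circle_fun\<^esub>" for y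
  proof -
    obtain k :: int where k: "y = x [^] k" using y mem_generate_singleton[OF x] by blast
    have uk: "u [^]\<^bsub>circle_fun\<^esub> k = \<one>\<^bsub>circle_fun\<^esub>" using y(2) \<psi>(2) k by simp
    have "k = 0"
    proof (rule CF.int_pow_eq_one_iff[OF u(1), THEN iffD1, OF _ uk])
      show "u [^]\<^bsub>circle_fun\<^esub> n \<noteq> \<one>\<^bsub>circle_fun\<^esub>" if "n > 0" for n :: nat
        using uinf[of n] that by auto
    qed
    then show ?thesis using k by simp
  qed
  have Wtor: "\<exists>n>0. w [^] (n::nat) = \<one>" if "w \<in> W" for w
    using finite_subgroup_exponent[OF W that] W(2) that by (metis card_gt_0_iff empty_iff)
  \<comment> \<open>The finite factor is merely embedded injectively; density comes from the cyclic
    factor alone.\<close>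
  obtain \<eta> where \<eta>: "\<eta> \<in> hom (G\<lparr>carrier := W\<rparr>) circle_fun"
    "\<And>a. a \<in> W \<Longrightarrow> \<eta> a = \<one>\<^bsub>circle_fun\<^esub> \<Longrightarrow> a = \<one>"
    using torsion_embedding[OF W(1) countable_finite[OF W(2)] Wtor] by metis
  note gx = subgroup_generate_singleton[OF x]
  have "\<psi> y = \<eta> y" if "y \<in> generate G {x}" "y \<in> W" for y
    using disj that hom_eq_one[OF is_group CF.is_group gx \<psi>(1)] hom_eq_one[OF is_group CF.is_group W(1) \<eta>(1)]
    by auto
  then obtain \<theta> where \<theta>: "\<theta> \<in> hom (G\<lparr>carrier := generate G {x} <#> W\<rparr>) circle_fun"
    "\<And>a. a \<in> generate G {x} \<Longrightarrow> \<theta> a = \<psi> a" "\<And>b. b \<in> W \<Longrightarrow> \<theta> b = \<eta> b"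
    using hom_glue[OF gx W(1) comm_group_circle_fun \<psi>(1) \<eta>(1)] by blast
  note inc = set_mult_incl[OF gx W(1)]
  have S: "subgroup (generate G {x} <#> W) G" by (rule mult_subgroups[OF gx W(1)])
  have "y = \<one>" if y: "y \<in> generate G {x} <#> W" "\<theta> y = \<one>\<^bsub>circle_fun\<^esub>" for y
  proof -
    obtain a w where aw: "a \<in> generate G {x}" "w \<in> W" "y = a \<otimes> w" using y(1) by (auto simp: mem_set_mult)
    have car: "a \<in> carrier G" "w \<in> carrier G"
      using aw subgroup.mem_carrier[OF gx] subgroup.mem_carrier[OF W(1)] by auto
    \<comment> \<open>Raising to the power \<open>card W\<close> removes the finite factor.
      Injectivity on the cyclic group and the infinite order of \<open>x\<close> then force
      \<open>a\<close> to be trivial.\<close>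
    have cW: "card W > 0" using W(2) aw(2) by (auto simp: card_gt_0_iff)
    have "y [^] card W = a [^] card W"
      using car finite_subgroup_exponent[OF W aw(2)] by (simp add: aw(3) pow_mult_distrib m_comm)
    moreover have "\<theta> (y [^] card W) = \<one>\<^bsub>circle_fun\<^esub>"
      using hom_on_pow[OF S comm_group_circle_fun \<theta>(1) y(1), of "card W"] y(2) by simp
    moreover have aW: "a [^] card W \<in> generate G {x}" by (rule subgroup_pow_closed[OF gx aw(1)])
    ultimately have "\<psi> (a [^] card W) = \<one>\<^bsub>circle_fun\<^esub>" using \<theta>(2) by simp
    then have a1: "a [^] card W = \<one>" using \<psi>inj aW by blast
    obtain k :: int where k: "a = x [^] k" using aw(1) mem_generate_singleton[OF x] by blast
    have "x [^] (k * int (card W)) = \<one>" using a1 k x by (simp add: int_pow_pow[symmetric] int_pow_int)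
    then have "k = 0" using int_pow_eq_one_iff[OF x inf] cW by simp
    then have "y = w" using k aw(3) car by simp
    then show ?thesis using \<eta>(2) \<theta>(3) aw(2) y(2) by simp
  qed
  moreover have "mean_dense (generate G {x} <#> W) \<theta>"
    unfolding mean_dense_def
  proof (intro ballI allI impI)
    fix v and e :: real assume "v \<in> carrier circle_fun" "e > 0"
    then obtain k :: nat where k: "mdist (u [^]\<^bsub>circle_fun\<^esub> k) v < e"
      using u(2) unfolding mean_dense_def by blast
    have "x [^] k \<in> generate G {x}" by (rule subgroup_pow_closed[OF gx]) (simp add: generate.incl)
    then have "x [^] k \<in> generate G {x} <#> W" "mdist (\<theta> (x [^] k)) v < e"
      using inc(1) \<theta>(2) \<psi>n k by auto
    then show "\<exists>a\<in>generate G {x} <#> W. mdist (\<theta> a) v < e" by blast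
  qed
  ultimately show ?thesis
    unfolding circle_embeddable_def using S \<theta>(1) by blast
qed

end

section \<open>Independent families of subgroups\<close>

lemma subset_chain_finite:
  assumes "subset.chain X C" "C \<noteq> {}" "finite F" "F \<subseteq> \<Union>C"
  shows "\<exists>A\<in>C. F \<subseteq> A"
  using assms(3,4)
proof (induction F)
  case empty
  then show ?case using assms(2) by blast
next
  case (insert x F)
  obtain A where A: "A \<in> C" "F \<subseteq> A" using insert by auto
  obtain B where B: "B \<in> C" "x \<in> B" using insert.prems by auto
  have "A \<subseteq> B \<or> B \<subseteq> A"
    using assms(1) A(1) B(1) unfolding subset_chain_def by blast
  then show ?case
  proof
    assume "A \<subseteq> B"
    then have "insert x F \<subseteq> B" using A B by auto
    then show ?thesis using B(1) by blast
  next
    assume "B \<subseteq> A"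
    then have "insert x F \<subseteq> A" using A B by auto
    then show ?thesis using A(1) by blast
  qed
qed

context comm_group
begin

text \<open>This says that the span is the internal direct sum of the members.\<close>

definition independent_family :: "'a set set \<Rightarrow> bool" where
  "independent_family \<C> \<longleftrightarrow> (\<forall>A\<in>\<C>. subgroup A G) \<and>
     (\<forall>A\<in>\<C>. A \<inter> generate G (\<Union>(\<C> - {A})) \<subseteq> {\<one>})"

lemma Union_subgroups_carrier: "(\<And>A. A \<in> \<C> \<Longrightarrow> subgroup A G) \<Longrightarrow> \<Union>\<C> \<subseteq> carrier G"
  by (meson Union_least subgroup.subset)

lemma subgroup_span: "(\<And>A. A \<in> \<C> \<Longrightarrow> subgroup A G) \<Longrightarrow> subgroup (generate G (\<Union>\<C>)) G"
  by (intro generate_is_subgroup Union_subgroups_carrier)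

lemma span_insert:
  assumes A: "subgroup A G" and \<D>: "\<And>B. B \<in> \<D> \<Longrightarrow> subgroup B G"
  shows "generate G (\<Union>(insert A \<D>)) = A <#> generate G (\<Union>\<D>)"
proof
  have S: "subgroup (generate G (\<Union>\<D>)) G" using \<D> by (rule subgroup_span)
  note inc = set_mult_incl[OF A S]
  have "\<Union>\<D> \<subseteq> generate G (\<Union>\<D>)" by (auto intro: generate.incl)
  then have "\<Union>(insert A \<D>) \<subseteq> A <#> generate G (\<Union>\<D>)" using inc by auto
  then show "generate G (\<Union>(insert A \<D>)) \<subseteq> A <#> generate G (\<Union>\<D>)"
    by (rule generate_subgroup_incl) (rule mult_subgroups[OF A S])
  show "A <#> generate G (\<Union>\<D>) \<subseteq> generate G (\<Union>(insert A \<D>))"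
  proof (rule set_mult_least)
    show "subgroup (generate G (\<Union>(insert A \<D>))) G"
      using A \<D> by (intro subgroup_span) auto
    show "A \<subseteq> generate G (\<Union>(insert A \<D>))" by (auto intro: generate.incl)
    show "generate G (\<Union>\<D>) \<subseteq> generate G (\<Union>(insert A \<D>))" by (rule mono_generate) auto
  qed
qed

text \<open>A product involves only finitely many generators. This finite character makes
  independence pass to unions of chains and permits induction over finite subfamilies.\<close>

lemma span_finite:
  assumes "x \<in> generate G (\<Union>\<C>)"
  shows "\<exists>\<D>. finite \<D> \<and> \<D> \<subseteq> \<C> \<and> x \<in> generate G (\<Union>\<D>)"
  using assms
proof (induction rule: generate.induct)
  case one
  show ?case by (intro exI[of _ "{}"]) (auto intro: generate.one)
next
  case (incl h)
  then obtain A where "A \<in> \<C>" "h \<in> A" by blast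
  then show ?case by (intro exI[of _ "{A}"]) (auto intro: generate.incl)
next
  case (inv h)
  then obtain A where "A \<in> \<C>" "h \<in> A" by blast
  then show ?case by (intro exI[of _ "{A}"]) (auto intro: generate.inv)
next
  case (eng h1 h2)
  then obtain \<D>1 \<D>2 where D: "finite \<D>1" "\<D>1 \<subseteq> \<C>" "h1 \<in> generate G (\<Union>\<D>1)"
    "finite \<D>2" "\<D>2 \<subseteq> \<C>" "h2 \<in> generate G (\<Union>\<D>2)" by blast
  have "h1 \<in> generate G (\<Union>(\<D>1 \<union> \<D>2))" "h2 \<in> generate G (\<Union>(\<D>1 \<union> \<D>2))"
    using D(3,6) mono_generate[of "\<Union>\<D>1" "\<Union>(\<D>1 \<union> \<D>2)"] mono_generate[of "\<Union>\<D>2" "\<Union>(\<D>1 \<union> \<D>2)"]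
    by auto
  then have "h1 \<otimes> h2 \<in> generate G (\<Union>(\<D>1 \<union> \<D>2))" by (rule generate.eng)
  then show ?case using D by (intro exI[of _ "\<D>1 \<union> \<D>2"]) auto
qed

lemma independent_subset:
  assumes "independent_family \<C>" "\<D> \<subseteq> \<C>"
  shows "independent_family \<D>"
proof -
  have "A \<inter> generate G (\<Union>(\<D> - {A})) \<subseteq> {\<one>}" if A: "A \<in> \<D>" for A
  proof -
    have "generate G (\<Union>(\<D> - {A})) \<subseteq> generate G (\<Union>(\<C> - {A}))"
      using assms(2) by (intro mono_generate) blast
    moreover have "A \<inter> generate G (\<Union>(\<C> - {A})) \<subseteq> {\<one>}"
      using assms A unfolding independent_family_def by auto
    ultimately show ?thesis by blast
  qed
  then show ?thesis using assms unfolding independent_family_def by auto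
qed

text \<open>If an element of \<open>B\<close> is the product of some \<open>m\<close> in
  \<open>M\<close> and an element of the span of the remaining members, then \<open>m\<close> lies
  in the span of \<open>\<C>\<close> and is trivial; independence of \<open>\<C>\<close> does the
  rest.\<close>

lemma independent_insert:
  assumes ind: "independent_family \<C>" and M: "subgroup M G" "M \<inter> generate G (\<Union>\<C>) \<subseteq> {\<one>}"
  shows "independent_family (insert M \<C>)"
proof (cases "M \<in> \<C>")
  case True
  then show ?thesis using ind by (simp add: insert_absorb)
next
  case False
  have sub: "\<And>A. A \<in> \<C> \<Longrightarrow> subgroup A G" using ind unfolding independent_family_def by blast
  have "x = \<one>" if B: "B \<in> \<C>" and x: "x \<in> B" "x \<in> generate G (\<Union>(insert M \<C> - {B}))" for B x
  proof -
    have "insert M \<C> - {B} = insert M (\<C> - {B})" using False B by auto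
    then have "x \<in> M <#> generate G (\<Union>(\<C> - {B}))"
      using x(2) span_insert[OF M(1), of "\<C> - {B}"] sub by auto
    then obtain m c where mc: "m \<in> M" "c \<in> generate G (\<Union>(\<C> - {B}))" "x = m \<otimes> c"
      by (auto simp: mem_set_mult)
    have S: "subgroup (generate G (\<Union>\<C>)) G" using sub by (rule subgroup_span)
    have "c \<in> generate G (\<Union>\<C>)" using mc(2) mono_generate[of "\<Union>(\<C> - {B})" "\<Union>\<C>"] by auto
    moreover have "x \<in> generate G (\<Union>\<C>)" using x(1) B by (auto intro: generate.incl)
    ultimately have "x \<otimes> inv c \<in> generate G (\<Union>\<C>)"
      using S by (simp add: subgroup.m_closed subgroup.m_inv_closed)
    moreover have car: "m \<in> carrier G" "c \<in> carrier G"
      using mc(1) M(1) \<open>c \<in> generate G (\<Union>\<C>)\<close> S by (auto dest: subgroup.mem_carrier)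
    then have "x \<otimes> inv c = m" by (simp add: mc(3) m_assoc)
    ultimately have "m = \<one>" using M(2) mc(1) by auto
    then have "x \<in> generate G (\<Union>(\<C> - {B}))" using mc car by simp
    then show ?thesis using ind B x(1) unfolding independent_family_def by blast
  qed
  moreover have "insert M \<C> - {M} = \<C>" using False by auto
  ultimately show ?thesis
    unfolding independent_family_def using sub M by auto
qed

lemma independent_chain:
  assumes ne: "K \<noteq> {}" and chain: "subset.chain {\<C>. independent_family \<C> \<and> P \<C>} K"
  shows "independent_family (\<Union>K)"
proof -
  have ind: "independent_family \<C>" if "\<C> \<in> K" for \<C>
    using chain that unfolding subset.chain_def by blast
  have "x = \<one>" if A: "A \<in> \<Union>K" and x: "x \<in> A" "x \<in> generate G (\<Union>(\<Union>K - {A}))" for A x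
  proof -
    obtain \<D> where \<D>: "finite \<D>" "\<D> \<subseteq> \<Union>K - {A}" "x \<in> generate G (\<Union>\<D>)"
      using span_finite[OF x(2)] by blast
    have "\<exists>\<C>\<in>K. insert A \<D> \<subseteq> \<C>"
      using \<D> A by (intro subset_chain_finite[OF chain ne]) auto
    then obtain \<C> where \<C>: "\<C> \<in> K" "A \<in> \<C>" "\<D> \<subseteq> \<C>" by blast
    have "x \<in> generate G (\<Union>(\<C> - {A}))"
      using \<D> \<C>(3) mono_generate[of "\<Union>\<D>" "\<Union>(\<C> - {A})"] by blast
    then show ?thesis using ind[OF \<C>(1)] \<C>(2) x(1) unfolding independent_family_def by blast
  qed
  then show ?thesis
    using ind unfolding independent_family_def by blast
qed

text \<open>Maximality is put in the form in which it is applied: an admissible \<open>M\<close>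
  that meets the span trivially could be added, so it already is a member, lies in the span, and
  must be trivial.\<close>

lemma maximal_independent_family:
  obtains \<C> where "independent_family \<C>" "\<And>A. A \<in> \<C> \<Longrightarrow> P A"
    "\<And>M. subgroup M G \<Longrightarrow> P M \<Longrightarrow> M \<inter> generate G (\<Union>\<C>) \<subseteq> {\<one>} \<Longrightarrow> M \<subseteq> {\<one>}"
proof -
  define Z where "Z = {\<C>. independent_family \<C> \<and> (\<forall>A\<in>\<C>. P A)}"
  have "\<exists>M\<in>Z. \<forall>X\<in>Z. M \<subseteq> X \<longrightarrow> X = M"
  proof (rule subset_Zorn_nonempty)
    have "independent_family {}" by (simp add: independent_family_def)
    then show "Z \<noteq> {}" unfolding Z_def by blast
    fix K assume K: "K \<noteq> {}" "subset.chain Z K"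
    then have "independent_family (\<Union>K)" unfolding Z_def by (rule independent_chain)
    moreover have "\<forall>A\<in>\<Union>K. P A" using K(2) unfolding Z_def subset.chain_def by blast
    ultimately show "\<Union>K \<in> Z" unfolding Z_def by blast
  qed
  then obtain \<C> where \<C>: "\<C> \<in> Z" and max: "\<And>X. X \<in> Z \<Longrightarrow> \<C> \<subseteq> X \<Longrightarrow> X = \<C>" by blast
  show ?thesis
  proof (rule that)
    show "independent_family \<C>" "\<And>A. A \<in> \<C> \<Longrightarrow> P A" using \<C> unfolding Z_def by auto
    fix M assume M: "subgroup M G" "P M" "M \<inter> generate G (\<Union>\<C>) \<subseteq> {\<one>}"
    have "insert M \<C> \<in> Z"
      using \<C> M independent_insert unfolding Z_def by auto
    then have "M \<in> \<C>" using max[of "insert M \<C>"] by blast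
    then have "M \<subseteq> generate G (\<Union>\<C>)" by (auto intro: generate.incl)
    then show "M \<subseteq> {\<one>}" using M(3) by blast
  qed
qed

lemma maximal_disjoint_subgroup:
  assumes C: "subgroup C G" and P: "subgroup P G"
  obtains W where "subgroup W G" "W \<subseteq> P" "W \<inter> C \<subseteq> {\<one>}"
    "\<And>V. subgroup V G \<Longrightarrow> V \<subseteq> P \<Longrightarrow> V \<inter> C \<subseteq> {\<one>} \<Longrightarrow> W \<subseteq> V \<Longrightarrow> V = W"
proof -
  define Z where "Z = {W. subgroup W G \<and> W \<subseteq> P \<and> W \<inter> C \<subseteq> {\<one>}}"
  have "\<exists>M\<in>Z. \<forall>X\<in>Z. M \<subseteq> X \<longrightarrow> X = M"
  proof (rule subset_Zorn_nonempty)
    have "{\<one>} \<in> Z" unfolding Z_def using triv_subgroup subgroup.one_closed[OF P] by auto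
    then show "Z \<noteq> {}" by blast
    fix K assume K: "K \<noteq> {}" "subset.chain Z K"
    then have sub: "W \<in> Z" if "W \<in> K" for W using that unfolding subset.chain_def by blast
    have "subgroup (\<Union>K) G"
    proof (rule subgroupI)
      show "\<Union>K \<subseteq> carrier G" using sub unfolding Z_def by (auto dest: subgroup.mem_carrier)
      obtain W0 where W0: "W0 \<in> K" using K(1) by blast
      then have "\<one> \<in> W0" using sub unfolding Z_def by (auto intro: subgroup.one_closed)
      then show "\<Union>K \<noteq> {}" using W0 by blast
      show "inv a \<in> \<Union>K" if "a \<in> \<Union>K" for a
        using that sub unfolding Z_def by (auto intro: subgroup.m_inv_closed)
      show "a \<otimes> b \<in> \<Union>K" if ab: "a \<in> \<Union>K" "b \<in> \<Union>K" for a b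
      proof -
        have "\<exists>W\<in>K. {a, b} \<subseteq> W" using ab by (intro subset_chain_finite[OF K(2,1)]) auto
        then obtain W where "W \<in> K" "a \<in> W" "b \<in> W" by blast
        then show ?thesis using sub unfolding Z_def by (auto intro: subgroup.m_closed)
      qed
    qed
    then show "\<Union>K \<in> Z" using sub unfolding Z_def by blast
  qed
  then obtain W where W: "W \<in> Z" "\<And>X. X \<in> Z \<Longrightarrow> W \<subseteq> X \<Longrightarrow> X = W" by blast
  show ?thesis
  proof (rule that)
    show "subgroup W G" "W \<subseteq> P" "W \<inter> C \<subseteq> {\<one>}" using W(1) unfolding Z_def by auto
    show "V = W" if "subgroup V G" "V \<subseteq> P" "V \<inter> C \<subseteq> {\<one>}" "W \<subseteq> V" for V
      using W(2)[of V] that unfolding Z_def by blast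
  qed
qed

lemma hom_trivial_on_generate:
  assumes J: "J \<in> hom G E" and E: "comm_group E" and S: "S \<subseteq> carrier G"
    and triv: "\<And>s. s \<in> S \<Longrightarrow> J s = \<one>\<^bsub>E\<^esub>" and x: "x \<in> generate G S"
  shows "J x = \<one>\<^bsub>E\<^esub>"
proof -
  interpret E: comm_group E by (rule E)
  interpret J: group_hom G E J using J by unfold_locales
  from x show ?thesis
  proof (induction rule: generate.induct)
    case (eng h1 h2)
    then show ?case using generate_in_carrier[OF S] by simp
  qed (use triv S in auto)
qed

text \<open>Each map detects the component in one member and ignores the others, so an element all
  of whose images are trivial has only trivial components. The induction strips off one member at a
  time.\<close>

lemma span_separated:
  assumes E: "comm_group E" and sub: "\<And>A. A \<in> \<C> \<Longrightarrow> subgroup A G"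
    and J: "\<And>A. A \<in> \<C> \<Longrightarrow> J A \<in> hom G E"
    and inj: "\<And>A a. A \<in> \<C> \<Longrightarrow> a \<in> A \<Longrightarrow> J A a = \<one>\<^bsub>E\<^esub> \<Longrightarrow> a = \<one>"
    and triv: "\<And>A B b. A \<in> \<C> \<Longrightarrow> B \<in> \<C> \<Longrightarrow> A \<noteq> B \<Longrightarrow> b \<in> B \<Longrightarrow> J A b = \<one>\<^bsub>E\<^esub>"
    and x: "x \<in> generate G (\<Union>\<C>)" and ker: "\<And>A. A \<in> \<C> \<Longrightarrow> J A x = \<one>\<^bsub>E\<^esub>"
  shows "x = \<one>"
proof -
  interpret E: comm_group E by (rule E)
  have main: "\<forall>x\<in>generate G (\<Union>\<D>). (\<forall>A\<in>\<D>. J A x = \<one>\<^bsub>E\<^esub>) \<longrightarrow> x = \<one>" if "finite \<D>" "\<D> \<subseteq> \<C>" for \<D>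
    using that
  proof (induction \<D>)
    case empty
    have "generate G {} = {\<one>}" by (rule generate_empty)
    then show ?case by simp
  next
    case (insert A \<D>)
    show ?case
    proof (intro ballI impI)
      fix x assume x: "x \<in> generate G (\<Union>(insert A \<D>))" and ker: "\<forall>B\<in>insert A \<D>. J B x = \<one>\<^bsub>E\<^esub>"
      have A: "A \<in> \<C>" "subgroup A G" using insert.prems sub by auto
      have \<D>: "\<And>B. B \<in> \<D> \<Longrightarrow> subgroup B G" using insert.prems sub by auto
      obtain a b where ab: "a \<in> A" "b \<in> generate G (\<Union>\<D>)" "x = a \<otimes> b"
        using x span_insert[OF A(2) \<D>] by (auto simp: mem_set_mult)
      have car: "a \<in> carrier G" "b \<in> carrier G"
        using ab A(2) subgroup_span[OF \<D>] by (auto dest: subgroup.mem_carrier)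
      have "J A b = \<one>\<^bsub>E\<^esub>"
      proof (rule hom_trivial_on_generate[OF J[OF A(1)] E _ _ ab(2)])
        show "\<Union>\<D> \<subseteq> carrier G" using \<D> by (rule Union_subgroups_carrier)
        fix s assume "s \<in> \<Union>\<D>"
        then obtain B where "B \<in> \<D>" "s \<in> B" by blast
        then show "J A s = \<one>\<^bsub>E\<^esub>" using triv[of A B s] A insert by auto
      qed
      moreover have "J A a \<in> carrier E" "J A x = J A a \<otimes>\<^bsub>E\<^esub> J A b"
        using J[OF A(1)] car by (auto simp: hom_def ab(3))
      ultimately have "J A a = \<one>\<^bsub>E\<^esub>" using ker by simp
      then have "a = \<one>" using inj A ab by blast
      then have "x = b" using ab car by simp
      then show "x = \<one>" using insert ab(2) ker by auto
    qed
  qed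
  obtain \<D> where "finite \<D>" "\<D> \<subseteq> \<C>" "x \<in> generate G (\<Union>\<D>)" using span_finite[OF x] by blast
  then show ?thesis using main ker by blast
qed

text \<open>For a prime \<open>p\<close> dividing \<open>e\<close>, raising to the power
  \<open>p\<close> sends the elements killed by \<open>e\<close> to elements killed by
  \<open>e div p\<close>, and its fibres lie in translates of the finite set of elements killed by a
  prime.\<close>

lemma finite_if_finite_socle:
  assumes W: "subgroup W G" and fin: "finite {w \<in> W. \<exists>p. prime (p::nat) \<and> w [^] p = \<one>}"
    and e: "e > (0::nat)"
  shows "finite {w \<in> W. w [^] e = \<one>}"
  using e
proof (induction e rule: less_induct)
  case (less e)
  note W' = subgroup.mem_carrier[OF W]
  show ?case
  proof (cases "e = 1")
    case True
    then have "{w \<in> W. w [^] e = \<one>} \<subseteq> {\<one>}" using W' by auto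
    then show ?thesis using finite_subset by blast
  next
    case False
    then obtain p where p: "prime p" "p dvd e" using prime_factor_nat by blast
    define k where "k = e div p"
    have ek: "e = p * k" using p by (simp add: k_def)
    have k: "k < e" "k > 0" using less.prems prime_gt_1_nat[OF p(1)] by (auto simp: ek)
    let ?X = "{w \<in> W. w [^] e = \<one>}" and ?S = "{w \<in> W. \<exists>p. prime (p::nat) \<and> w [^] p = \<one>}"
    have "(\<lambda>w. w [^] p) ` ?X \<subseteq> {w \<in> W. w [^] k = \<one>}"
      using W' subgroup_pow_closed[OF W] by (auto simp: ek nat_pow_pow)
    then have fin_im: "finite ((\<lambda>w. w [^] p) ` ?X)"
      using less.IH[OF k] finite_subset by blast
    have fib: "finite {w \<in> ?X. w [^] p = v [^] p}" if v: "v \<in> ?X" for v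
    proof (rule finite_subset)
      show "{w \<in> ?X. w [^] p = v [^] p} \<subseteq> (\<lambda>s. s \<otimes> v) ` ?S"
      proof
        fix w assume w: "w \<in> {w \<in> ?X. w [^] p = v [^] p}"
        have car: "w \<in> carrier G" "v \<in> carrier G" using w v W' by auto
        have "(w \<otimes> inv v) [^] p = \<one>"
          using w car by (simp add: pow_mult_distrib m_comm nat_pow_inv)
        moreover have "w \<otimes> inv v \<in> W" using w v W by (simp add: subgroup.m_closed subgroup.m_inv_closed)
        ultimately have "w \<otimes> inv v \<in> ?S" using p(1) by blast
        moreover have "w = (w \<otimes> inv v) \<otimes> v" using car by (simp add: m_assoc)
        ultimately show "w \<in> (\<lambda>s. s \<otimes> v) ` ?S" by blast
      qed
    qed (use fin in simp)
    have "finite (\<Union>y\<in>(\<lambda>w. w [^] p) ` ?X. {w \<in> ?X. w [^] p = y})"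
    proof (rule finite_UN_I[OF fin_im])
      fix y assume "y \<in> (\<lambda>w. w [^] p) ` ?X"
      then obtain v where v: "v \<in> ?X" "y = v [^] p" by (rule imageE)
      show "finite {w \<in> ?X. w [^] p = y}" unfolding v(2) by (rule fib[OF v(1)])
    qed
    moreover have "?X = (\<Union>y\<in>(\<lambda>w. w [^] p) ` ?X. {w \<in> ?X. w [^] p = y})" by blast
    ultimately show ?thesis by argo
  qed
qed


section \<open>Unbounded subgroups and the consequences of maximality\<close>

definition torsion_unbounded :: "'a set \<Rightarrow> bool" where
  "torsion_unbounded A \<longleftrightarrow> countable A \<and> (\<forall>a\<in>A. \<exists>n>0. a [^] (n::nat) = \<one>) \<and>
     (\<forall>n>0. \<exists>a\<in>A. a [^] (n::nat) \<noteq> \<one>)"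

definition infinite_cyclic :: "'a set \<Rightarrow> bool" where
  "infinite_cyclic A \<longleftrightarrow> (\<exists>x\<in>carrier G. (\<forall>n>0. x [^] (n::nat) \<noteq> \<one>) \<and> A = generate G {x})"

lemma unbounded_not_trivial: "torsion_unbounded A \<or> infinite_cyclic A \<Longrightarrow> \<not> A \<subseteq> {\<one>}"
proof
  assume AA: "torsion_unbounded A \<or> infinite_cyclic A" and A: "A \<subseteq> {\<one>}"
  from AA show False
  proof
    assume "torsion_unbounded A"
    then obtain a where "a \<in> A" "a [^] (1::nat) \<noteq> \<one>" unfolding torsion_unbounded_def by (metis zero_less_one)
    then show False using A by auto
  next
    assume "infinite_cyclic A"
    then obtain x where x: "x \<in> carrier G" "x [^] (1::nat) \<noteq> \<one>" "A = generate G {x}"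
      unfolding infinite_cyclic_def by (metis zero_less_one)
    then have "x \<in> A" by (simp add: generate.incl)
    then show False using x A by auto
  qed
qed

text \<open>Stage \<open>n\<close> contributes an element not killed by \<open>fact n\<close>, and
  every positive \<open>n\<close> divides \<open>fact n\<close>; so the union of the finite stages
  is countable, torsion and of unbounded exponent. The property \<open>Q\<close> is guaranteed for
  the stages only, which is enough when it can be tested on single elements, such as lying in
  \<open>W\<close> or meeting \<open>C\<close> trivially.\<close>

lemma torsion_unbounded_chain:
  assumes one: "Q {\<one>}"
    and step: "\<And>M n. subgroup M G \<Longrightarrow> finite M \<Longrightarrow> Q M \<Longrightarrow>
      \<exists>g\<in>carrier G. (\<exists>k>0. g [^] (k::nat) = \<one>) \<and> g [^] (fact n :: nat) \<noteq> \<one> \<and> Q (M <#> generate G {g})"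
  shows "\<exists>M. subgroup M G \<and> torsion_unbounded M \<and> (\<forall>x\<in>M. \<exists>F. x \<in> F \<and> F \<subseteq> M \<and> Q F)"
proof -
  define P where "P M \<longleftrightarrow> subgroup M G \<and> finite M \<and> Q M" for M
  have "\<exists>S. \<forall>n. P (S n) \<and> (S n \<subseteq> S (Suc n) \<and> (\<exists>g\<in>S (Suc n). g [^] (fact n :: nat) \<noteq> \<one>))"
  proof (rule dependent_nat_choice)
    show "\<exists>M. P M" using one triv_subgroup unfolding P_def by (intro exI[of _ "{\<one>}"]) auto
    fix M n assume M: "P M"
    then obtain g k where g: "g \<in> carrier G" "k > 0" "g [^] (k::nat) = \<one>" "g [^] (fact n :: nat) \<noteq> \<one>"
      "Q (M <#> generate G {g})" using step unfolding P_def by metis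
    have gk: "g [^] k \<in> M" using g(3) M unfolding P_def by (simp add: subgroup.one_closed)
    have sM: "subgroup M G" using M unfolding P_def by simp
    note gs = subgroup_generate_singleton[OF g(1)]
    note inc = set_mult_incl[OF sM gs]
    have "P (M <#> generate G {g})"
      unfolding P_def using mult_subgroups[OF sM gs] finite_adjoin[OF sM g(1,2) gk] M g(5)
      unfolding P_def by blast
    moreover have "g \<in> M <#> generate G {g}" using inc(2) generate.incl[of g "{g}" G] by blast
    ultimately show "\<exists>M'. P M' \<and> (M \<subseteq> M' \<and> (\<exists>g\<in>M'. g [^] (fact n :: nat) \<noteq> \<one>))"
      using inc(1) g(4) by blast
  qed
  then obtain S where S: "\<And>n. P (S n)" "\<And>n. S n \<subseteq> S (Suc n)"
    "\<And>n. \<exists>g\<in>S (Suc n). g [^] (fact n :: nat) \<noteq> \<one>" by blast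
  have mono: "S n \<subseteq> S m" if "n \<le> m" for n m using lift_Suc_mono_le[of S, OF S(2) that] .
  define M where "M = (\<Union>n. S n)"
  show ?thesis
  proof (rule exI[of _ M], intro conjI ballI)
    show "subgroup M G"
    proof (rule subgroupI)
      show "M \<subseteq> carrier G" using S(1) unfolding M_def P_def by (auto dest: subgroup.mem_carrier)
      have "\<one> \<in> S 0" using S(1)[of 0] unfolding P_def by (auto intro: subgroup.one_closed)
      then show "M \<noteq> {}" unfolding M_def by blast
      show "inv a \<in> M" if "a \<in> M" for a
        using that S(1) unfolding M_def P_def by (auto intro: subgroup.m_inv_closed)
      show "a \<otimes> b \<in> M" if ab: "a \<in> M" "b \<in> M" for a b
      proof -
        obtain n m where "a \<in> S n" "b \<in> S m" using ab unfolding M_def by blast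
        then have "a \<in> S (max n m)" "b \<in> S (max n m)" using mono by (meson max.cobounded1 max.cobounded2 subsetD)+
        then have "a \<otimes> b \<in> S (max n m)" using S(1)[of "max n m"] unfolding P_def by (auto intro: subgroup.m_closed)
        then show ?thesis unfolding M_def by blast
      qed
    qed
    show "torsion_unbounded M"
      unfolding torsion_unbounded_def
    proof (intro conjI ballI allI impI)
      show "countable M" unfolding M_def using S(1) unfolding P_def by (intro countable_UN) (auto intro: countable_finite)
      show "\<exists>n>0. a [^] (n::nat) = \<one>" if a: "a \<in> M" for a
      proof -
        obtain n where n: "a \<in> S n" using a unfolding M_def by blast
        have fin: "subgroup (S n) G" "finite (S n)" using S(1)[of n] unfolding P_def by auto
        then have "card (S n) > 0" using n by (auto simp: card_gt_0_iff)
        then show ?thesis using finite_subgroup_exponent[OF fin n] by blast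
      qed
      fix n :: nat assume "n > 0"
      obtain g where g: "g \<in> S (Suc n)" "g [^] (fact n :: nat) \<noteq> \<one>" using S(3) by blast
      have gG: "g \<in> carrier G" using g(1) S(1)[of "Suc n"] unfolding P_def by (auto dest: subgroup.mem_carrier)
      have "n dvd fact n" using \<open>n > 0\<close> by (intro dvd_fact) auto
      then obtain k where k: "fact n = n * k" by (rule dvdE)
      have "g [^] n \<noteq> \<one>"
      proof
        assume "g [^] n = \<one>"
        then have "g [^] (n * k) = \<one>" using gG by (simp flip: nat_pow_pow)
        then show False using g(2) k by simp
      qed
      then show "\<exists>a\<in>M. a [^] n \<noteq> \<one>" using g(1) unfolding M_def by blast
    qed
    show "\<exists>F. x \<in> F \<and> F \<subseteq> M \<and> Q F" if "x \<in> M" for x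
      using that S(1) unfolding M_def P_def by blast
  qed
qed

text \<open>An element of infinite order in \<open>W\<close> would give an infinite cyclic subgroup,
  and a torsion group \<open>W\<close> of unbounded exponent a countable subgroup of the same kind.
  Either is nontrivial and meets \<open>C\<close> trivially, against maximality.\<close>

lemma bounded_of_maximal:
  assumes max: "\<And>M. subgroup M G \<Longrightarrow> torsion_unbounded M \<or> infinite_cyclic M \<Longrightarrow> M \<inter> C \<subseteq> {\<one>} \<Longrightarrow> M \<subseteq> {\<one>}"
    and W: "subgroup W G" "W \<inter> C \<subseteq> {\<one>}"
  shows "\<exists>e>0. \<forall>w\<in>W. w [^] (e::nat) = \<one>"
proof (rule ccontr)
  assume unb: "\<not> ?thesis"
  have tors: "\<exists>k>0. w [^] (k::nat) = \<one>" if w: "w \<in> W" for w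
  proof (rule ccontr)
    assume inf: "\<not> ?thesis"
    have wG: "w \<in> carrier G" using W(1) w by (rule subgroup.mem_carrier)
    then have "infinite_cyclic (generate G {w})" using inf unfolding infinite_cyclic_def by blast
    moreover have "generate G {w} \<subseteq> W" using w W(1) by (intro generate_subgroup_incl) auto
    ultimately show False
      using max[OF subgroup_generate_singleton[OF wG]] unbounded_not_trivial W(2) by blast
  qed
  have "\<exists>M. subgroup M G \<and> torsion_unbounded M \<and> (\<forall>x\<in>M. \<exists>F. x \<in> F \<and> F \<subseteq> M \<and> F \<subseteq> W)"
  proof (rule torsion_unbounded_chain)
    show "{\<one>} \<subseteq> W" using W(1) by (simp add: subgroup.one_closed)
    fix M and n :: nat assume M: "M \<subseteq> W"
    obtain g where g: "g \<in> W" "g [^] (fact n :: nat) \<noteq> \<one>" using unb by (metis fact_gt_zero)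
    have "M <#> generate G {g} \<subseteq> W"
      using M g(1) W(1) by (intro set_mult_least generate_subgroup_incl) auto
    then show "\<exists>g\<in>carrier G. (\<exists>k>0. g [^] (k::nat) = \<one>) \<and> g [^] (fact n :: nat) \<noteq> \<one> \<and> M <#> generate G {g} \<subseteq> W"
      using g tors subgroup.mem_carrier[OF W(1)] by blast
  qed
  then obtain M where M: "subgroup M G" "torsion_unbounded M" "M \<subseteq> W" by blast
  then show False using max[OF M(1)] M(2) unbounded_not_trivial W(2) by blast
qed

text \<open>By Bezout, \<open>w\<close> is the product of a power of \<open>w [^] m\<close> and a
  power of \<open>w [^] p\<close>.\<close>

lemma pow_in_coprime:
  assumes H: "subgroup H G" and w: "w \<in> carrier G" and p: "w [^] (p::nat) = \<one>"
    and cop: "coprime m p" and wm: "w [^] (m::nat) \<in> H"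
  shows "w \<in> H"
proof -
  obtain a b :: int where ab: "a * int m + b * int p = 1"
    using bezout_int[of "int m" "int p"] cop by (auto simp: gcd_int_int_eq coprime_iff_gcd_eq_1)
  have "w [^] (int m * a) \<in> H" 
    using subgroup_int_pow_closed[OF H wm, of a] w by (simp add: int_pow_pow flip: int_pow_int)
  moreover have "w [^] (int p * b) = \<one>"
    using p w by (simp add: int_pow_int flip: int_pow_pow)
  moreover have "w = w [^] (int m * a) \<otimes> w [^] (int p * b)"
    using w ab by (simp add: int_pow_mult[symmetric] mult.commute)
  ultimately show ?thesis using w by simp
qed

text \<open>If the claim failed, then for every \<open>n\<close> and every finite \<open>M\<close> disjoint from \<open>C\<close> there would be
  an element \<open>w\<close> of prime order outside \<open>C <#> M\<close> that is an \<open>n!\<close>-th power of some \<open>g\<close>. Adjoining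
  the primary part of \<open>g\<close> to \<open>M\<close> again and again yields an unbounded torsion group disjoint
  from \<open>C\<close>.\<close>

lemma finite_disjoint_of_maximal:
  assumes C: "subgroup C G"
    and max: "\<And>M. subgroup M G \<Longrightarrow> torsion_unbounded M \<or> infinite_cyclic M \<Longrightarrow> M \<inter> C \<subseteq> {\<one>} \<Longrightarrow> M \<subseteq> {\<one>}"
  shows "\<exists>d>0. \<forall>W. subgroup W G \<longrightarrow> W \<subseteq> (\<lambda>g. g [^] (d::nat)) ` carrier G \<longrightarrow> W \<inter> C \<subseteq> {\<one>} \<longrightarrow> finite W"
proof (rule ccontr)
  assume neg: "\<not> ?thesis"
  have "\<exists>M. subgroup M G \<and> torsion_unbounded M \<and> (\<forall>x\<in>M. \<exists>F. x \<in> F \<and> F \<subseteq> M \<and> F \<inter> C \<subseteq> {\<one>})"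
  proof (rule torsion_unbounded_chain)
    show "{\<one>} \<inter> C \<subseteq> {\<one>}" by blast
    fix M and n :: nat assume M: "subgroup M G" "finite M" "M \<inter> C \<subseteq> {\<one>}"
    define d :: nat where "d = fact n"
    have "d > 0" by (simp add: d_def)
    then obtain W where W: "subgroup W G" "W \<subseteq> (\<lambda>g. g [^] d) ` carrier G" "W \<inter> C \<subseteq> {\<one>}" "infinite W"
      using neg by blast
    have CM: "subgroup (C <#> M) G" by (rule mult_subgroups[OF C M(1)])
    note inc = set_mult_incl[OF C M(1)]
    \<comment> \<open>Each coset of \<open>C\<close> contains at most one element of
      \<open>W\<close>, because \<open>W\<close> meets \<open>C\<close> trivially, and
      \<open>C <#> M\<close> is a union of finitely many such cosets.\<close>
    have finV: "finite (W \<inter> (C <#> M))"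
    proof (rule finite_subset)
      show "W \<inter> (C <#> M) \<subseteq> (\<Union>m\<in>M. {w \<in> W. \<exists>c\<in>C. w = c \<otimes> m})"
        by (auto simp: mem_set_mult) blast
      have "finite {w \<in> W. \<exists>c\<in>C. w = c \<otimes> m}" if m: "m \<in> M" for m
      proof -
        have uniq: "w = w'" if w: "w \<in> W" "c \<in> C" "w = c \<otimes> m" and w': "w' \<in> W" "c' \<in> C" "w' = c' \<otimes> m" for w w' c c'
        proof -
          have car: "c \<in> carrier G" "c' \<in> carrier G" "m \<in> carrier G" "w \<in> carrier G" "w' \<in> carrier G"
            using w w' m C M(1) W(1) by (auto dest: subgroup.mem_carrier)
          have "w \<otimes> inv w' = c \<otimes> inv c'"
            using car by (simp add: w(3) w'(3) inv_mult m_ac)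
          moreover have "w \<otimes> inv w' \<in> W" using w w' W(1) by (simp add: subgroup.m_closed subgroup.m_inv_closed)
          moreover have "c \<otimes> inv c' \<in> C" using w w' C by (simp add: subgroup.m_closed subgroup.m_inv_closed)
          ultimately have "w \<otimes> inv w' = \<one>" using W(3) by auto
          moreover have "w = (w \<otimes> inv w') \<otimes> w'" using car by (simp add: m_assoc)
          ultimately show ?thesis using car by simp
        qed
        show ?thesis
        proof (cases "\<exists>w0\<in>W. \<exists>c0\<in>C. w0 = c0 \<otimes> m")
          case True
          then obtain w0 c0 where 0: "w0 \<in> W" "c0 \<in> C" "w0 = c0 \<otimes> m" by blast
          have "{w \<in> W. \<exists>c\<in>C. w = c \<otimes> m} \<subseteq> {w0}" using uniq[OF _ _ _ 0] by blast
          then show ?thesis by (rule finite_subset) simp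
        next
          case False
          then have "{w \<in> W. \<exists>c\<in>C. w = c \<otimes> m} = {}" by blast
          then show ?thesis by (simp only: finite.emptyI)
        qed
      qed
      then show "finite (\<Union>m\<in>M. {w \<in> W. \<exists>c\<in>C. w = c \<otimes> m})" using M(2) by blast
    qed
    \<comment> \<open>By maximality \<open>W\<close> has bounded exponent, so finitely many elements
      killed by primes would make \<open>W\<close> finite.\<close>
    have "infinite {w \<in> W. \<exists>p. prime (p::nat) \<and> w [^] p = \<one>}"
    proof
      assume fin: "finite {w \<in> W. \<exists>p. prime (p::nat) \<and> w [^] p = \<one>}"
      obtain e :: nat where e: "e > 0" "\<forall>w\<in>W. w [^] e = \<one>"
        using bounded_of_maximal[OF max W(1,3)] by blast
      then have "{w \<in> W. w [^] e = \<one>} = W" by blast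
      then show False using finite_if_finite_socle[OF W(1) fin e(1)] W(4) by simp
    qed
    then have "\<not> {w \<in> W. \<exists>p. prime (p::nat) \<and> w [^] p = \<one>} \<subseteq> W \<inter> (C <#> M)"
      using finV finite_subset by blast
    then obtain w p where w: "w \<in> W" "prime (p::nat)" "w [^] p = \<one>" "w \<notin> C <#> M" by blast
    obtain h where h: "h \<in> carrier G" "w = h [^] d" using W(2) w(1) by blast
    have wG: "w \<in> carrier G" using h by simp
    have "\<not> is_unit p" using w(2) by (simp add: prime_nat_iff)
    then obtain m where am: "\<not> p dvd m" "d = p ^ multiplicity p d * m"
      using multiplicity_decompose'[of d p] \<open>d > 0\<close> by auto
    define a where "a = multiplicity p d"
    have cop: "coprime m p" using am(1) w(2) by (meson coprime_commute prime_imp_coprime_nat)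
    \<comment> \<open>\<open>h\<close> is killed by \<open>d * p\<close>; passing to the
      \<open>m\<close>-th power leaves only the \<open>p\<close>-primary part, so \<open>g\<close>
      is killed by \<open>p ^ Suc a\<close>.\<close>
    define g where "g = h [^] m"
    have gG: "g \<in> carrier G" using h by (simp add: g_def)
    have gd: "g [^] d = w [^] m" using h by (simp add: g_def nat_pow_pow mult.commute)
    have gdCM: "g [^] d \<notin> C <#> M" using pow_in_coprime[OF CM wG w(3) cop] w(4) gd by auto
    have "g [^] (p ^ Suc a) = h [^] (d * p)"
      using h(1) by (subst am(2)) (simp add: g_def nat_pow_pow a_def mult_ac)
    also have "\<dots> = \<one>" using h w(3) by (simp flip: nat_pow_pow)
    finally have gp: "g [^] (p ^ Suc a) = \<one>" .
    \<comment> \<open>Let \<open>d1\<close> be the order of \<open>g\<close> modulo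
      \<open>C <#> M\<close> and \<open>d2\<close> its order; both are powers of \<open>p\<close>.
      If they differed, \<open>d1 * p\<close> would divide \<open>d2\<close>, which divides
      \<open>d * p\<close>; then \<open>d1\<close> would divide \<open>d\<close> and
      \<open>g [^] d\<close> would lie in \<open>C <#> M\<close>.\<close>
    have gtriv: "g [^] k = \<one>" if k: "g [^] k \<in> C <#> M" for k :: int
    proof -
      have "g [^] (p ^ Suc a) \<in> C <#> M" using gp subgroup.one_closed[OF CM] by simp
      moreover have ppos: "p ^ Suc a > 0" using w(2) by (simp add: prime_gt_0_nat)
      ultimately obtain d1 :: nat where d1: "d1 > 0" "\<And>k::int. g [^] k \<in> C <#> M \<longleftrightarrow> int d1 dvd k"
        using relative_order[OF CM gG] by metis
      have "g [^] (p ^ Suc a) \<in> {\<one>}" using gp by simp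
      then obtain d2 :: nat where d2: "d2 > 0" "\<And>k::int. g [^] k \<in> {\<one>} \<longleftrightarrow> int d2 dvd k"
        using relative_order[OF triv_subgroup gG ppos] by metis
      have "int d1 dvd int d2"
        using d1(2)[of "int d2"] d2(2)[of "int d2"] subgroup.one_closed[OF CM] by auto
      then have d12: "d1 dvd d2" by simp
      have "d2 dvd p ^ Suc a"
        using d2(2)[of "int (p ^ Suc a)"] gp by (simp only: int_pow_int of_nat_dvd_iff) simp
      then obtain c where c: "d2 = p ^ c" using divides_primepow_nat[OF w(2)] by blast
      then obtain b where b: "b \<le> c" "d1 = p ^ b" using divides_primepow_nat[OF w(2)] d12 by blast
      have "d1 = d2"
      proof (rule ccontr)
        assume "d1 \<noteq> d2"
        then have "b < c" using b c by (cases "b = c") auto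
        then have "d1 * p dvd d2" using b c by (metis Suc_leI le_imp_power_dvd power_Suc2)
        moreover have "d2 dvd d * p"
        proof -
          have "g [^] (d * p) = (w [^] p) [^] m"
            using wG gd gG by (simp add: nat_pow_pow mult.commute flip: nat_pow_pow[of g d p])
          then have "g [^] (d * p) = \<one>" using w(3) by simp
          then show ?thesis using d2(2)[of "int (d * p)"] by (simp only: int_pow_int of_nat_dvd_iff) simp
        qed
        ultimately have "d1 * p dvd d * p" by (rule dvd_trans)
        then have "d1 dvd d" using w(2) by (simp add: prime_gt_0_nat)
        then have "g [^] d \<in> C <#> M" using d1(2)[of "int d"] by (simp only: int_pow_int of_nat_dvd_iff)
        then show False using gdCM by simp
      qed
      then show ?thesis using d1(2) d2(2) k by auto
    qed
    have "(M <#> generate G {g}) \<inter> C \<subseteq> {\<one>}"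
    proof
      fix y assume y: "y \<in> (M <#> generate G {g}) \<inter> C"
      then obtain \<mu> and k :: int where \<mu>: "\<mu> \<in> M" "y = \<mu> \<otimes> g [^] k"
        by (auto simp: mem_set_mult mem_generate_singleton[OF gG])
      have car: "\<mu> \<in> carrier G" "y \<in> carrier G" using \<mu> y M(1) C by (auto dest: subgroup.mem_carrier)
      have "inv \<mu> \<in> C <#> M" "y \<in> C <#> M" using inc \<mu>(1) y M(1) by (auto intro: subgroup.m_inv_closed)
      then have "inv \<mu> \<otimes> y \<in> C <#> M" using CM by (simp add: subgroup.m_closed)
      moreover have "inv \<mu> \<otimes> y = g [^] k" using car gG by (simp add: \<mu>(2) m_assoc[symmetric])
      ultimately have "g [^] k = \<one>" using gtriv by simp
      then have "y = \<mu>" using \<mu>(2) car by simp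
      then show "y \<in> {\<one>}" using \<mu>(1) y M(3) by blast
    qed
    moreover have "g [^] (fact n :: nat) \<noteq> \<one>"
      using gdCM subgroup.one_closed[OF CM] unfolding d_def[symmetric] by auto
    moreover have "p ^ Suc a > 0" using w(2) by (simp add: prime_gt_0_nat)
    ultimately show "\<exists>g\<in>carrier G. (\<exists>k>0. g [^] (k::nat) = \<one>) \<and> g [^] (fact n :: nat) \<noteq> \<one> \<and>
        (M <#> generate G {g}) \<inter> C \<subseteq> {\<one>}"
      using gG gp by blast
  qed
  then obtain M where M: "subgroup M G" "torsion_unbounded M" "M \<inter> C \<subseteq> {\<one>}" by blast
  then show False using max[OF M(1)] M(2) unbounded_not_trivial by blast
qed

end

section \<open>Bounded groups\<close>

text \<open>The number of binary digits of \<open>r\<close>, and 0 for 0: the coarsest level at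
  which \<open>r\<close> is its own residue.\<close>

definition bit_len :: "nat \<Rightarrow> nat" where
  "bit_len r = (LEAST n. r < 2 ^ n)"

lemma less_bit_len: "r < 2 ^ bit_len r"
  unfolding bit_len_def by (rule LeastI[of _ r]) (rule less_exp)

lemma bit_len_eq:
  assumes "2 ^ n \<le> r" "r < 2 ^ Suc n"
  shows "bit_len r = Suc n"
  unfolding bit_len_def
proof (rule Least_equality)
  fix m assume "r < 2 ^ m"
  then have "(2::nat) ^ n < 2 ^ m" by (rule le_less_trans[OF assms(1)])
  then have "n < m" by simp
  then show "Suc n \<le> m" by simp
qed (rule assms)

lemma bit_len_0: "bit_len 0 = 0"
  unfolding bit_len_def by (rule Least_equality) auto

lemma mod_double_cases: "i mod 2 ^ Suc n = i mod 2 ^ n \<or> i mod 2 ^ Suc n = i mod 2 ^ n + (2::nat) ^ n"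
proof -
  have "i mod 2 ^ Suc n = 2 ^ n * (i div 2 ^ n mod 2) + i mod 2 ^ n"
    by (metis mod_mult2_eq mult.commute power_Suc)
  moreover have "i div 2 ^ n mod 2 = 0 \<or> i div 2 ^ n mod 2 = 1" by auto
  ultimately show ?thesis by auto
qed

context comm_group
begin

section \<open>Families of pseudonorms that admit no characters\<close>

definition pseudonorm_on :: "'a set \<Rightarrow> ('a \<Rightarrow> real) \<Rightarrow> bool" where
  "pseudonorm_on H \<nu> \<longleftrightarrow> \<nu> \<one> = 0 \<and> (\<forall>x\<in>H. \<nu> x \<ge> 0 \<and> \<nu> (inv x) = \<nu> x) \<and>
     (\<forall>x\<in>H. \<forall>y\<in>H. \<nu> (x \<otimes> y) \<le> \<nu> x + \<nu> y)"

text \<open>The finite set \<open>F\<close> and the radius \<open>e\<close> describe a neighbourhood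
  of the identity; continuity of \<open>f\<close> is replaced by closeness to 1 on one such
  neighbourhood. The threshold 1/4 leaves room for adding two errors.\<close>

definition char_free :: "'a set \<Rightarrow> ('a \<Rightarrow> real) set \<Rightarrow> bool" where
  "char_free H \<P> \<longleftrightarrow> (\<forall>f F e. unitary_char G H f \<longrightarrow> F \<subseteq> \<P> \<longrightarrow> finite F \<longrightarrow> e > 0 \<longrightarrow>
     (\<forall>x\<in>H. (\<forall>\<nu>\<in>F. \<nu> x < e) \<longrightarrow> cmod (f x - 1) \<le> 1 / 4) \<longrightarrow> (\<forall>x\<in>H. f x = 1))"

lemma char_freeI:
  assumes "\<And>f F e x. unitary_char G H f \<Longrightarrow> F \<subseteq> \<P> \<Longrightarrow> finite F \<Longrightarrow> e > 0 \<Longrightarrow>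
     (\<And>x. x \<in> H \<Longrightarrow> (\<And>\<nu>. \<nu> \<in> F \<Longrightarrow> \<nu> x < e) \<Longrightarrow> cmod (f x - 1) \<le> 1 / 4) \<Longrightarrow> x \<in> H \<Longrightarrow> f x = 1"
  shows "char_free H \<P>"
  unfolding char_free_def using assms by meson

lemma char_freeD:
  assumes "char_free H \<P>" "unitary_char G H f" "F \<subseteq> \<P>" "finite F" "e > 0"
    "\<And>x. x \<in> H \<Longrightarrow> (\<And>\<nu>. \<nu> \<in> F \<Longrightarrow> \<nu> x < e) \<Longrightarrow> cmod (f x - 1) \<le> 1 / 4" "x \<in> H"
  shows "f x = 1"
  using assms unfolding char_free_def by meson

text \<open>Here the only neighbourhood is all of \<open>H\<close>, and the circle has no small
  subgroups. This serves the finite summands, which contribute a finite kernel instead of a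
  norm.\<close>

lemma char_free_empty: "subgroup H G \<Longrightarrow> char_free H {}"
  by (rule char_freeI) (erule (1) unitary_char_trivial, fastforce)

lemma pseudonorm_mean:
  assumes H: "subgroup H G" and J: "J \<in> hom (G\<lparr>carrier := H\<rparr>) circle_fun"
  shows "pseudonorm_on H (\<lambda>x. mean (J x))"
proof -
  have JC: "J x \<in> carrier circle_fun" if "x \<in> H" for x using J that by (auto simp: hom_def)
  have J1: "J \<one> = \<one>\<^bsub>circle_fun\<^esub>" by (rule hom_eq_one[OF is_group CF.is_group H J])
  have Jm: "J (x \<otimes> y) = J x \<otimes>\<^bsub>circle_fun\<^esub> J y" if "x \<in> H" "y \<in> H" for x y
    using J that by (auto simp: hom_def)
  have "J (inv x) = inv\<^bsub>circle_fun\<^esub> J x" if x: "x \<in> H" for x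
  proof -
    have "J (inv x) \<otimes>\<^bsub>circle_fun\<^esub> J x = \<one>\<^bsub>circle_fun\<^esub>"
      using Jm[of "inv x" x] x H J1 by (simp add: subgroup.m_inv_closed subgroup.mem_carrier)
    then show ?thesis using JC x H by (metis CF.inv_equality subgroup.m_inv_closed)
  qed
  then show ?thesis
    unfolding pseudonorm_on_def using JC J1 Jm mean_nonneg mean_inv mean_mult mean_one
    by (simp add: one_circle_fun)
qed

lemma unitary_char_trivial_on_generate:
  assumes f: "unitary_char G H f" and H: "subgroup H G" and S: "S \<subseteq> H"
    and triv: "\<And>s. s \<in> S \<Longrightarrow> f s = 1" and x: "x \<in> generate G S"
  shows "f x = 1"
proof -
  have gH: "generate G S \<subseteq> H" by (rule generate_subgroup_incl[OF S H])
  from x show ?thesis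
  proof (induction rule: generate.induct)
    case one
    show ?case by (rule unitary_char_one[OF H f])
  next
    case (incl h)
    then show ?case by (rule triv)
  next
    case (inv h)
    have h: "h \<in> H" "inv h \<in> H" using inv S H by (auto intro: subgroup.m_inv_closed)
    then have "f (h \<otimes> inv h) = f h * f (inv h)" using f unfolding unitary_char_def by blast
    then show ?case using triv[OF inv] unitary_char_one[OF H f] h subgroup.mem_carrier[OF H] by simp
  next
    case (eng h1 h2)
    then have "h1 \<in> H" "h2 \<in> H" using gH by auto
    then have "f (h1 \<otimes> h2) = f h1 * f h2" using f unfolding unitary_char_def by blast
    then show ?case using eng by simp
  qed
qed

text \<open>If \<open>z r\<close> corresponds to the residue class of \<open>r\<close> modulo \<open>2 ^ bit_len r\<close>, then \<open>haar z n s\<close>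
  corresponds to the residue class of \<open>s\<close> modulo \<open>2 ^ n\<close>.\<close>

primrec haar :: "(nat \<Rightarrow> 'a) \<Rightarrow> nat \<Rightarrow> nat \<Rightarrow> 'a" where
  "haar z 0 s = z 0"
| "haar z (Suc n) s = (if s < 2 ^ n then haar z n s \<otimes> inv (z (s + 2 ^ n)) else z s)"

text \<open>An infinite family is in bijection with its product with the natural numbers, so it
  falls into countable blocks of members \<open>h (a, r)\<close>. The indicator functions of the
  classes of \<open>r\<close> modulo \<open>2 ^ bit_len r\<close> form a basis of the locally
  constant functions from the 2-adic integers to Z/q. This identifies the span of a block with such
  functions, \<open>mean\<close> provides a norm, and the argument with pieces of small support
  applies again.\<close>

lemma homocyclic_char_free_infinite:
  assumes ind: "independent_family \<C>" and q: "q > (0::nat)"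
    and y: "\<And>A. A \<in> \<C> \<Longrightarrow> y A \<in> carrier G \<and> generate G {y A} = A"
    and ord: "\<And>A k. A \<in> \<C> \<Longrightarrow> y A [^] (k::int) = \<one> \<longleftrightarrow> int q dvd k"
    and N: "subgroup N G" "N \<inter> generate G (\<Union>\<C>) \<subseteq> {\<one>}"
    and inf: "infinite \<C>"
  shows "\<exists>\<P>. (\<forall>\<nu>\<in>\<P>. pseudonorm_on (generate G (\<Union>\<C>) <#> N) \<nu> \<and> (\<forall>n\<in>N. \<nu> n = 0)) \<and>
    char_free (generate G (\<Union>\<C>)) \<P> \<and> finite {b \<in> generate G (\<Union>\<C>). \<forall>\<nu>\<in>\<P>. \<nu> b = 0}"
proof -
  define B where "B = generate G (\<Union>\<C>)"
  define \<zeta> where "\<zeta> = cis (2 * pi / q)"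
  have \<zeta>1: "cmod \<zeta> = 1" "\<zeta> \<noteq> 0" by (auto simp: \<zeta>_def)
  have \<zeta>q: "\<zeta> ^ q = 1" using q by (simp add: \<zeta>_def Complex.DeMoivre)
  define Z where "Z = (\<lambda>i::nat. \<zeta>)"
  have ZC: "Z \<in> carrier circle_fun"
    by (rule periodic_circle_fun[of 0]) (auto simp: Z_def periodic_def \<zeta>1)
  have sub: "\<And>A. A \<in> \<C> \<Longrightarrow> subgroup A G" using ind unfolding independent_family_def by blast
  have sB: "subgroup B G" unfolding B_def using sub by (rule subgroup_span)
  have memB: "A \<subseteq> B" if "A \<in> \<C>" for A unfolding B_def using that by (auto intro: generate.incl)
  have yA: "y A \<in> A" if "A \<in> \<C>" for A using y[OF that] generate.incl[of "y A" "{y A}" G] by auto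
  have Apow: "\<exists>j::nat. a = y A [^] j" if A: "A \<in> \<C>" and a: "a \<in> A" for A a
  proof -
    have yG: "y A \<in> carrier G" and Ay: "generate G {y A} = A" using y[OF A] by auto
    have y1: "y A [^] q \<in> {\<one>}" using ord[OF A, of "int q"] by (simp add: int_pow_int)
    have "a \<in> {\<one>} <#> generate G {y A}"
      using set_mult_incl(2)[OF triv_subgroup subgroup_generate_singleton[OF yG]] a Ay by auto
    then obtain h j where "h \<in> {\<one>}" "j < q" "a = h \<otimes> y A [^] j"
      by (rule mem_adjoin[OF triv_subgroup yG q y1])
    then show ?thesis using yG by auto
  qed
  have Zpow: "Z [^]\<^bsub>circle_fun\<^esub> k = \<one>\<^bsub>circle_fun\<^esub> \<longleftrightarrow> q dvd k" for k :: nat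
  proof
    assume "q dvd k"
    then obtain l where "k = q * l" by (rule dvdE)
    then show "Z [^]\<^bsub>circle_fun\<^esub> k = \<one>\<^bsub>circle_fun\<^esub>"
      by (simp add: pow_circle_fun Z_def power_mult \<zeta>q one_circle_fun)
  next
    assume "Z [^]\<^bsub>circle_fun\<^esub> k = \<one>\<^bsub>circle_fun\<^esub>"
    then have "\<zeta> ^ k = 1" by (simp add: pow_circle_fun Z_def one_circle_fun fun_eq_iff)
    moreover have "\<zeta> ^ k = \<zeta> ^ (k mod q)"
    proof -
      have "\<zeta> ^ k = \<zeta> ^ (q * (k div q) + k mod q)" by simp
      then show ?thesis unfolding power_add power_mult \<zeta>q by simp
    qed
    ultimately have "k mod q = 0"
      using root_of_unity_eq_one[of q "k mod q"] q by (simp add: \<zeta>_def)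
    then show "q dvd k" by (simp add: dvd_eq_mod_eq_0)
  qed
  define \<Phi> where "\<Phi> A \<pi> \<longleftrightarrow> \<pi> \<in> hom G circle_fun \<and> \<pi> (y A) = Z \<and>
    (\<forall>b\<in>generate G (\<Union>(\<C> - {A})). \<pi> b = \<one>\<^bsub>circle_fun\<^esub>) \<and>
    (\<forall>n\<in>N. \<pi> n = \<one>\<^bsub>circle_fun\<^esub>) \<and> (\<forall>a\<in>A. \<pi> a = \<one>\<^bsub>circle_fun\<^esub> \<longrightarrow> a = \<one>)" for A \<pi>
  have "\<exists>\<pi>. \<Phi> A \<pi>" if A: "A \<in> \<C>" for A
  proof -
    have yG: "y A \<in> carrier G" and Ay: "generate G {y A} = A" using y[OF A] by auto
    let ?D = "generate G (\<Union>(\<C> - {A})) <#> N"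
    have sD0: "subgroup (generate G (\<Union>(\<C> - {A}))) G" using sub by (intro subgroup_span) auto
    have sD: "subgroup ?D G" by (rule mult_subgroups[OF sD0 N(1)])
    have relq: "Z [^]\<^bsub>circle_fun\<^esub> k = \<one>\<^bsub>circle_fun\<^esub>" if k: "y A [^] k = \<one>" for k :: int
    proof -
      have "int q dvd k" using ord[OF A] k by blast
      then obtain l where "k = int q * l" by (rule dvdE)
      then have "Z [^]\<^bsub>circle_fun\<^esub> k = (Z [^]\<^bsub>circle_fun\<^esub> int q) [^]\<^bsub>circle_fun\<^esub> l"
        using CF.int_pow_pow[OF ZC, of "int q" l] by simp
      also have "Z [^]\<^bsub>circle_fun\<^esub> int q = \<one>\<^bsub>circle_fun\<^esub>" using Zpow[of q] by (simp add: int_pow_int)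
      finally show ?thesis by simp
    qed
    then obtain \<psi> where \<psi>: "\<psi> \<in> hom (G\<lparr>carrier := generate G {y A}\<rparr>) circle_fun"
      "\<And>k::int. \<psi> (y A [^] k) = Z [^]\<^bsub>circle_fun\<^esub> k"
      using hom_cyclic[OF yG comm_group_circle_fun ZC] by metis
    have triv: "(\<lambda>_. \<one>\<^bsub>circle_fun\<^esub>) \<in> hom (G\<lparr>carrier := ?D\<rparr>) circle_fun" by (auto simp: hom_def)
    have disj: "x = \<one>" if x: "x \<in> A" "x \<in> ?D" for x
    proof -
      obtain b n where bn: "b \<in> generate G (\<Union>(\<C> - {A}))" "n \<in> N" "x = b \<otimes> n"
        using x(2) by (auto simp: mem_set_mult)
      have bB: "b \<in> B" unfolding B_def using bn(1) mono_generate[of "\<Union>(\<C> - {A})" "\<Union>\<C>"] by blast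
      have xB: "x \<in> B" using x(1) memB[OF A] by blast
      have car: "b \<in> carrier G" "n \<in> carrier G"
        using bB sB bn(2) N(1) by (auto dest: subgroup.mem_carrier)
      have "n = x \<otimes> inv b" using car by (simp add: bn(3) m_comm m_assoc[symmetric])
      then have "n \<in> B" using xB bB sB by (simp add: subgroup.m_closed subgroup.m_inv_closed)
      then have "n = \<one>" using bn(2) N(2) unfolding B_def by blast
      then have "x \<in> generate G (\<Union>(\<C> - {A}))" using bn car by simp
      then show ?thesis using x(1) A ind unfolding independent_family_def by blast
    qed
    have agree: "\<psi> x = \<one>\<^bsub>circle_fun\<^esub>" if x: "x \<in> generate G {y A}" "x \<in> ?D" for x
      using disj[of x] x Ay hom_eq_one[OF is_group CF.is_group subgroup_generate_singleton[OF yG] \<psi>(1)] by auto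
    obtain \<theta> where \<theta>: "\<theta> \<in> hom (G\<lparr>carrier := generate G {y A} <#> ?D\<rparr>) circle_fun"
      "\<And>a. a \<in> generate G {y A} \<Longrightarrow> \<theta> a = \<psi> a" "\<And>b. b \<in> ?D \<Longrightarrow> \<theta> b = \<one>\<^bsub>circle_fun\<^esub>"
      using hom_glue[OF subgroup_generate_singleton[OF yG] sD comm_group_circle_fun \<psi>(1) triv agree] by blast
    have sAD: "subgroup (generate G {y A} <#> ?D) G"
      by (rule mult_subgroups[OF subgroup_generate_singleton[OF yG] sD])
    obtain \<pi> where \<pi>: "\<pi> \<in> hom G circle_fun" "\<And>h. h \<in> generate G {y A} <#> ?D \<Longrightarrow> \<pi> h = \<theta> h"
      using hom_extend[OF sAD comm_group_circle_fun \<theta>(1) divisible_circle_fun] by blast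
    note inc = set_mult_incl[OF subgroup_generate_singleton[OF yG] sD] set_mult_incl[OF sD0 N(1)]
    have \<pi>A: "\<pi> a = \<psi> a" if "a \<in> generate G {y A}" for a using \<pi>(2) \<theta>(2) inc(1) that by auto
    have \<pi>D: "\<pi> b = \<one>\<^bsub>circle_fun\<^esub>" if "b \<in> ?D" for b using \<pi>(2) \<theta>(3) inc(2) that by auto
    have "\<pi> (y A) = Z" using \<pi>A[of "y A"] \<psi>(2)[of 1] yG ZC by (simp add: generate.incl)
    moreover have "a = \<one>" if a: "a \<in> A" "\<pi> a = \<one>\<^bsub>circle_fun\<^esub>" for a
    proof -
      obtain j :: nat where j: "a = y A [^] j" using Apow[OF A a(1)] by blast
      have "Z [^]\<^bsub>circle_fun\<^esub> j = \<one>\<^bsub>circle_fun\<^esub>"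
        using a(2) \<pi>A[of a] Ay a(1) \<psi>(2)[of "int j"] j by (simp add: int_pow_int)
      then have "q dvd j" using Zpow by blast
      then have "y A [^] int j = \<one>" using ord[OF A] by simp
      then show ?thesis using j by (simp add: int_pow_int)
    qed
    ultimately have "\<Phi> A \<pi>" unfolding \<Phi>_def using \<pi>(1) \<pi>D inc(3,4) by auto
    then show ?thesis by blast
  qed
  then obtain \<pi> where all\<pi>: "\<And>A. A \<in> \<C> \<Longrightarrow> \<Phi> A (\<pi> A)" by metis
  have \<pi>: "\<And>A. A \<in> \<C> \<Longrightarrow> \<pi> A \<in> hom G circle_fun" "\<And>A. A \<in> \<C> \<Longrightarrow> \<pi> A (y A) = Z"
    "\<And>A b. A \<in> \<C> \<Longrightarrow> b \<in> generate G (\<Union>(\<C> - {A})) \<Longrightarrow> \<pi> A b = \<one>\<^bsub>circle_fun\<^esub>"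
    "\<And>A n. A \<in> \<C> \<Longrightarrow> n \<in> N \<Longrightarrow> \<pi> A n = \<one>\<^bsub>circle_fun\<^esub>"
    "\<And>A a. A \<in> \<C> \<Longrightarrow> a \<in> A \<Longrightarrow> \<pi> A a = \<one>\<^bsub>circle_fun\<^esub> \<Longrightarrow> a = \<one>"
    using all\<pi> unfolding \<Phi>_def by blast+
  have \<pi>m: "\<pi> A (x \<otimes> z) i = \<pi> A x i * \<pi> A z i" if "A \<in> \<C>" "x \<in> carrier G" "z \<in> carrier G" for A x z i
    using \<pi>(1)[OF that(1)] that by (auto simp: hom_def mult_circle_fun)
  have \<pi>C: "\<pi> A x \<in> carrier circle_fun" if "A \<in> \<C>" "x \<in> carrier G" for A x
    using \<pi>(1)[OF that(1)] that by (auto simp: hom_def)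
  have \<pi>1: "\<pi> A \<one> = \<one>\<^bsub>circle_fun\<^esub>" if "A \<in> \<C>" for A
    using \<pi>(4)[OF that] subgroup.one_closed[OF N(1)] by blast
  have \<pi>const: "\<pi> A b i = \<pi> A b 0" if A: "A \<in> \<C>" and b: "b \<in> B" for A b i
  proof -
    have base: "\<forall>i. \<pi> A h i = \<pi> A h 0" if h: "h \<in> \<Union>\<C>" for h
    proof -
      obtain A' where A': "A' \<in> \<C>" "h \<in> A'" using h by blast
      show ?thesis
      proof (cases "A' = A")
        case True
        then obtain j :: nat where "h = y A [^] j" using Apow[OF A] A' by blast
        then have "\<pi> A h = Z [^]\<^bsub>circle_fun\<^esub> j"
          using hom_nat_pow[OF \<pi>(1)[OF A]] y[OF A] \<pi>(2)[OF A] CF.is_group is_group by metis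
        then show ?thesis by (simp add: pow_circle_fun Z_def)
      next
        case False
        then have "h \<in> generate G (\<Union>(\<C> - {A}))" using A' by (auto intro: generate.incl)
        then show ?thesis using \<pi>(3)[OF A] by (simp add: one_circle_fun)
      qed
    qed
    have "\<forall>i. \<pi> A b i = \<pi> A b 0"
      using b unfolding B_def
    proof (induction rule: generate.induct)
      case one
      show ?case using \<pi>1[OF A] by (simp add: one_circle_fun)
    next
      case (incl h)
      then show ?case by (rule base)
    next
      case (inv h)
      then have "inv h \<in> \<Union>\<C>" using sub by (auto intro: subgroup.m_inv_closed)
      then show ?case by (rule base)
    next
      case (eng h1 h2)
      then have "h1 \<in> carrier G" "h2 \<in> carrier G"
        using sB unfolding B_def by (auto dest: subgroup.mem_carrier)
      then show ?case using \<pi>m[OF A] eng by metis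
    qed
    then show ?thesis by blast
  qed
  \<comment> \<open>This is where infinity of \<open>\<C>\<close> is used: each block needs a member
    for every natural number.\<close>
  obtain h where h: "bij_betw h (\<C> \<times> (UNIV :: nat set)) \<C>"
  proof -
    have "(card_of (\<C> \<times> (UNIV :: nat set)), card_of \<C>) \<in> ordIso"
      using card_of_Times_infinite[OF inf, of "UNIV :: nat set"] inf infinite_iff_card_of_nat by blast
    then show ?thesis using card_of_ordIso that by blast
  qed
  have hC: "h (a, r) \<in> \<C>" if "a \<in> \<C>" for a r
    using bij_betwE[OF h] that by blast
  have hinj: "h (a, r) = h (b, s) \<longleftrightarrow> a = b \<and> r = s" if "a \<in> \<C>" "b \<in> \<C>" for a b r s
    using bij_betw_imp_inj_on[OF h] that by (auto simp: inj_on_def)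
  \<comment> \<open>On \<open>B\<close> the coordinate belonging to \<open>A\<close> takes only
    constant functions as values, so the value at 0 carries all the information.\<close>
  define c where "c A x = \<pi> A x 0" for A x
  \<comment> \<open>The indices whose residue class contains \<open>i\<close>; the explicit bound
    makes the set finite at sight.\<close>
  define S where "S i = {r. r \<le> i \<and> i mod 2 ^ bit_len r = r}" for i :: nat
  have finS: "finite (S i)" for i unfolding S_def by auto
  have S_iff: "r \<in> S i \<longleftrightarrow> i mod 2 ^ bit_len r = r" for r i
    unfolding S_def by (auto intro: order_trans[OF _ mod_less_eq_dividend] simp del: mod_less_eq_dividend) (metis mod_less_eq_dividend)
  \<comment> \<open>The step function that corresponds to the part of \<open>x\<close> in block
    \<open>a\<close>: at \<open>i\<close> every class containing \<open>i\<close> contributes its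
    coordinate.\<close>
  define J where "J a x i = (\<Prod>r\<in>S i. c (h (a, r)) x)" for a x i
  define H where "H = B <#> N"
  have sH: "subgroup H G" unfolding H_def by (rule mult_subgroups[OF sB N(1)])
  have HG: "x \<in> carrier G" if "x \<in> H" for x using sH that by (rule subgroup.mem_carrier)
  have BH: "B \<subseteq> H" "N \<subseteq> H" unfolding H_def by (rule set_mult_incl[OF sB N(1)])+
  have c1: "cmod (c A x) = 1" if "A \<in> \<C>" "x \<in> carrier G" for A x
    using \<pi>C[OF that] by (simp add: c_def cmod_circle_fun)
  have cN: "c A n = 1" if "A \<in> \<C>" "n \<in> N" for A n
    using \<pi>(4)[OF that] by (simp add: c_def one_circle_fun)
  have cm: "c A (x \<otimes> z) = c A x * c A z" if "A \<in> \<C>" "x \<in> carrier G" "z \<in> carrier G" for A x z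
    using \<pi>m[OF that] by (simp add: c_def)
  have cy: "c A (y A') = (if A = A' then \<zeta> else 1)" if "A \<in> \<C>" "A' \<in> \<C>" for A A'
  proof (cases "A = A'")
    case True
    then show ?thesis using \<pi>(2)[OF that(1)] by (simp add: c_def Z_def)
  next
    case False
    then have "y A' \<in> generate G (\<Union>(\<C> - {A}))" using yA[OF that(2)] that by (auto intro: generate.incl)
    then show ?thesis using \<pi>(3)[OF that(1)] False by (simp add: c_def one_circle_fun)
  qed
  have supp: "\<exists>\<D>. finite \<D> \<and> (\<forall>A\<in>\<C> - \<D>. c A x = 1)" if x: "x \<in> H" for x
  proof -
    obtain b n where bn: "b \<in> B" "n \<in> N" "x = b \<otimes> n" using x unfolding H_def by (auto simp: mem_set_mult)
    obtain \<D> where \<D>: "finite \<D>" "\<D> \<subseteq> \<C>" "b \<in> generate G (\<Union>\<D>)"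
      using span_finite bn(1) unfolding B_def by blast
    have "c A x = 1" if A: "A \<in> \<C> - \<D>" for A
    proof -
      have "\<Union>\<D> \<subseteq> \<Union>(\<C> - {A})" using \<D>(2) A by blast
      then have "b \<in> generate G (\<Union>(\<C> - {A}))" using \<D>(3) mono_generate by blast
      then have "c A b = 1" using \<pi>(3) A by (simp add: c_def one_circle_fun)
      moreover have "b \<in> carrier G" "n \<in> carrier G" using bn BH HG by auto
      ultimately show ?thesis using cm[of A b n] cN[of A n] A bn by simp
    qed
    then show ?thesis using \<D>(1) by blast
  qed
  have Jhom: "J a \<in> hom (G\<lparr>carrier := H\<rparr>) circle_fun" if a: "a \<in> \<C>" for a
  proof (rule homI)
    fix x z assume xz: "x \<in> carrier (G\<lparr>carrier := H\<rparr>)" "z \<in> carrier (G\<lparr>carrier := H\<rparr>)"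
    then show "J a (x \<otimes>\<^bsub>G\<lparr>carrier := H\<rparr>\<^esub> z) = J a x \<otimes>\<^bsub>circle_fun\<^esub> J a z"
      using cm[OF hC[OF a]] HG by (simp add: J_def mult_circle_fun prod.distrib fun_eq_iff)
  next
    fix x assume "x \<in> carrier (G\<lparr>carrier := H\<rparr>)"
    then have x: "x \<in> H" by simp
    obtain \<D> where \<D>: "finite \<D>" "\<And>A. A \<in> \<C> - \<D> \<Longrightarrow> c A x = 1" using supp[OF x] by blast
    define R where "R = {r. h (a, r) \<in> \<D>}"
    have "inj (\<lambda>r. h (a, r))" using hinj[OF a a] by (auto simp: inj_on_def)
    then have finR: "finite R" using finite_vimageI[OF \<D>(1), of "\<lambda>r. h (a, r)"] by (simp add: R_def vimage_def)
    have Jx: "J a x i = (\<Prod>r\<in>{r \<in> R. i mod 2 ^ bit_len r = r}. c (h (a, r)) x)" for i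
    proof -
      have "(\<Prod>r\<in>{r \<in> R. i mod 2 ^ bit_len r = r}. c (h (a, r)) x) = (\<Prod>r\<in>S i. c (h (a, r)) x)"
        using \<D>(2) hC[OF a] by (intro prod.mono_neutral_left finS) (auto simp: S_iff R_def)
      then show ?thesis by (simp add: J_def)
    qed
    obtain P where P: "\<And>r. r \<in> R \<Longrightarrow> bit_len r \<le> P"
      using finite_imageI[OF finR, of bit_len] unfolding finite_nat_set_iff_bounded_le by blast
    have "periodic P (J a x)"
      unfolding periodic_def
    proof (intro allI impI)
      fix i j :: nat assume ij: "i mod 2 ^ P = j mod 2 ^ P"
      have "{r \<in> R. i mod 2 ^ bit_len r = r} = {r \<in> R. j mod 2 ^ bit_len r = r}"
        using mod_pow_le[OF P ij] by auto
      then show "J a x i = J a x j" unfolding Jx by simp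
    qed
    moreover have "cmod (J a x i) = 1" for i
      unfolding J_def using c1[OF hC[OF a] HG[OF x]] by (simp flip: prod_norm)
    ultimately show "J a x \<in> carrier circle_fun" by (rule periodic_circle_fun)
  qed
  have Jy: "J b (y (h (a, r))) i = (if a = b \<and> i mod 2 ^ bit_len r = r then \<zeta> else 1)"
    if "a \<in> \<C>" "b \<in> \<C>" for a b r i
  proof -
    have "J b (y (h (a, r))) i = (\<Prod>s\<in>S i. if r = s then (if a = b then \<zeta> else 1) else 1)"
      unfolding J_def using cy hC hinj that by (intro prod.cong) auto
    also have "\<dots> = (if r \<in> S i then (if a = b then \<zeta> else 1) else 1)"
      by (rule prod.delta'[OF finS])
    finally show ?thesis by (auto simp: S_iff)
  qed
  define \<P> where "\<P> = (\<lambda>a x. mean (J a x)) ` \<C>"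
  have pn: "pseudonorm_on H \<nu>" "\<forall>n\<in>N. \<nu> n = 0" if \<nu>: "\<nu> \<in> \<P>" for \<nu>
  proof -
    obtain a where a: "a \<in> \<C>" "\<nu> = (\<lambda>x. mean (J a x))" using \<nu> unfolding \<P>_def by blast
    show "pseudonorm_on H \<nu>" unfolding a(2) by (rule pseudonorm_mean[OF sH Jhom[OF a(1)]])
    have "J a n = (\<lambda>i. 1)" if "n \<in> N" for n using cN[OF hC[OF a(1)] that] by (simp add: J_def fun_eq_iff)
    then show "\<forall>n\<in>N. \<nu> n = 0" unfolding a(2) by (simp add: mean_one)
  qed
  have "b = \<one>" if b: "b \<in> B" "\<forall>\<nu>\<in>\<P>. \<nu> b = 0" for b
  proof -
    have J1: "J a b i = 1" if a: "a \<in> \<C>" for a i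
    proof -
      have "b \<in> H" using b(1) BH(1) by (rule subsetD[rotated])
      then have JC: "J a b \<in> carrier circle_fun" using Jhom[OF a] by (simp add: hom_def Pi_iff)
      have "(\<lambda>x. mean (J a x)) \<in> \<P>" unfolding \<P>_def using a by (rule imageI)
      then have "mean (J a b) = 0" using b(2) by auto
      then have "J a b = (\<lambda>i. 1)" using mean_pos[OF JC] by auto
      then show ?thesis by simp
    qed
    \<comment> \<open>The system is triangular: at the point \<open>r\<close> only indices up to
      \<open>r\<close> contribute, and \<open>r\<close> itself does. So the coordinates are
      recovered one after another.\<close>
    have "c (h (a, r)) b = 1" if a: "a \<in> \<C>" for a r
    proof (induction r rule: less_induct)
      case (less r)
      have r: "r \<in> S r" using less_bit_len[of r] by (simp add: S_iff)
      have "(\<Prod>s\<in>S r. c (h (a, s)) b) = c (h (a, r)) b * (\<Prod>s\<in>S r - {r}. c (h (a, s)) b)"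
        by (rule prod.remove[OF finS r])
      also have "(\<Prod>s\<in>S r - {r}. c (h (a, s)) b) = 1"
        by (rule prod.neutral) (auto simp: S_def intro!: less)
      finally show ?case using J1[OF a, of r] by (simp add: J_def)
    qed
    then have c1: "c A b = 1" if "A \<in> \<C>" for A
      using bij_betw_imp_surj_on[OF h] that by (metis (no_types, lifting) SigmaE imageE)
    show "b = \<one>"
    proof (rule span_separated[OF comm_group_circle_fun sub])
      show "\<pi> A \<in> hom G circle_fun" if "A \<in> \<C>" for A using \<pi>(1)[OF that] .
      show "a = \<one>" if "A \<in> \<C>" "a \<in> A" "\<pi> A a = \<one>\<^bsub>circle_fun\<^esub>" for A a using \<pi>(5)[OF that] .
      show "\<pi> A a = \<one>\<^bsub>circle_fun\<^esub>" if "A \<in> \<C>" "A' \<in> \<C>" "A \<noteq> A'" "a \<in> A'" for A A' a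
        using \<pi>(3)[OF that(1), of a] that by (auto intro: generate.incl)
      show "b \<in> generate G (\<Union>\<C>)" using b(1) unfolding B_def .
      show "\<pi> A b = \<one>\<^bsub>circle_fun\<^esub>" if "A \<in> \<C>" for A
        using \<pi>const[OF that b(1)] c1[OF that] by (simp add: c_def one_circle_fun fun_eq_iff)
    qed
  qed
  then have "{b \<in> B. \<forall>\<nu>\<in>\<P>. \<nu> b = 0} \<subseteq> {\<one>}" by (intro subsetI) simp
  then have "finite {b \<in> B. \<forall>\<nu>\<in>\<P>. \<nu> b = 0}" by (rule finite_subset) simp
  moreover have "char_free B \<P>"
  proof (rule char_freeI)
    fix f F e x
    assume f: "unitary_char G B f" and F: "F \<subseteq> \<P>" "finite F" and e: "(e::real) > 0"
      and small: "\<And>x. x \<in> B \<Longrightarrow> (\<And>\<nu>. \<nu> \<in> F \<Longrightarrow> \<nu> x < e) \<Longrightarrow> cmod (f x - 1) \<le> 1 / 4" and x: "x \<in> B"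
    have fm: "f (x \<otimes> z) = f x * f z" if "x \<in> B" "z \<in> B" for x z using f that unfolding unitary_char_def by blast
    obtain n0 where n0: "(1 / 2) ^ n0 < e / 2" using real_arch_pow_inv[of "e / 2" "1 / 2"] e by auto
    have fy: "f (y (h (a, r))) = 1" if a: "a \<in> \<C>" for a r
    proof -
      define z where "z r = y (h (a, r))" for r
      have zB: "z r \<in> B" for r unfolding z_def using yA[OF hC[OF a]] memB[OF hC[OF a]] by blast
      have Jz: "J b (z r) i = (if a = b \<and> i mod 2 ^ bit_len r = r then \<zeta> else 1)" if "b \<in> \<C>" for b r i
        unfolding z_def by (rule Jy[OF a that])
      have hB: "haar z n s \<in> B" for n s
        by (induction n arbitrary: s) (auto simp: zB intro!: subgroup.m_closed[OF sB] subgroup.m_inv_closed[OF sB])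
      have Jm: "J b (u \<otimes> inv w) i = J b u i * inverse (J b w i)" if b: "b \<in> \<C>" and uw: "u \<in> B" "w \<in> B" for b u w i
      proof -
        have uwH: "u \<in> H" "w \<in> H" "inv w \<in> H" using uw BH sH by (auto intro: subgroup.m_inv_closed)
        have JC: "J b u \<in> carrier circle_fun" "J b w \<in> carrier circle_fun" "J b (inv w) \<in> carrier circle_fun"
          using Jhom[OF b] uwH by (auto simp: hom_def)
        have "J b (inv w) \<otimes>\<^bsub>circle_fun\<^esub> J b w = J b (inv w \<otimes> w)"
          using Jhom[OF b] uwH by (auto simp: hom_def)
        also have "\<dots> = \<one>\<^bsub>circle_fun\<^esub>"
          using HG[OF uwH(2)] hom_eq_one[OF is_group CF.is_group sH Jhom[OF b]] by simp
        finally have "J b (inv w) = inv\<^bsub>circle_fun\<^esub> J b w" using JC CF.inv_equality by metis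
        moreover have "J b (u \<otimes> inv w) = J b u \<otimes>\<^bsub>circle_fun\<^esub> J b (inv w)"
          using Jhom[OF b] uwH by (auto simp: hom_def)
        ultimately show ?thesis using JC by (simp add: mult_circle_fun inv_circle_fun)
      qed
      have Jh: "J b (haar z n s) i = (if a = b \<and> i mod 2 ^ n = s then \<zeta> else 1)"
        if b: "b \<in> \<C>" and s: "s < 2 ^ n" for b n s i
        using s
      proof (induction n arbitrary: s)
        case 0
        then show ?case using Jz[OF b, of 0 i] by (simp add: bit_len_0)
      next
        case (Suc n)
        show ?case
        proof (cases "s < 2 ^ n")
          case True
          have "bit_len (s + 2 ^ n) = Suc n" by (rule bit_len_eq) (use True in auto)
          then have "J b (haar z (Suc n) s) i = (if a = b \<and> i mod 2 ^ n = s then \<zeta> else 1) *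
              inverse (if a = b \<and> i mod 2 ^ Suc n = s + 2 ^ n then \<zeta> else 1)"
            using True Jm[OF b hB zB] Suc.IH[OF True] Jz[OF b] by simp
          also have "\<dots> = (if a = b \<and> i mod 2 ^ Suc n = s then \<zeta> else 1)"
          proof -
            define t u where "t = i mod 2 ^ n" and "u = i mod 2 ^ Suc n"
            have "t < 2 ^ n" "u = t \<or> u = t + 2 ^ n"
              unfolding t_def u_def using mod_double_cases[of i n] by (simp, blast)
            then show ?thesis
              unfolding t_def[symmetric] u_def[symmetric] using True \<zeta>1(2) by auto
          qed
          finally show ?thesis .
        next
          case False
          then have "bit_len s = Suc n" using Suc.prems by (intro bit_len_eq) auto
          then show ?thesis using False Jz[OF b, of s i] by simp
        qed
      qed
      \<comment> \<open>All powers of a piece at level \<open>n0\<close> or finer are supported on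
        one class of small measure, so they all lie in the given neighbourhood and the character is
        trivial on the piece.\<close>
      have fine: "f (haar z n s) = 1" if n: "n \<ge> n0" and s: "s < 2 ^ n" for n s
      proof (rule small_powers_imp_one)
        show "cmod (f (haar z n s)) = 1" using f hB unfolding unitary_char_def by blast
        fix k :: nat
        have kB: "haar z n s [^] k \<in> B" by (rule subgroup_pow_closed[OF sB hB])
        have "\<nu> (haar z n s [^] k) < e" if \<nu>: "\<nu> \<in> F" for \<nu>
        proof -
          obtain b where b: "b \<in> \<C>" "\<nu> = (\<lambda>x. mean (J b x))" using \<nu> F(1) unfolding \<P>_def by blast
          have "J b (haar z n s [^] k) = J b (haar z n s) [^]\<^bsub>circle_fun\<^esub> k"
            using hom_on_pow[OF sH comm_group_circle_fun Jhom[OF b(1)]] hB BH by blast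
          then have "J b (haar z n s [^] k) i = 1" if "i mod 2 ^ n \<noteq> s" for i
            using Jh[OF b(1) s] that by (simp add: pow_circle_fun)
          moreover have "J b (haar z n s [^] k) \<in> carrier circle_fun"
            using Jhom[OF b(1)] kB BH by (auto simp: hom_def)
          ultimately have "\<nu> (haar z n s [^] k) \<le> 2 / 2 ^ n" unfolding b(2) by (intro mean_class)
          also have "\<dots> \<le> 2 / 2 ^ n0" using n by (intro divide_left_mono power_increasing) auto
          also have "\<dots> < e" using n0 by (simp add: power_divide field_simps)
          finally show ?thesis .
        qed
        then have "cmod (f (haar z n s [^] k) - 1) \<le> 1 / 4" by (rule small[OF kB])
        then show "cmod (f (haar z n s) ^ k - 1) \<le> 1"
          using unitary_char_pow[OF sB f hB] by simp
      qed
      \<comment> \<open>A piece is the product of its two halves at the next level, so triviality is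
        carried from the fine levels to the coarse ones.\<close>
      have "\<forall>s<2 ^ n. f (haar z n s) = 1" for n
      proof (cases "n \<ge> n0")
        case True
        then show ?thesis using fine by blast
      next
        case False
        then have "n \<le> n0" by simp
        then show ?thesis
        proof (induction rule: inc_induct)
          case base
          show ?case using fine by blast
        next
          case (step n)
          show ?case
          proof (intro allI impI)
            fix s :: nat assume s: "s < 2 ^ n"
            have *: "haar z (Suc n) s = haar z n s \<otimes> inv (z (s + 2 ^ n))" "haar z (Suc n) (s + 2 ^ n) = z (s + 2 ^ n)"
              using s by auto
            have car: "haar z n s \<in> carrier G" "z (s + 2 ^ n) \<in> carrier G"
              using hB zB subgroup.mem_carrier[OF sB] by auto
            have "haar z n s = haar z (Suc n) s \<otimes> haar z (Suc n) (s + 2 ^ n)"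
              unfolding * using car by (simp add: m_assoc)
            then have "f (haar z n s) = f (haar z (Suc n) s \<otimes> haar z (Suc n) (s + 2 ^ n))"
              by (rule arg_cong)
            also have "\<dots> = f (haar z (Suc n) s) * f (haar z (Suc n) (s + 2 ^ n))"
              by (rule fm[OF hB hB])
            also have "f (haar z (Suc n) s) = 1" by (rule step.IH[rule_format]) (use s in simp)
            also have "f (haar z (Suc n) (s + 2 ^ n)) = 1" by (rule step.IH[rule_format]) (use s in simp)
            finally show "f (haar z n s) = 1" by simp
          qed
        qed
      qed
      moreover have "z r = haar z (bit_len r) r"
      proof (cases "bit_len r")
        case 0
        then have "r = 0" using less_bit_len[of r] by simp
        then show ?thesis by (simp add: bit_len_0)
      next
        case (Suc n)
        have "\<not> r < 2 ^ n"
        proof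
          assume "r < 2 ^ n"
          then have "bit_len r \<le> n" unfolding bit_len_def by (rule Least_le)
          then show False using Suc by simp
        qed
        then show ?thesis using Suc by simp
      qed
      ultimately show ?thesis using less_bit_len[of r] unfolding z_def by metis
    qed
    have "f s = 1" if s: "s \<in> \<Union>\<C>" for s
    proof -
      obtain A where A: "A \<in> \<C>" "s \<in> A" using s by blast
      then obtain j :: nat where j: "s = y A [^] j" using Apow by blast
      obtain a r where "a \<in> \<C>" "A = h (a, r)"
        using bij_betw_imp_surj_on[OF h] A(1) by (metis (no_types, lifting) SigmaE imageE)
      then have "f (y A) = 1" using fy by blast
      then show ?thesis using unitary_char_pow[OF sB f, of "y A" j] yA[OF A(1)] memB[OF A(1)] j by auto
    qed
    then show "f x = 1"
      using unitary_char_trivial_on_generate[OF f sB, of "\<Union>\<C>" x] x memB unfolding B_def by blast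
  qed
  ultimately show ?thesis
    using pn unfolding B_def H_def by (intro exI[of _ \<P>]) blast
qed


section \<open>Splitting off homocyclic summands\<close>

lemma span_finite_family:
  assumes "finite \<C>" "\<And>A. A \<in> \<C> \<Longrightarrow> subgroup A G" "\<And>A. A \<in> \<C> \<Longrightarrow> finite A"
  shows "finite (generate G (\<Union>\<C>))"
  using assms
proof (induction \<C>)
  case empty
  then show ?case by (simp add: generate_empty)
next
  case (insert A \<C>)
  have "generate G (\<Union>(insert A \<C>)) = A <#> generate G (\<Union>\<C>)"
    using insert.prems by (intro span_insert) auto
  moreover have "finite (A <#> generate G (\<Union>\<C>))"
    unfolding set_mult_def using insert by auto
  ultimately show ?case by simp
qed

text \<open>The order of \<open>y\<close> divides \<open>p ^ i\<close> but not
  \<open>p ^ (i - 1)\<close>.\<close>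

lemma int_pow_eq_one_of_order:
  assumes y: "y \<in> carrier G" and p: "prime (p::nat)"
    and q: "y [^] (p ^ i) = \<one>" and nq: "i > 0" "y [^] (p ^ (i - 1)) \<noteq> \<one>"
  shows "y [^] (k::int) = \<one> \<longleftrightarrow> int (p ^ i) dvd k"
proof -
  have "y [^] (p ^ i) \<in> {\<one>}" using q by simp
  moreover have "p ^ i > 0" using p by (simp add: prime_gt_0_nat)
  ultimately obtain d :: nat where d: "\<And>k::int. y [^] k \<in> {\<one>} \<longleftrightarrow> int d dvd k"
    using relative_order[OF triv_subgroup y] by metis
  have "int d dvd int (p ^ i)" using d[of "int (p ^ i)"] q by (simp only: int_pow_int) simp
  then have "d dvd p ^ i" by (simp only: of_nat_dvd_iff)
  then obtain j where j: "j \<le> i" "d = p ^ j" using divides_primepow_nat[OF p] by blast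
  have "\<not> int d dvd int (p ^ (i - 1))" using d[of "int (p ^ (i - 1))"] nq(2) by (simp only: int_pow_int) simp
  then have "\<not> p ^ j dvd p ^ (i - 1)" using j by (simp only: of_nat_dvd_iff not_False_eq_True)
  then have "\<not> j \<le> i - 1" using le_imp_power_dvd by blast
  then have "j = i" using j(1) nq(1) by simp
  then show ?thesis using d j by simp
qed

text \<open>In a direct sum the equation \<open>b [^] e = \<one>\<close> holds in every component,
  and roots may be taken componentwise.\<close>

lemma span_roots:
  assumes ind: "independent_family \<C>"
    and root: "\<And>A a. A \<in> \<C> \<Longrightarrow> a \<in> A \<Longrightarrow> a [^] (e::nat) = \<one> \<Longrightarrow> \<exists>c\<in>A. a = c [^] (p::nat)"
    and b: "b \<in> generate G (\<Union>\<C>)" "b [^] e = \<one>"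
  shows "\<exists>c\<in>generate G (\<Union>\<C>). b = c [^] p"
proof -
  have sub: "\<And>A. A \<in> \<C> \<Longrightarrow> subgroup A G" using ind unfolding independent_family_def by blast
  have main: "\<forall>b\<in>generate G (\<Union>\<D>). b [^] e = \<one> \<longrightarrow> (\<exists>c\<in>generate G (\<Union>\<D>). b = c [^] p)"
    if "finite \<D>" "\<D> \<subseteq> \<C>" for \<D>
    using that
  proof (induction \<D>)
    case empty
    have "generate G {} = {\<one>}" by (rule generate_empty)
    then show ?case by simp
  next
    case (insert A \<D>)
    have A: "A \<in> \<C>" "subgroup A G" using insert.prems sub by auto
    have sD: "\<And>B. B \<in> \<D> \<Longrightarrow> subgroup B G" using insert.prems sub by auto
    have S: "subgroup (generate G (\<Union>\<D>)) G" using sD by (rule subgroup_span)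
    have eq: "generate G (\<Union>(insert A \<D>)) = A <#> generate G (\<Union>\<D>)" by (rule span_insert[OF A(2) sD])
    show ?case
    proof (intro ballI impI)
      fix x assume x: "x \<in> generate G (\<Union>(insert A \<D>))" "x [^] e = \<one>"
      obtain a b where ab: "a \<in> A" "b \<in> generate G (\<Union>\<D>)" "x = a \<otimes> b"
        using x(1) eq by (auto simp: mem_set_mult)
      have car: "a \<in> carrier G" "b \<in> carrier G" using ab A(2) S by (auto dest: subgroup.mem_carrier)
      have ae: "a [^] e \<in> A" by (rule subgroup_pow_closed[OF A(2) ab(1)])
      have be: "b [^] e \<in> generate G (\<Union>\<D>)" by (rule subgroup_pow_closed[OF S ab(2)])
      have prod: "a [^] e \<otimes> b [^] e = \<one>" using x(2) car by (simp add: ab(3) pow_mult_distrib m_comm)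
      then have "a [^] e = inv (b [^] e)" using car by (metis inv_equality nat_pow_closed)
      then have "a [^] e \<in> generate G (\<Union>\<D>)" using be S by (simp add: subgroup.m_inv_closed)
      moreover have "\<Union>\<D> \<subseteq> \<Union>(\<C> - {A})" using insert by blast
      ultimately have "a [^] e \<in> generate G (\<Union>(\<C> - {A}))" using mono_generate by blast
      then have a1: "a [^] e = \<one>" using ae A(1) ind unfolding independent_family_def by blast
      then have b1: "b [^] e = \<one>" using prod car by simp
      obtain c where c: "c \<in> A" "a = c [^] p" using root[OF A(1) ab(1) a1] by blast
      obtain c' where c': "c' \<in> generate G (\<Union>\<D>)" "b = c' [^] p" using insert ab(2) b1 by auto
      have "c \<in> carrier G" "c' \<in> carrier G" using c c' A(2) S by (auto dest: subgroup.mem_carrier)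
      then have "x = (c \<otimes> c') [^] p" by (simp add: ab(3) c(2) c'(2) pow_mult_distrib m_comm)
      moreover have "c \<otimes> c' \<in> generate G (\<Union>(insert A \<D>))" using c(1) c'(1) eq by (auto simp: mem_set_mult)
      ultimately show "\<exists>c\<in>generate G (\<Union>(insert A \<D>)). x = c [^] p" by blast
    qed
  qed
  obtain \<D> where \<D>: "finite \<D>" "\<D> \<subseteq> \<C>" "b \<in> generate G (\<Union>\<D>)" using span_finite[OF b(1)] by blast
  then obtain c where "c \<in> generate G (\<Union>\<D>)" "b = c [^] p" using main b(2) by blast
  then show ?thesis using mono_generate[of "\<Union>\<D>" "\<Union>\<C>"] \<D>(2) by blast
qed

text \<open>By Bezout, raising to a power prime to \<open>q\<close> is invertible on the elements
  killed by \<open>q\<close>.\<close>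

lemma root_of_coprime_order:
  assumes B: "subgroup B G" and b: "b \<in> B" "b [^] (q::nat) = \<one>" and cop: "coprime l q"
  shows "\<exists>c\<in>B. b = c [^] (l::nat)"
proof -
  obtain u v :: int where uv: "u * int l + v * int q = 1"
    using bezout_int[of "int l" "int q"] cop by (auto simp: gcd_int_int_eq coprime_iff_gcd_eq_1)
  have bG: "b \<in> carrier G" using B b(1) by (rule subgroup.mem_carrier)
  have "b [^] (int q * v) = \<one>" using b(2) bG by (simp add: int_pow_int flip: int_pow_pow)
  moreover have "b = b [^] (u * int l) \<otimes> b [^] (int q * v)"
    using bG uv by (simp add: int_pow_mult[symmetric] mult.commute)
  ultimately have "b = (b [^] u) [^] l" using bG by (simp add: int_pow_int flip: int_pow_pow)
  moreover have "b [^] u \<in> B" by (rule subgroup_int_pow_closed[OF B b(1)])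
  ultimately show ?thesis by blast
qed

text \<open>If \<open>g\<close> lies outside \<open>B <#> W\<close>, some power \<open>g1\<close> of
  it has prime order \<open>l\<close> modulo \<open>B <#> W\<close>. Then \<open>g1 [^] l\<close> is
  a product of \<open>b\<close> in \<open>B\<close> and \<open>w\<close> in \<open>W\<close>, and
  dividing \<open>g1\<close> by an \<open>l\<close>-th root of \<open>b\<close> in \<open>B\<close>
  gives \<open>g2\<close> outside \<open>B <#> W\<close> with \<open>g2 [^] l = w\<close>. Adjoining
  \<open>g2\<close> to \<open>W\<close> keeps the intersection with \<open>B\<close> trivial,
  against maximality.\<close>

lemma complement_of_roots:
  assumes B: "subgroup B G" and N: "subgroup N G" "B \<subseteq> N" and d: "d > (0::nat)" "\<And>x. x \<in> N \<Longrightarrow> x [^] d = \<one>"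
    and W: "subgroup W G" "W \<subseteq> N" "W \<inter> B \<subseteq> {\<one>}"
    and max: "\<And>V. subgroup V G \<Longrightarrow> V \<subseteq> N \<Longrightarrow> V \<inter> B \<subseteq> {\<one>} \<Longrightarrow> W \<subseteq> V \<Longrightarrow> V = W"
    and root: "\<And>l b. prime (l::nat) \<Longrightarrow> l dvd d \<Longrightarrow> b \<in> B \<Longrightarrow> b [^] (d div l) = \<one> \<Longrightarrow> \<exists>c\<in>B. b = c [^] l"
  shows "B <#> W = N"
proof
  show "B <#> W \<subseteq> N" by (rule set_mult_least[OF N W(2)])
  have BW: "subgroup (B <#> W) G" by (rule mult_subgroups[OF B W(1)])
  note inc = set_mult_incl[OF B W(1)]
  show "N \<subseteq> B <#> W"
  proof
    fix g assume g: "g \<in> N"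
    show "g \<in> B <#> W"
    proof (rule ccontr)
      assume gn: "g \<notin> B <#> W"
      have gG: "g \<in> carrier G" using N(1) g by (rule subgroup.mem_carrier)
      have "g [^] d \<in> B <#> W" using d(2)[OF g] subgroup.one_closed[OF BW] by simp
      then obtain r :: nat where r: "r > 0" "g [^] r \<in> B <#> W" "\<And>k::int. g [^] k \<in> B <#> W \<longleftrightarrow> int r dvd k"
        using relative_order[OF BW gG d(1)] by metis
      have "r \<noteq> 1" using r(2) gn gG by auto
      then obtain l where l: "prime l" "l dvd r" using prime_factor_nat by blast
      then obtain s where s: "r = l * s" by (auto elim: dvdE)
      have "int r dvd int d" using r(3)[of "int d"] d(2)[OF g] subgroup.one_closed[OF BW] by (simp only: int_pow_int)
      then have "l dvd d" using l(2) by (meson dvd_trans of_nat_dvd_iff)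
      then obtain e where e: "d = l * e" by (rule dvdE)
      have l0: "l > 0" "l > 1" using prime_gt_1_nat[OF l(1)] by auto
      define g1 where "g1 = g [^] s"
      have g1N: "g1 \<in> N" unfolding g1_def by (rule subgroup_pow_closed[OF N(1) g])
      have g1G: "g1 \<in> carrier G" using N(1) g1N by (rule subgroup.mem_carrier)
      have "g1 [^] l = g [^] r" unfolding g1_def s using gG by (simp add: nat_pow_pow mult.commute)
      then have "g1 [^] l \<in> B <#> W" using r(2) by simp
      then obtain b w where bw: "b \<in> B" "w \<in> W" "g1 [^] l = b \<otimes> w" by (auto simp: mem_set_mult)
      have g1n: "g1 \<notin> B <#> W"
      proof
        assume "g1 \<in> B <#> W"
        then have "int r dvd int s" using r(3)[of "int s"] unfolding g1_def by (simp add: int_pow_int)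
        then have "r dvd s" by simp
        then show False using s r(1) l0 by (auto dest: dvd_imp_le)
      qed
      have car: "b \<in> carrier G" "w \<in> carrier G" using bw B W(1) by (auto dest: subgroup.mem_carrier)
      \<comment> \<open>As \<open>d = l * e\<close> kills \<open>g1\<close>, the product of
        \<open>b [^] e\<close> and \<open>w [^] e\<close> is trivial; since \<open>B\<close> and
        \<open>W\<close> meet trivially, \<open>b [^] e = \<one>\<close>, which is the condition for
        a root of \<open>b\<close>.\<close>
      have "\<one> = (g1 [^] l) [^] e" using d(2)[OF g1N] g1G by (simp add: e nat_pow_pow)
      also have "\<dots> = b [^] e \<otimes> w [^] e" using car by (simp add: bw(3) pow_mult_distrib m_comm)
      finally have "b [^] e = inv (w [^] e)" using car by (metis inv_equality nat_pow_closed)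
      then have "b [^] e \<in> W"
        using subgroup_pow_closed[OF W(1) bw(2)] W(1) by (simp add: subgroup.m_inv_closed)
      then have "b [^] e = \<one>" using subgroup_pow_closed[OF B bw(1)] W(3) by blast
      moreover have "d div l = e" using l0 by (simp add: e)
      ultimately obtain c where c: "c \<in> B" "b = c [^] l" using root[OF l(1) \<open>l dvd d\<close> bw(1)] by auto
      have cG: "c \<in> carrier G" using B c(1) by (rule subgroup.mem_carrier)
      define g2 where "g2 = g1 \<otimes> inv c"
      have g2N: "g2 \<in> N" unfolding g2_def using g1N c(1) N by (auto intro!: subgroup.m_closed subgroup.m_inv_closed)
      have g2G: "g2 \<in> carrier G" using N(1) g2N by (rule subgroup.mem_carrier)
      have "g2 [^] l = (b \<otimes> w) \<otimes> inv b"
        unfolding g2_def using g1G cG by (simp add: pow_mult_distrib m_comm nat_pow_inv bw(3) flip: c(2))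
      then have g2l: "g2 [^] l = w" using car by (simp add: m_comm[of b w] m_assoc)
      have g2n: "g2 \<notin> B <#> W"
      proof
        assume "g2 \<in> B <#> W"
        moreover have "c \<in> B <#> W" using c(1) inc by blast
        ultimately have "g2 \<otimes> c \<in> B <#> W" using BW by (simp add: subgroup.m_closed)
        moreover have "g2 \<otimes> c = g1" unfolding g2_def using g1G cG by (simp add: m_assoc)
        ultimately show False using g1n by simp
      qed
      note sg2 = subgroup_generate_singleton[OF g2G]
      \<comment> \<open>\<open>g2\<close> has order exactly \<open>l\<close> modulo
        \<open>B <#> W\<close>, so a power of \<open>g2\<close> lying there is a power of
        \<open>w\<close>; an element of the intersection is therefore already in
        \<open>W\<close>.\<close>
      have "(W <#> generate G {g2}) \<inter> B \<subseteq> {\<one>}"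
      proof
        fix x assume x: "x \<in> (W <#> generate G {g2}) \<inter> B"
        then obtain w' and k :: int where w': "w' \<in> W" "x = w' \<otimes> g2 [^] k"
          by (auto simp: mem_set_mult mem_generate_singleton[OF g2G])
        have xw: "w' \<in> carrier G" "x \<in> carrier G" using w'(1) x W(1) B by (auto dest: subgroup.mem_carrier)
        have "inv w' \<otimes> x \<in> B <#> W"
          using w'(1) x inc W(1) by (intro subgroup.m_closed[OF BW]) (auto intro: subgroup.m_inv_closed)
        moreover have "inv w' \<otimes> x = g2 [^] k" using xw g2G by (simp add: w'(2) m_assoc[symmetric])
        ultimately have k: "g2 [^] k \<in> B <#> W" by simp
        have "g2 [^] l \<in> B <#> W" using g2l bw(2) inc by auto
        then obtain t :: nat where t: "\<And>k::int. g2 [^] k \<in> B <#> W \<longleftrightarrow> int t dvd k" "g2 [^] t \<in> B <#> W"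
          using relative_order[OF BW g2G l0(1)] by metis
        have "int t dvd int l" using t(1)[of "int l"] \<open>g2 [^] l \<in> B <#> W\<close> by (simp only: int_pow_int)
        then have "t dvd l" by simp
        moreover have "t \<noteq> 1" using t(2) g2n g2G by auto
        ultimately have "t = l" using l(1) unfolding prime_nat_iff by blast
        then have "int l dvd k" using t(1) k by blast
        then obtain m where "k = int l * m" by (rule dvdE)
        then have "g2 [^] k = w [^] m" using g2G g2l by (simp add: int_pow_int flip: int_pow_pow)
        then have "g2 [^] k \<in> W" using subgroup_int_pow_closed[OF W(1) bw(2)] by simp
        then have "x \<in> W" using w' W(1) by (simp add: subgroup.m_closed)
        then show "x \<in> {\<one>}" using x W(3) by blast
      qed
      moreover have "W <#> generate G {g2} \<subseteq> N"
        using g2N N(1) W(2) by (intro set_mult_least generate_subgroup_incl) auto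
      ultimately have "W <#> generate G {g2} = W"
        using max[OF mult_subgroups[OF W(1) sg2]] set_mult_incl(1)[OF W(1) sg2] by blast
      then have "g2 \<in> W" using set_mult_incl(2)[OF W(1) sg2] generate.incl[of g2 "{g2}" G] by blast
      then show False using g2n inc by blast
    qed
  qed
qed

text \<open>The norms in \<open>\<P>\<close> vanish on \<open>W\<close>, and those in
  \<open>\<Q>\<close>, composed with the projection \<open>\<theta>\<close> onto \<open>W\<close>
  along \<open>B\<close>, vanish on \<open>B\<close>. So a neighbourhood restricts to each factor
  through one family alone, and a character is trivial on both. An element of the common kernel has
  its components in the two finite kernels.\<close>

lemma char_free_product:
  assumes B: "subgroup B G" and W: "subgroup W G" and disj: "W \<inter> B \<subseteq> {\<one>}"
    and P1: "\<And>\<nu>. \<nu> \<in> \<P> \<Longrightarrow> pseudonorm_on (B <#> W) \<nu>" "\<And>\<nu> n. \<nu> \<in> \<P> \<Longrightarrow> n \<in> W \<Longrightarrow> \<nu> n = 0"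
      "char_free B \<P>" "finite {b \<in> B. \<forall>\<nu>\<in>\<P>. \<nu> b = 0}"
    and P2: "\<And>\<nu>. \<nu> \<in> \<Q> \<Longrightarrow> pseudonorm_on W \<nu>" "char_free W \<Q>" "finite {b \<in> W. \<forall>\<nu>\<in>\<Q>. \<nu> b = 0}"
  shows "\<exists>\<P>. (\<forall>\<nu>\<in>\<P>. pseudonorm_on (B <#> W) \<nu>) \<and> char_free (B <#> W) \<P> \<and>
    finite {x \<in> B <#> W. \<forall>\<nu>\<in>\<P>. \<nu> x = 0}"
proof -
  have triv: "(\<lambda>_. \<one>) \<in> hom (G\<lparr>carrier := B\<rparr>) G" by (auto simp: hom_def)
  have id: "(\<lambda>x. x) \<in> hom (G\<lparr>carrier := W\<rparr>) G" using subgroup.mem_carrier[OF W] by (auto simp: hom_def)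
  have "\<one> = x" if "x \<in> B" "x \<in> W" for x using disj that by blast
  then obtain \<theta> where \<theta>: "\<theta> \<in> hom (G\<lparr>carrier := B <#> W\<rparr>) G" "\<And>b. b \<in> B \<Longrightarrow> \<theta> b = \<one>" "\<And>w. w \<in> W \<Longrightarrow> \<theta> w = w"
    using hom_glue[OF B W comm_group_axioms triv id] by metis
  have BW: "subgroup (B <#> W) G" by (rule mult_subgroups[OF B W])
  note inc = set_mult_incl[OF B W]
  note memB = subgroup.mem_carrier[OF B] and memW = subgroup.mem_carrier[OF W]
  have \<theta>bw: "\<theta> (b \<otimes> w) = w" if "b \<in> B" "w \<in> W" for b w
  proof -
    have "b \<in> B <#> W" "w \<in> B <#> W" using that inc by auto
    then have "\<theta> (b \<otimes> w) = \<theta> b \<otimes> \<theta> w" using \<theta>(1) by (simp add: hom_def)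
    then show ?thesis using \<theta> that memW by simp
  qed
  have \<theta>W: "\<theta> x \<in> W" if "x \<in> B <#> W" for x using that \<theta>bw by (auto simp: mem_set_mult)
  have \<theta>m: "\<theta> (x \<otimes> y) = \<theta> x \<otimes> \<theta> y" if "x \<in> B <#> W" "y \<in> B <#> W" for x y
    using \<theta>(1) that by (simp add: hom_def)
  have \<theta>inv: "\<theta> (inv x) = inv (\<theta> x)" if x: "x \<in> B <#> W" for x
  proof -
    have ix: "inv x \<in> B <#> W" using x BW by (simp add: subgroup.m_inv_closed)
    have "\<theta> (inv x) \<otimes> \<theta> x = \<theta> \<one>" using \<theta>m[OF ix x] x subgroup.mem_carrier[OF BW] by simp
    also have "\<dots> = \<one>" using \<theta>(2) subgroup.one_closed[OF B] by blast
    finally show ?thesis using \<theta>W[OF ix] \<theta>W[OF x] memW by (metis inv_equality)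
  qed
  define \<R> where "\<R> = \<P> \<union> (\<lambda>\<nu> x. \<nu> (\<theta> x)) ` \<Q>"
  have "pseudonorm_on (B <#> W) (\<lambda>x. \<nu> (\<theta> x))" if "\<nu> \<in> \<Q>" for \<nu>
    using P2(1)[OF that] \<theta>(2) subgroup.one_closed[OF B] \<theta>W \<theta>m \<theta>inv
    unfolding pseudonorm_on_def by simp
  then have pn: "\<forall>\<nu>\<in>\<R>. pseudonorm_on (B <#> W) \<nu>" using P1(1) unfolding \<R>_def by blast
  have "char_free (B <#> W) \<R>"
  proof (rule char_freeI)
    fix f F e x
    assume f: "unitary_char G (B <#> W) f" and F: "F \<subseteq> \<R>" "finite F" and e: "(e::real) > 0"
      and small: "\<And>x. x \<in> B <#> W \<Longrightarrow> (\<And>\<nu>. \<nu> \<in> F \<Longrightarrow> \<nu> x < e) \<Longrightarrow> cmod (f x - 1) \<le> 1 / 4"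
      and x: "x \<in> B <#> W"
    have fB: "f b = 1" if b: "b \<in> B" for b
    proof (rule char_freeD[OF P1(3) unitary_char_mono[OF f inc(1)], of "F \<inter> \<P>" e])
      fix x assume x: "x \<in> B" "\<And>\<nu>. \<nu> \<in> F \<inter> \<P> \<Longrightarrow> \<nu> x < e"
      have "\<nu> x < e" if \<nu>: "\<nu> \<in> F" for \<nu>
      proof (cases "\<nu> \<in> \<P>")
        case False
        then obtain \<mu> where \<mu>: "\<mu> \<in> \<Q>" "\<nu> = (\<lambda>x. \<mu> (\<theta> x))" using F(1) \<nu> unfolding \<R>_def by blast
        then show ?thesis using \<theta>(2)[OF x(1)] P2(1)[OF \<mu>(1)] e unfolding pseudonorm_on_def by simp
      qed (use x \<nu> in auto)
      then show "cmod (f x - 1) \<le> 1 / 4" using small x(1) inc(1) by blast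
    qed (use F e b in auto)
    have "F - \<P> \<subseteq> (\<lambda>\<nu> x. \<nu> (\<theta> x)) ` \<Q>" using F(1) unfolding \<R>_def by blast
    then obtain F' where F': "F' \<subseteq> \<Q>" "finite F'" "F - \<P> = (\<lambda>\<nu> x. \<nu> (\<theta> x)) ` F'"
      using finite_subset_image[of "F - \<P>"] F(2) by (metis finite_Diff)
    have fW: "f w = 1" if w: "w \<in> W" for w
    proof (rule char_freeD[OF P2(2) unitary_char_mono[OF f inc(2)] F'(1,2) e])
      fix x assume x: "x \<in> W" "\<And>\<nu>. \<nu> \<in> F' \<Longrightarrow> \<nu> x < e"
      have "\<nu> x < e" if \<nu>: "\<nu> \<in> F" for \<nu>
      proof (cases "\<nu> \<in> \<P>")
        case True
        then show ?thesis using P1(2)[OF True x(1)] e by simp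
      next
        case False
        then have "\<nu> \<in> (\<lambda>\<nu> x. \<nu> (\<theta> x)) ` F'" using \<nu> F'(3) by blast
        then show ?thesis using x \<theta>(3) by auto
      qed
      then show "cmod (f x - 1) \<le> 1 / 4" using small x(1) inc(2) by blast
    qed (rule w)
    obtain b w where "b \<in> B" "w \<in> W" "x = b \<otimes> w" using x by (auto simp: mem_set_mult)
    moreover from this have "f x = f b * f w" using f inc unfolding unitary_char_def by blast
    ultimately show "f x = 1" using fB fW by simp
  qed
  moreover have "finite {x \<in> B <#> W. \<forall>\<nu>\<in>\<R>. \<nu> x = 0}"
  proof (rule finite_subset)
    let ?K = "{b \<in> B. \<forall>\<nu>\<in>\<P>. \<nu> b = 0}" and ?L = "{b \<in> W. \<forall>\<nu>\<in>\<Q>. \<nu> b = 0}"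
    show "finite ((\<lambda>(b, w). b \<otimes> w) ` (?K \<times> ?L))" using P1(4) P2(3) by simp
    show "{x \<in> B <#> W. \<forall>\<nu>\<in>\<R>. \<nu> x = 0} \<subseteq> (\<lambda>(b, w). b \<otimes> w) ` (?K \<times> ?L)"
    proof
      fix x assume "x \<in> {x \<in> B <#> W. \<forall>\<nu>\<in>\<R>. \<nu> x = 0}"
      then have x: "x \<in> B <#> W" "\<And>\<nu>. \<nu> \<in> \<R> \<Longrightarrow> \<nu> x = 0" by auto
      obtain b w where bw: "b \<in> B" "w \<in> W" "x = b \<otimes> w" using x(1) by (auto simp: mem_set_mult)
      have "\<nu> w = 0" if "\<nu> \<in> \<Q>" for \<nu>
        using x(2)[of "\<lambda>x. \<nu> (\<theta> x)"] that \<theta>bw[OF bw(1,2)] bw(3) unfolding \<R>_def by auto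
      moreover have "\<nu> b = 0" if \<nu>: "\<nu> \<in> \<P>" for \<nu>
      proof -
        have in': "b \<in> B <#> W" "inv w \<in> B <#> W" "w \<in> B <#> W"
          using bw inc W by (auto intro: subgroup.m_inv_closed)
        have "b = x \<otimes> inv w" using bw memB memW by (simp add: m_assoc)
        moreover have "\<nu> (x \<otimes> inv w) \<le> \<nu> x + \<nu> (inv w)" "\<nu> b \<ge> 0" "\<nu> (inv w) = \<nu> w"
          using P1(1)[OF \<nu>] in' x(1) unfolding pseudonorm_on_def by blast+
        ultimately have "\<nu> b \<le> \<nu> x + \<nu> (inv w)" "\<nu> b \<ge> 0" "\<nu> (inv w) = \<nu> w"
          by simp_all
        then show ?thesis using P1(2)[OF \<nu> bw(2)] x(2)[of \<nu>] \<nu> unfolding \<R>_def by simp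
      qed
      ultimately have "(b, w) \<in> ?K \<times> ?L" using bw by simp
      then show "x \<in> (\<lambda>(b, w). b \<otimes> w) ` (?K \<times> ?L)" using bw(3) by force
    qed
  qed
  ultimately show ?thesis using pn by blast
qed

text \<open>Induction on the exponent: a maximal independent family of cyclic subgroups of maximal
  \<open>p\<close>-power order spans a direct summand, and the exponent of the complement is smaller.\<close>

lemma bounded_char_free:
  assumes "d > (0::nat)" "subgroup N G" "\<And>x. x \<in> N \<Longrightarrow> x [^] d = \<one>"
  shows "\<exists>\<P>. (\<forall>\<nu>\<in>\<P>. pseudonorm_on N \<nu>) \<and> char_free N \<P> \<and> finite {x \<in> N. \<forall>\<nu>\<in>\<P>. \<nu> x = 0}"
  using assms
proof (induction d arbitrary: N rule: less_induct)
  case (less d)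
  note N = less.prems(2) and exp = less.prems(3)
  note memN = subgroup.mem_carrier[OF N]
  show ?case
  proof (cases "d = 1")
    case True
    then have "N \<subseteq> {\<one>}" using exp memN by fastforce
    then have "finite {x \<in> N. \<forall>\<nu>\<in>({} :: ('a \<Rightarrow> real) set). \<nu> x = 0}" by (auto intro: finite_subset)
    then show ?thesis using char_free_empty[OF N] by (intro exI[of _ "{}"]) auto
  next
    case False
    then obtain p where p: "prime p" "p dvd d" using prime_factor_nat by blast
    define i where "i = multiplicity p d"
    have "\<not> is_unit p" using p(1) by (simp add: prime_nat_iff)
    then obtain m where m: "\<not> p dvd m" "d = p ^ i * m"
      unfolding i_def using multiplicity_decompose'[of d p] less.prems(1) by auto
    have i: "i > 0" using m p(2) by (cases i) auto
    define q where "q = p ^ i"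
    \<comment> \<open>The exponent to be obtained for the complement: \<open>d\<close> with one
      factor \<open>p\<close> removed.\<close>
    define e where "e = p ^ (i - 1) * m"
    have pe: "d = p * e" using i m(2) by (cases i) (auto simp: e_def)
    have p0: "p > 0" "p > 1" using prime_gt_1_nat[OF p(1)] by auto
    have q0: "q > 0" using p0 by (simp add: q_def)
    have e0: "e > 0" "e < d" using less.prems(1) p0 by (auto simp: pe)
    have dq: "d = q * m" by (simp add: m(2) q_def)
    have copq: "coprime l q" if "prime l" "l \<noteq> p" for l :: nat
      unfolding q_def using that p(1) by (simp add: primes_coprime)
    define good where "good A \<longleftrightarrow> (\<exists>y\<in>N. generate G {y} = A \<and> (\<forall>k::int. y [^] k = \<one> \<longleftrightarrow> int q dvd k))" for A
    obtain \<C> where \<C>: "independent_family \<C>" "\<And>A. A \<in> \<C> \<Longrightarrow> good A"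
      "\<And>M. subgroup M G \<Longrightarrow> good M \<Longrightarrow> M \<inter> generate G (\<Union>\<C>) \<subseteq> {\<one>} \<Longrightarrow> M \<subseteq> {\<one>}"
      using maximal_independent_family[of good] by metis
    then obtain y where y: "\<And>A. A \<in> \<C> \<Longrightarrow> y A \<in> N" "\<And>A. A \<in> \<C> \<Longrightarrow> generate G {y A} = A"
      "\<And>A k. A \<in> \<C> \<Longrightarrow> y A [^] (k::int) = \<one> \<longleftrightarrow> int q dvd k"
      unfolding good_def by metis
    have sub: "\<And>A. A \<in> \<C> \<Longrightarrow> subgroup A G" using \<C>(1) unfolding independent_family_def by blast
    define B where "B = generate G (\<Union>\<C>)"
    have sB: "subgroup B G" unfolding B_def using sub by (rule subgroup_span)
    have AN: "A \<subseteq> N" if A: "A \<in> \<C>" for A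
      using generate_subgroup_incl[OF _ N, of "{y A}"] y(1)[OF A] y(2)[OF A] by simp
    have BN: "B \<subseteq> N" unfolding B_def by (rule generate_subgroup_incl[OF _ N]) (use AN in blast)
    obtain W where W: "subgroup W G" "W \<subseteq> N" "W \<inter> B \<subseteq> {\<one>}"
      "\<And>V. subgroup V G \<Longrightarrow> V \<subseteq> N \<Longrightarrow> V \<inter> B \<subseteq> {\<one>} \<Longrightarrow> W \<subseteq> V \<Longrightarrow> V = W"
      using maximal_disjoint_subgroup[OF sB N] by metis
    \<comment> \<open>In a cyclic group of order \<open>p ^ i\<close>, an element killed by
      \<open>p ^ (i - 1)\<close> times a number prime to \<open>p\<close> is a \<open>p\<close>-th
      power.\<close>
    have Aroot: "\<exists>c\<in>A. a = c [^] p" if A: "A \<in> \<C>" and a: "a \<in> A" "a [^] e = \<one>" for A a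
    proof -
      have yG: "y A \<in> carrier G" using y(1)[OF A] memN by blast
      obtain k :: int where k: "a = y A [^] k" using a(1) y(2)[OF A] mem_generate_singleton[OF yG] by blast
      have "y A [^] (k * int e) = \<one>" using a(2) k yG by (simp add: int_pow_int flip: int_pow_pow)
      then have "int q dvd k * int e" using y(3)[OF A] by blast
      moreover have "int q = int (p ^ (i - 1)) * int p" unfolding q_def using i by (cases i) auto
      ultimately have "int (p ^ (i - 1)) * int p dvd int (p ^ (i - 1)) * (k * int m)"
        by (simp add: e_def mult_ac)
      then have "int p dvd k * int m" using p0 by simp
      then have "int p dvd k" using m(1) p(1) by (simp add: prime_dvd_mult_iff)
      then obtain t where t: "k = t * int p" by (metis dvdE mult.commute)
      have "a = (y A [^] t) [^] p" using k t yG by (simp add: int_pow_int flip: int_pow_pow)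
      moreover have "y A [^] t \<in> A" using y(2)[OF A] mem_generate_singleton[OF yG] by blast
      ultimately show ?thesis by blast
    qed
    have Bq: "b [^] q = \<one>" if b: "b \<in> B" for b
    proof -
      have "subgroup {x \<in> carrier G. x [^] q = \<one>} G"
        by (rule subgroupI) (auto simp: pow_mult_distrib m_comm nat_pow_inv)
      moreover have "\<Union>\<C> \<subseteq> {x \<in> carrier G. x [^] q = \<one>}"
      proof
        fix a assume "a \<in> \<Union>\<C>"
        then obtain A where A: "A \<in> \<C>" "a \<in> A" by blast
        have yG: "y A \<in> carrier G" using y(1)[OF A(1)] memN by blast
        obtain k :: int where k: "a = y A [^] k" using A y(2)[OF A(1)] mem_generate_singleton[OF yG] by blast
        have "y A [^] (k * int q) = \<one>" using y(3)[OF A(1)] by simp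
        then show "a \<in> {x \<in> carrier G. x [^] q = \<one>}" using k yG by (simp add: int_pow_int flip: int_pow_pow)
      qed
      ultimately show ?thesis using generate_subgroup_incl b unfolding B_def by blast
    qed
    have "B <#> W = N"
    proof (rule complement_of_roots[OF sB N BN less.prems(1) exp W])
      fix l b assume l: "prime (l::nat)" "l dvd d" "b \<in> B" "b [^] (d div l) = \<one>"
      show "\<exists>c\<in>B. b = c [^] l"
      proof (cases "l = p")
        case True
        have "d div l = e" using True p0 by (simp add: pe)
        then show ?thesis
          using span_roots[OF \<C>(1) Aroot, where b = b] l True unfolding B_def by auto
      next
        case False
        show ?thesis by (rule root_of_coprime_order[OF sB l(3) Bq[OF l(3)] copq[OF l(1) False]])
      qed
    qed
    \<comment> \<open>Otherwise \<open>w [^] m\<close> would have order exactly \<open>q\<close>,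
      and the cyclic group it generates inside \<open>W\<close> could be added to the maximal
      family.\<close>
    have We: "w [^] e = \<one>" if w: "w \<in> W" for w
    proof (rule ccontr)
      assume ne: "w [^] e \<noteq> \<one>"
      have wG: "w \<in> carrier G" using W(1) w by (rule subgroup.mem_carrier)
      define z where "z = w [^] m"
      have zW: "z \<in> W" unfolding z_def by (rule subgroup_pow_closed[OF W(1) w])
      have zG: "z \<in> carrier G" using W(1) zW by (rule subgroup.mem_carrier)
      have "z [^] (p ^ i) = w [^] (m * p ^ i)" unfolding z_def by (rule nat_pow_pow[OF wG])
      also have "m * p ^ i = d" unfolding m(2) by (rule mult.commute)
      also have "w [^] d = \<one>" using w W(2) by (intro exp) auto
      finally have z1: "z [^] (p ^ i) = \<one>" .
      have "z [^] (p ^ (i - 1)) = w [^] (m * p ^ (i - 1))" unfolding z_def by (rule nat_pow_pow[OF wG])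
      also have "m * p ^ (i - 1) = e" unfolding e_def by (rule mult.commute)
      finally have z2: "z [^] (p ^ (i - 1)) \<noteq> \<one>" using ne by simp
      have "z \<in> N" using zW W(2) by blast
      then have "good (generate G {z})"
        using int_pow_eq_one_of_order[OF zG p(1) z1 i z2] unfolding good_def q_def by blast
      moreover have "generate G {z} \<subseteq> W" using zW W(1) by (intro generate_subgroup_incl) auto
      then have "generate G {z} \<inter> generate G (\<Union>\<C>) \<subseteq> {\<one>}" using W(3) unfolding B_def by blast
      ultimately have "generate G {z} \<subseteq> {\<one>}" using \<C>(3) subgroup_generate_singleton[OF zG] by blast
      then have "z = \<one>" using generate.incl[of z "{z}" G] by blast
      then show False using z2 by simp
    qed
    obtain \<Q> where \<Q>: "\<forall>\<nu>\<in>\<Q>. pseudonorm_on W \<nu>" "char_free W \<Q>" "finite {x \<in> W. \<forall>\<nu>\<in>\<Q>. \<nu> x = 0}"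
      using less.IH[OF e0(2,1) W(1) We] by blast
    have "\<exists>\<P>. (\<forall>\<nu>\<in>\<P>. pseudonorm_on (B <#> W) \<nu> \<and> (\<forall>n\<in>W. \<nu> n = 0)) \<and> char_free B \<P> \<and>
        finite {b \<in> B. \<forall>\<nu>\<in>\<P>. \<nu> b = 0}"
    proof (cases "finite \<C>")
      case True
      have "finite A" if A: "A \<in> \<C>" for A
      proof -
        have yG: "y A \<in> carrier G" using y(1)[OF A] memN by blast
        have "y A [^] q \<in> {\<one>}" using y(3)[OF A, of "int q"] by (simp add: int_pow_int)
        then have "finite ({\<one>} <#> generate G {y A})" by (intro finite_adjoin[OF triv_subgroup yG q0]) auto
        then show ?thesis
          using set_mult_incl(2)[OF triv_subgroup subgroup_generate_singleton[OF yG]] y(2)[OF A]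
          by (metis finite_subset)
      qed
      \<comment> \<open>A finite summand gets no norm; it goes into the finite kernel.\<close>
      then have "finite B" unfolding B_def by (intro span_finite_family[OF True sub])
      then have "finite {b \<in> B. \<forall>\<nu>\<in>({} :: ('a \<Rightarrow> real) set). \<nu> b = 0}" by simp
      then show ?thesis using char_free_empty[OF sB] by (intro exI[of _ "{}"]) auto
    next
      case False
      show ?thesis
        unfolding B_def
      proof (rule homocyclic_char_free_infinite[OF \<C>(1) q0 _ _ W(1) _ False])
        show "y A \<in> carrier G \<and> generate G {y A} = A" if "A \<in> \<C>" for A using y(1,2)[OF that] memN by blast
        show "(y A [^] (k::int) = \<one>) = (int q dvd k)" if "A \<in> \<C>" for A k by (rule y(3)[OF that])
        show "W \<inter> generate G (\<Union>\<C>) \<subseteq> {\<one>}" using W(3) unfolding B_def .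
      qed
    qed
    then obtain \<P> where \<P>: "\<forall>\<nu>\<in>\<P>. pseudonorm_on (B <#> W) \<nu> \<and> (\<forall>n\<in>W. \<nu> n = 0)" "char_free B \<P>"
      "finite {b \<in> B. \<forall>\<nu>\<in>\<P>. \<nu> b = 0}" by blast
    show ?thesis
      unfolding \<open>B <#> W = N\<close>[symmetric]
      by (rule char_free_product[OF sB W(1,3) _ _ \<P>(2,3) _ \<Q>(2,3)]) (use \<P>(1) \<Q>(1) in blast)+
  qed
qed

end

section \<open>Topologies defined by pseudonorms\<close>

lemma mem_circle_proj: "s \<in> circle_proj t \<longleftrightarrow> s - t \<in> \<int>"
proof
  assume "s \<in> circle_proj t"
  then show "s - t \<in> \<int>"
    by (auto simp: circle_proj_def r_coset_def real_group_def)
next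
  assume "s - t \<in> \<int>"
  then show "s \<in> circle_proj t"
    unfolding circle_proj_def r_coset_def by (intro UN_I[of "s - t"]) (auto simp: real_group_def)
qed

lemma cis_circle_group:
  assumes "A \<in> carrier circle_group" "s \<in> A" "t \<in> A"
  shows "cis (2 * pi * s) = cis (2 * pi * t)"
proof -
  obtain r where r: "A = circle_proj r" using assms(1) by (auto simp: carrier_circle_group)
  then have "s - r \<in> \<int>" "t - r \<in> \<int>" using assms mem_circle_proj by auto
  then have "(s - r) - (t - r) \<in> \<int>" by (rule Ints_diff)
  then have "s - t \<in> \<int>" by simp
  then have "cis (2 * pi * (s - t)) = 1" by (rule cis_multiple_2pi)
  moreover have "cis (2 * pi * s) = cis (2 * pi * (s - t)) * cis (2 * pi * t)"
    by (simp add: cis_mult algebra_simps)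
  ultimately show ?thesis by simp
qed

lemma one_circle_group: "\<one>\<^bsub>circle_group\<^esub> = \<int>"
  by (simp add: circle_group_def)

lemma cis_eq_one_imp_Ints: "cis (2 * pi * t) = 1 \<Longrightarrow> t \<in> \<int>"
proof -
  assume "cis (2 * pi * t) = 1"
  then have "cos (2 * pi * t) = 1" by (metis cis.simps(1) one_complex.simps(1))
  then obtain n :: int where "2 * pi * t = real_of_int n * 2 * pi" using cos_one_2pi_int by blast
  then have "t = n" by simp
  then show ?thesis by simp
qed

text \<open>The set comes from an open subset of the line, because \<open>cis (2 * pi * t)\<close>
  depends only on the coset of \<open>t\<close> and is continuous in \<open>t\<close>.\<close>

lemma openin_circle_near_one:
  "openin circle_topology {A \<in> carrier circle_group. \<forall>t\<in>A. cmod (cis (2 * pi * t) - 1) < 1 / 4}"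
proof -
  have "circle_proj -` {A \<in> carrier circle_group. \<forall>t\<in>A. cmod (cis (2 * pi * t) - 1) < 1 / 4}
      = {t. cmod (cis (2 * pi * t) - 1) < 1 / 4}"
  proof (intro Set.set_eqI iffI)
    fix t assume "t \<in> circle_proj -` {A \<in> carrier circle_group. \<forall>t\<in>A. cmod (cis (2 * pi * t) - 1) < 1 / 4}"
    moreover have "t \<in> circle_proj t" by (simp add: mem_circle_proj)
    ultimately show "t \<in> {t. cmod (cis (2 * pi * t) - 1) < 1 / 4}" by simp
  next
    fix t assume t: "t \<in> {t. cmod (cis (2 * pi * t) - 1) < 1 / 4}"
    have c: "circle_proj t \<in> carrier circle_group" by (simp add: carrier_circle_group)
    have "t \<in> circle_proj t" by (simp add: mem_circle_proj)
    then have "cmod (cis (2 * pi * s) - 1) < 1 / 4" if "s \<in> circle_proj t" for s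
      using cis_circle_group[OF c that] t by simp
    then show "t \<in> circle_proj -` {A \<in> carrier circle_group. \<forall>t\<in>A. cmod (cis (2 * pi * t) - 1) < 1 / 4}"
      using c by simp
  qed
  moreover have "open {t. cmod (cis (2 * pi * t) - 1) < 1 / 4}"
    unfolding cis_conv_exp by (intro open_Collect_less continuous_intros)
  ultimately show ?thesis unfolding openin_circle_topology by simp
qed

context comm_group
begin

definition pseudonorm_topology :: "('a \<Rightarrow> real) set \<Rightarrow> 'a topology" where
  "pseudonorm_topology \<P> = topology (\<lambda>U. U \<subseteq> carrier G \<and> (\<forall>x\<in>U. \<exists>F e. F \<subseteq> \<P> \<and> finite F \<and> e > 0 \<and>
     (\<forall>y\<in>carrier G. (\<forall>\<nu>\<in>F. \<nu> (inv x \<otimes> y) < e) \<longrightarrow> y \<in> U)))"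

lemma openin_pseudonorm_topology:
  "openin (pseudonorm_topology \<P>) U \<longleftrightarrow> U \<subseteq> carrier G \<and> (\<forall>x\<in>U. \<exists>F e. F \<subseteq> \<P> \<and> finite F \<and> e > 0 \<and>
     (\<forall>y\<in>carrier G. (\<forall>\<nu>\<in>F. \<nu> (inv x \<otimes> y) < e) \<longrightarrow> y \<in> U))"
proof -
  define L where "L U \<longleftrightarrow> U \<subseteq> carrier G \<and> (\<forall>x\<in>U. \<exists>F e. F \<subseteq> \<P> \<and> finite F \<and> e > 0 \<and>
     (\<forall>y\<in>carrier G. (\<forall>\<nu>\<in>F. \<nu> (inv x \<otimes> y) < e) \<longrightarrow> y \<in> U))" for U
  have "istopology L"
    unfolding istopology_def
  proof (intro conjI allI impI)
    fix S T assume S: "L S" and T: "L T"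
    have "\<exists>F e. F \<subseteq> \<P> \<and> finite F \<and> e > 0 \<and>
        (\<forall>y\<in>carrier G. (\<forall>\<nu>\<in>F. \<nu> (inv x \<otimes> y) < e) \<longrightarrow> y \<in> S \<inter> T)" if x: "x \<in> S \<inter> T" for x
    proof -
      obtain F1 e1 where 1: "F1 \<subseteq> \<P>" "finite F1" "e1 > 0"
        "\<And>y. y \<in> carrier G \<Longrightarrow> \<forall>\<nu>\<in>F1. \<nu> (inv x \<otimes> y) < e1 \<Longrightarrow> y \<in> S"
        using S x unfolding L_def by (metis IntD1)
      obtain F2 e2 where 2: "F2 \<subseteq> \<P>" "finite F2" "e2 > 0"
        "\<And>y. y \<in> carrier G \<Longrightarrow> \<forall>\<nu>\<in>F2. \<nu> (inv x \<otimes> y) < e2 \<Longrightarrow> y \<in> T"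
        using T x unfolding L_def by (metis IntD2)
      show ?thesis
        using 1 2 by (intro exI[of _ "F1 \<union> F2"] exI[of _ "min e1 e2"]) auto
    qed
    then show "L (S \<inter> T)" using S unfolding L_def by blast
  next
    fix K assume K: "\<forall>S\<in>K. L S"
    have "\<exists>F e. F \<subseteq> \<P> \<and> finite F \<and> e > 0 \<and>
        (\<forall>y\<in>carrier G. (\<forall>\<nu>\<in>F. \<nu> (inv x \<otimes> y) < e) \<longrightarrow> y \<in> \<Union>K)" if x: "x \<in> \<Union>K" for x
    proof -
      obtain S where S: "S \<in> K" "x \<in> S" using x by (rule UnionE)
      then obtain F e where "F \<subseteq> \<P>" "finite F" "e > 0"
        "\<forall>y\<in>carrier G. (\<forall>\<nu>\<in>F. \<nu> (inv x \<otimes> y) < e) \<longrightarrow> y \<in> S"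
        using K unfolding L_def by metis
      then show ?thesis using S(1) by (intro exI[of _ F] exI[of _ e]) auto
    qed
    moreover have "\<Union>K \<subseteq> carrier G" using K unfolding L_def by (simp add: Union_least)
    ultimately show "L (\<Union>K)" unfolding L_def by simp
  qed
  then have "openin (topology L) U \<longleftrightarrow> L U" by simp
  then show ?thesis unfolding pseudonorm_topology_def L_def .
qed

lemma topspace_pseudonorm_topology: "topspace (pseudonorm_topology \<P>) = carrier G"
proof (rule antisym)
  show "topspace (pseudonorm_topology \<P>) \<subseteq> carrier G"
    using openin_pseudonorm_topology[of \<P> "topspace (pseudonorm_topology \<P>)"] by simp
  have "openin (pseudonorm_topology \<P>) (carrier G)"
    unfolding openin_pseudonorm_topology by (auto intro!: exI[of _ "{}"] exI[of _ "1::real"])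
  then show "carrier G \<subseteq> topspace (pseudonorm_topology \<P>)" by (rule openin_subset)
qed

lemma finite_positive_lower_bound:
  fixes g :: "'i \<Rightarrow> real"
  assumes "finite F" "\<And>i. i \<in> F \<Longrightarrow> g i > 0"
  shows "\<exists>d>0. \<forall>i\<in>F. d \<le> g i"
  using assms
proof (induction F)
  case empty
  show ?case by (intro exI[of _ 1]) simp
next
  case (insert i F)
  then obtain d where "d > 0" "\<forall>i\<in>F. d \<le> g i" by auto
  then show ?case using insert by (intro exI[of _ "min d (g i)"]) auto
qed

lemma pseudonormD:
  assumes "pseudonorm_on H \<nu>"
  shows "\<nu> \<one> = 0" "x \<in> H \<Longrightarrow> \<nu> x \<ge> 0" "x \<in> H \<Longrightarrow> \<nu> (inv x) = \<nu> x"
    "x \<in> H \<Longrightarrow> y \<in> H \<Longrightarrow> \<nu> (x \<otimes> y) \<le> \<nu> x + \<nu> y"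
  using assms unfolding pseudonorm_on_def by auto

definition pball :: "'a \<Rightarrow> ('a \<Rightarrow> real) set \<Rightarrow> real \<Rightarrow> 'a set" where
  "pball x F e = {y \<in> carrier G. \<forall>\<nu>\<in>F. \<nu> (inv x \<otimes> y) < e}"

lemma openin_pball:
  assumes P: "\<And>\<nu>. \<nu> \<in> \<P> \<Longrightarrow> pseudonorm_on (carrier G) \<nu>" and F: "F \<subseteq> \<P>" "finite F"
    and x: "x \<in> carrier G"
  shows "openin (pseudonorm_topology \<P>) (pball x F e)"
  unfolding openin_pseudonorm_topology
proof (intro conjI ballI)
  show "pball x F e \<subseteq> carrier G" unfolding pball_def by blast
  fix y assume y: "y \<in> pball x F e"
  then have yG: "y \<in> carrier G" unfolding pball_def by blast
  obtain d where d: "d > 0" "\<forall>\<nu>\<in>F. d \<le> e - \<nu> (inv x \<otimes> y)"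
    using finite_positive_lower_bound[OF F(2), of "\<lambda>\<nu>. e - \<nu> (inv x \<otimes> y)"] y unfolding pball_def by auto
  have "z \<in> pball x F e" if z: "z \<in> carrier G" "\<forall>\<nu>\<in>F. \<nu> (inv y \<otimes> z) < d" for z
  proof -
    have "inv x \<otimes> z = (inv x \<otimes> y) \<otimes> (inv y \<otimes> z)"
      using x yG z(1) by (simp add: m_assoc) (simp add: m_assoc[symmetric])
    have "\<nu> (inv x \<otimes> z) < e" if \<nu>: "\<nu> \<in> F" for \<nu>
    proof -
      have "\<nu> ((inv x \<otimes> y) \<otimes> (inv y \<otimes> z)) \<le> \<nu> (inv x \<otimes> y) + \<nu> (inv y \<otimes> z)"
        using P \<nu> F(1) x yG z(1) by (intro pseudonormD(4)[of "carrier G"]) auto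
      moreover have "d \<le> e - \<nu> (inv x \<otimes> y)" "\<nu> (inv y \<otimes> z) < d" using d(2) z(2) \<nu> by auto
      ultimately show ?thesis using \<open>inv x \<otimes> z = _\<close> by simp
    qed
    then show ?thesis using z(1) unfolding pball_def by blast
  qed
  then show "\<exists>F' e'. F' \<subseteq> \<P> \<and> finite F' \<and> e' > 0 \<and>
      (\<forall>z\<in>carrier G. (\<forall>\<nu>\<in>F'. \<nu> (inv y \<otimes> z) < e') \<longrightarrow> z \<in> pball x F e)"
    using F d(1) by (intro exI[of _ F] exI[of _ d]) auto
qed

lemma centre_in_pball:
  assumes "\<And>\<nu>. \<nu> \<in> F \<Longrightarrow> pseudonorm_on (carrier G) \<nu>" "x \<in> carrier G" "e > 0"
  shows "x \<in> pball x F e"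
  using assms pseudonormD(1) unfolding pball_def by fastforce

lemma topological_abelian_group_pseudonorm:
  assumes P: "\<And>\<nu>. \<nu> \<in> \<P> \<Longrightarrow> pseudonorm_on (carrier G) \<nu>"
  shows "topological_abelian_group G (pseudonorm_topology \<P>)"
proof (intro topological_abelian_group.intro topological_abelian_group_axioms.intro comm_group_axioms)
  let ?T = "pseudonorm_topology \<P>"
  show "topspace ?T = carrier G" by (rule topspace_pseudonorm_topology)
  show "continuous_map (prod_topology ?T ?T) ?T (\<lambda>(x, y). x \<otimes> y)"
    unfolding continuous_map_def topspace_prod_topology topspace_pseudonorm_topology
  proof (intro conjI allI impI)
    show "(\<lambda>(x, y). x \<otimes> y) \<in> carrier G \<times> carrier G \<rightarrow> carrier G" by auto
    fix U assume U: "openin ?T U"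
    show "openin (prod_topology ?T ?T) {p \<in> carrier G \<times> carrier G. (case p of (x, y) \<Rightarrow> x \<otimes> y) \<in> U}"
      unfolding openin_prod_topology_alt
    proof (intro allI impI)
      fix x y assume "(x, y) \<in> {p \<in> carrier G \<times> carrier G. (case p of (x, y) \<Rightarrow> x \<otimes> y) \<in> U}"
      then have xy: "x \<in> carrier G" "y \<in> carrier G" "x \<otimes> y \<in> U" by auto
      obtain F e where F: "F \<subseteq> \<P>" "finite F" "e > 0"
        "\<And>z. z \<in> carrier G \<Longrightarrow> \<forall>\<nu>\<in>F. \<nu> (inv (x \<otimes> y) \<otimes> z) < e \<Longrightarrow> z \<in> U"
        using U xy(3) unfolding openin_pseudonorm_topology by metis
      have "a \<otimes> b \<in> U" if ab: "a \<in> pball x F (e / 2)" "b \<in> pball y F (e / 2)" for a b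
      proof (rule F(4))
        have car: "a \<in> carrier G" "b \<in> carrier G" using ab unfolding pball_def by auto
        then show "a \<otimes> b \<in> carrier G" by simp
        have eq: "inv (x \<otimes> y) \<otimes> (a \<otimes> b) = (inv x \<otimes> a) \<otimes> (inv y \<otimes> b)"
          using car xy by (simp add: inv_mult m_ac)
        show "\<forall>\<nu>\<in>F. \<nu> (inv (x \<otimes> y) \<otimes> (a \<otimes> b)) < e"
        proof
          fix \<nu> assume \<nu>: "\<nu> \<in> F"
          have "\<nu> ((inv x \<otimes> a) \<otimes> (inv y \<otimes> b)) \<le> \<nu> (inv x \<otimes> a) + \<nu> (inv y \<otimes> b)"
            using P \<nu> F(1) xy car by (intro pseudonormD(4)[of "carrier G"]) auto
          moreover have "\<nu> (inv x \<otimes> a) < e / 2" "\<nu> (inv y \<otimes> b) < e / 2"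
            using ab \<nu> unfolding pball_def by auto
          ultimately show "\<nu> (inv (x \<otimes> y) \<otimes> (a \<otimes> b)) < e" unfolding eq by simp
        qed
      qed
      then have "pball x F (e / 2) \<times> pball y F (e / 2)
          \<subseteq> {p \<in> carrier G \<times> carrier G. (case p of (x, y) \<Rightarrow> x \<otimes> y) \<in> U}"
        unfolding pball_def by auto
      moreover have "x \<in> pball x F (e / 2)" "y \<in> pball y F (e / 2)"
        using P F(1,3) xy by (auto intro!: centre_in_pball)
      ultimately show "\<exists>V W. openin ?T V \<and> openin ?T W \<and> x \<in> V \<and> y \<in> W \<and>
          V \<times> W \<subseteq> {p \<in> carrier G \<times> carrier G. (case p of (x, y) \<Rightarrow> x \<otimes> y) \<in> U}"
        using openin_pball[OF P F(1,2) xy(1)] openin_pball[OF P F(1,2) xy(2)] by meson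
    qed
  qed
  show "continuous_map ?T ?T (\<lambda>x. inv x)"
    unfolding continuous_map_def topspace_pseudonorm_topology
  proof (intro conjI allI impI)
    show "(\<lambda>x. inv x) \<in> carrier G \<rightarrow> carrier G" by auto
    fix U assume U: "openin ?T U"
    show "openin ?T {x \<in> carrier G. inv x \<in> U}"
      unfolding openin_pseudonorm_topology
    proof (intro conjI ballI)
      fix x assume "x \<in> {x \<in> carrier G. inv x \<in> U}"
      then have x: "x \<in> carrier G" "inv x \<in> U" by auto
      obtain F e where F: "F \<subseteq> \<P>" "finite F" "e > 0"
        "\<And>z. z \<in> carrier G \<Longrightarrow> \<forall>\<nu>\<in>F. \<nu> (inv (inv x) \<otimes> z) < e \<Longrightarrow> z \<in> U"
        using U x(2) unfolding openin_pseudonorm_topology by metis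
      have "inv y \<in> U" if y: "y \<in> carrier G" "\<forall>\<nu>\<in>F. \<nu> (inv x \<otimes> y) < e" for y
      proof (rule F(4))
        show "inv y \<in> carrier G" using y by simp
        have eq: "inv (inv x) \<otimes> inv y = inv (inv x \<otimes> y)" using x y by (simp add: inv_mult)
        show "\<forall>\<nu>\<in>F. \<nu> (inv (inv x) \<otimes> inv y) < e"
        proof
          fix \<nu> assume \<nu>: "\<nu> \<in> F"
          then have "pseudonorm_on (carrier G) \<nu>" using P F(1) by blast
          then have "\<nu> (inv (inv x \<otimes> y)) = \<nu> (inv x \<otimes> y)" by (rule pseudonormD(3)) (use x y in simp)
          then show "\<nu> (inv (inv x) \<otimes> inv y) < e" unfolding eq using y(2) \<nu> by simp
        qed
      qed
      then show "\<exists>F e. F \<subseteq> \<P> \<and> finite F \<and> e > 0 \<and>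
          (\<forall>y\<in>carrier G. (\<forall>\<nu>\<in>F. \<nu> (inv x \<otimes> y) < e) \<longrightarrow> y \<in> {x \<in> carrier G. inv x \<in> U})"
        using F(1-3) by (intro exI[of _ F] exI[of _ e]) auto
    qed auto
  qed
qed

lemma Hausdorff_pseudonorm:
  assumes P: "\<And>\<nu>. \<nu> \<in> \<P> \<Longrightarrow> pseudonorm_on (carrier G) \<nu>"
    and sep: "\<And>x. x \<in> carrier G \<Longrightarrow> \<forall>\<nu>\<in>\<P>. \<nu> x = 0 \<Longrightarrow> x = \<one>"
  shows "Hausdorff_space (pseudonorm_topology \<P>)"
  unfolding Hausdorff_space_def topspace_pseudonorm_topology
proof (intro allI impI)
  fix x y assume "x \<in> carrier G \<and> y \<in> carrier G \<and> x \<noteq> y"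
  then have xy: "x \<in> carrier G" "y \<in> carrier G" "x \<noteq> y" by auto
  define z where "z = inv x \<otimes> y"
  have zG: "z \<in> carrier G" using xy by (simp add: z_def)
  have "z \<noteq> \<one>"
  proof
    assume "z = \<one>"
    then have "x \<otimes> z = x" using xy by simp
    then show False using xy by (simp add: z_def m_assoc[symmetric])
  qed
  then obtain \<nu> where \<nu>: "\<nu> \<in> \<P>" "\<nu> z \<noteq> 0" using sep[OF zG] by blast
  define e where "e = \<nu> z / 2"
  have e: "e > 0" using \<nu> pseudonormD(2)[OF P[OF \<nu>(1)] zG] by (simp add: e_def)
  have "pball x {\<nu>} e \<inter> pball y {\<nu>} e = {}"
  proof (rule ccontr)
    assume "pball x {\<nu>} e \<inter> pball y {\<nu>} e \<noteq> {}"
    then obtain w where w: "w \<in> carrier G" "\<nu> (inv x \<otimes> w) < e" "\<nu> (inv y \<otimes> w) < e"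
      unfolding pball_def by auto
    have "inv (inv y \<otimes> w) = inv w \<otimes> y" using xy w(1) by (simp add: inv_mult_group)
    then have "z = (inv x \<otimes> w) \<otimes> inv (inv y \<otimes> w)"
      unfolding z_def using xy w(1) by (simp add: m_assoc) (simp add: m_assoc[symmetric])
    then have "\<nu> z \<le> \<nu> (inv x \<otimes> w) + \<nu> (inv (inv y \<otimes> w))"
      using pseudonormD(4)[OF P[OF \<nu>(1)]] xy w(1) by simp
    also have "\<nu> (inv (inv y \<otimes> w)) = \<nu> (inv y \<otimes> w)"
      using pseudonormD(3)[OF P[OF \<nu>(1)], of "inv y \<otimes> w"] xy w(1) by simp
    finally show False using w(2,3) by (simp add: e_def)
  qed
  moreover have "x \<in> pball x {\<nu>} e" "y \<in> pball y {\<nu>} e"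
    using P \<nu> e xy by (auto intro!: centre_in_pball)
  moreover have "openin (pseudonorm_topology \<P>) (pball x {\<nu>} e)" "openin (pseudonorm_topology \<P>) (pball y {\<nu>} e)"
    using \<nu>(1) xy by (auto intro!: openin_pball[OF P])
  ultimately show "\<exists>U V. openin (pseudonorm_topology \<P>) U \<and> openin (pseudonorm_topology \<P>) V \<and>
      x \<in> U \<and> y \<in> V \<and> disjnt U V"
    unfolding disjnt_def by blast
qed

text \<open>A coset-valued character becomes complex-valued through \<open>cis (2 * pi * t)\<close>
  for any representative \<open>t\<close>. Continuity at the identity yields the neighbourhood that
  \<open>char_free\<close> asks for, and the value 1 corresponds to the coset
  \<open>\<int>\<close>.\<close>

lemma minimally_almost_periodic_pseudonorm:
  assumes free: "char_free (carrier G) \<P>"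
  shows "minimally_almost_periodic G (pseudonorm_topology \<P>)"
  unfolding minimally_almost_periodic_def
proof (intro allI impI ballI)
  fix \<phi> x assume \<phi>: "character G (pseudonorm_topology \<P>) \<phi>" and x: "x \<in> carrier G"
  interpret circ: comm_group circle_group by (rule comm_group_circle_group)
  have hom: "\<phi> \<in> hom G circle_group" and cont: "continuous_map (pseudonorm_topology \<P>) circle_topology \<phi>"
    using \<phi> unfolding character_def by auto
  have \<phi>C: "\<phi> y \<in> carrier circle_group" if "y \<in> carrier G" for y using hom that by (auto simp: hom_def)
  have ne: "\<exists>t. t \<in> \<phi> y" if y: "y \<in> carrier G" for y
  proof -
    obtain r where "\<phi> y = circle_proj r" using \<phi>C[OF y] by (auto simp: carrier_circle_group)
    then have "r \<in> \<phi> y" by (simp add: mem_circle_proj)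
    then show ?thesis by blast
  qed
  define f where "f y = cis (2 * pi * (SOME t. t \<in> \<phi> y))" for y
  have f: "f y = cis (2 * pi * t)" if "y \<in> carrier G" "t \<in> \<phi> y" for y t
    unfolding f_def by (rule cis_circle_group[OF \<phi>C[OF that(1)] someI that(2)]) (rule that(2))
  have uc: "unitary_char G (carrier G) f"
    unfolding unitary_char_def
  proof (intro conjI ballI)
    show "cmod (f y) = 1" for y by (simp add: f_def)
    fix y z assume yz: "y \<in> carrier G" "z \<in> carrier G"
    obtain s t where st: "s \<in> \<phi> y" "t \<in> \<phi> z" using ne yz by blast
    have "\<phi> (y \<otimes> z) = \<phi> y <#>\<^bsub>real_group\<^esub> \<phi> z"
      using hom yz by (simp add: hom_def circle_group_def)
    then have "s + t \<in> \<phi> (y \<otimes> z)"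
      using st unfolding set_mult_def real_group_def by auto
    then show "f (y \<otimes> z) = f y * f z"
      using f[OF _ st(1)] f[OF _ st(2)] f[of "y \<otimes> z" "s + t"] yz by (simp add: cis_mult algebra_simps)
  qed
  let ?U = "{A \<in> carrier circle_group. \<forall>t\<in>A. cmod (cis (2 * pi * t) - 1) < 1 / 4}"
  have "openin (pseudonorm_topology \<P>) {y \<in> carrier G. \<phi> y \<in> ?U}"
    using openin_continuous_map_preimage[OF cont openin_circle_near_one]
    unfolding topspace_pseudonorm_topology .
  moreover have "\<phi> \<one> = \<int>"
    using hom_one[OF hom is_group circ.is_group] by (simp add: one_circle_group)
  then have "\<one> \<in> {y \<in> carrier G. \<phi> y \<in> ?U}"
    using \<phi>C[of \<one>] by (auto simp: cis_multiple_2pi)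
  ultimately have "\<exists>F e. F \<subseteq> \<P> \<and> finite F \<and> e > 0 \<and>
     (\<forall>y\<in>carrier G. (\<forall>\<nu>\<in>F. \<nu> (inv \<one> \<otimes> y) < e) \<longrightarrow> y \<in> {y \<in> carrier G. \<phi> y \<in> ?U})"
    unfolding openin_pseudonorm_topology by blast
  then obtain F e where F: "F \<subseteq> \<P>" "finite F" "e > 0"
    "\<And>y. y \<in> carrier G \<Longrightarrow> \<forall>\<nu>\<in>F. \<nu> (inv \<one> \<otimes> y) < e \<Longrightarrow> \<phi> y \<in> ?U" by auto
  have "f x = 1"
  proof (rule char_freeD[OF free uc F(1,2,3) _ x])
    fix y assume y: "y \<in> carrier G" "\<And>\<nu>. \<nu> \<in> F \<Longrightarrow> \<nu> y < e"
    then have "\<phi> y \<in> ?U" using F(4)[OF y(1)] by simp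
    moreover obtain t where "t \<in> \<phi> y" using ne[OF y(1)] by blast
    ultimately show "cmod (f y - 1) \<le> 1 / 4" using f[OF y(1)] by auto
  qed
  obtain r where r: "\<phi> x = circle_proj r" using \<phi>C[OF x] by (auto simp: carrier_circle_group)
  then have "r \<in> \<phi> x" by (simp add: mem_circle_proj)
  then have rZ: "r \<in> \<int>" using f[OF x] \<open>f x = 1\<close> cis_eq_one_imp_Ints by simp
  have "s \<in> circle_proj r \<longleftrightarrow> s \<in> \<int>" for s
    unfolding mem_circle_proj using rZ Ints_add[of "s - r" r] Ints_diff[of s r] by auto
  then show "\<phi> x = \<one>\<^bsub>circle_group\<^esub>"
    unfolding r one_circle_group by blast
qed


section \<open>Unbounded groups\<close>

lemma subgroup_pow_image: "subgroup H G \<Longrightarrow> subgroup ((\<lambda>x. x [^] (d::nat)) ` H) G"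
proof (rule subgroupI)
  assume H: "subgroup H G"
  note mem = subgroup.mem_carrier[OF H]
  show "(\<lambda>x. x [^] d) ` H \<subseteq> carrier G" using mem by auto
  show "(\<lambda>x. x [^] d) ` H \<noteq> {}" using subgroup.one_closed[OF H] by blast
  fix a b assume "a \<in> (\<lambda>x. x [^] d) ` H" "b \<in> (\<lambda>x. x [^] d) ` H"
  then obtain x y where xy: "x \<in> H" "y \<in> H" "a = x [^] d" "b = y [^] d" by blast
  have "inv a = (inv x) [^] d" "a \<otimes> b = (x \<otimes> y) [^] d"
    using xy mem by (simp_all add: nat_pow_inv pow_mult_distrib m_comm)
  then show "inv a \<in> (\<lambda>x. x [^] d) ` H" "a \<otimes> b \<in> (\<lambda>x. x [^] d) ` H"
    using xy H by (auto intro: subgroup.m_inv_closed subgroup.m_closed)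
qed

text \<open>The norms pulled back from the quotient vanish on \<open>H\<close>, so a character close
  to 1 on a neighbourhood is close to 1 on all of \<open>H\<close>. Hence it is trivial on
  \<open>H\<close>, for lack of small subgroups in the circle, and factors through the
  quotient.\<close>

lemma char_free_pullback:
  assumes H: "subgroup H G"
    and P: "\<And>\<nu>. \<nu> \<in> \<P> \<Longrightarrow> comm_group.pseudonorm_on (G Mod H) (carrier (G Mod H)) \<nu>"
    and free: "comm_group.char_free (G Mod H) (carrier (G Mod H)) \<P>"
    and fin: "finite {X \<in> carrier (G Mod H). \<forall>\<nu>\<in>\<P>. \<nu> X = 0}"
  defines "\<Q> \<equiv> (\<lambda>\<nu> x. \<nu> (H #> x)) ` \<P>"
  shows "\<And>\<nu>. \<nu> \<in> \<Q> \<Longrightarrow> pseudonorm_on (carrier G) \<nu>" "\<And>\<nu> h. \<nu> \<in> \<Q> \<Longrightarrow> h \<in> H \<Longrightarrow> \<nu> h = 0"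
    "char_free (carrier G) \<Q>" "finite ((\<lambda>x. H #> x) ` {x \<in> carrier G. \<forall>\<nu>\<in>\<Q>. \<nu> x = 0})"
proof -
  interpret Q: comm_group "G Mod H" by (rule abelian_FactGroup[OF H])
  interpret N: normal H G by (rule subgroup_imp_normal[OF H])
  have mult: "(H #> x) \<otimes>\<^bsub>G Mod H\<^esub> (H #> y) = H #> (x \<otimes> y)" if "x \<in> carrier G" "y \<in> carrier G" for x y
    using N.rcos_sum[OF that] by simp
  have car: "H #> x \<in> carrier (G Mod H)" if "x \<in> carrier G" for x
    using that by (auto simp: carrier_FactGroup)
  have inv: "inv\<^bsub>G Mod H\<^esub> (H #> x) = H #> inv x" if x: "x \<in> carrier G" for x
    using N.inv_FactGroup[OF car[OF x]] N.rcos_inv[OF x] by simp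
  have one: "H #> \<one> = \<one>\<^bsub>G Mod H\<^esub>" using coset_mult_one subgroup.subset[OF H] by simp
  have oneH: "H #> h = \<one>\<^bsub>G Mod H\<^esub>" if "h \<in> H" for h
    using coset_join2[OF subgroup.mem_carrier[OF H that] H that] by simp
  show "pseudonorm_on (carrier G) \<nu>" if \<nu>: "\<nu> \<in> \<Q>" for \<nu>
  proof -
    obtain \<mu> where \<mu>: "\<mu> \<in> \<P>" "\<nu> = (\<lambda>x. \<mu> (H #> x))" using \<nu> unfolding \<Q>_def by blast
    note Q.pseudonormD[OF P[OF \<mu>(1)]]
    then show ?thesis unfolding pseudonorm_on_def \<mu>(2) using car mult inv one by metis
  qed
  show "\<nu> h = 0" if \<nu>: "\<nu> \<in> \<Q>" and h: "h \<in> H" for \<nu> h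
  proof -
    obtain \<mu> where \<mu>: "\<mu> \<in> \<P>" "\<nu> = (\<lambda>x. \<mu> (H #> x))" using \<nu> unfolding \<Q>_def by blast
    show ?thesis unfolding \<mu>(2) oneH[OF h] by (rule Q.pseudonormD(1)[OF P[OF \<mu>(1)]])
  qed
  note zero = this
  show "char_free (carrier G) \<Q>"
  proof (rule char_freeI)
    fix f F e x
    assume f: "unitary_char G (carrier G) f" and F: "F \<subseteq> \<Q>" "finite F" and e: "(e::real) > 0"
      and small: "\<And>x. x \<in> carrier G \<Longrightarrow> (\<And>\<nu>. \<nu> \<in> F \<Longrightarrow> \<nu> x < e) \<Longrightarrow> cmod (f x - 1) \<le> 1 / 4"
      and x: "x \<in> carrier G"
    have fH: "f h = 1" if h: "h \<in> H" for h
    proof (rule unitary_char_trivial[OF H unitary_char_mono[OF f subgroup.subset[OF H]] _ h])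
      fix h assume h: "h \<in> H"
      have "\<nu> h < e" if "\<nu> \<in> F" for \<nu> using zero[of \<nu> h] that F(1) h e by auto
      then have "cmod (f h - 1) \<le> 1 / 4" using small subgroup.mem_carrier[OF H h] by blast
      then show "cmod (f h - 1) \<le> 1" by simp
    qed
    define g where "g X = f (SOME x. x \<in> carrier G \<and> X = H #> x)" for X
    have g: "g (H #> x) = f x" if x: "x \<in> carrier G" for x
    proof -
      define y where "y = (SOME y. y \<in> carrier G \<and> H #> x = H #> y)"
      have y: "y \<in> carrier G \<and> H #> x = H #> y"
        unfolding y_def by (rule someI[of _ x]) (use x in simp)
      then have "y \<in> H #> x" using rcos_self[OF _ H] by simp
      then obtain h where h: "h \<in> H" "y = h \<otimes> x" by (auto simp: r_coset_def)
      then have "f y = f h * f x" using f x subgroup.mem_carrier[OF H] unfolding unitary_char_def by blast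
      then show ?thesis unfolding g_def y_def[symmetric] using fH[OF h(1)] by simp
    qed
    have ug: "unitary_char (G Mod H) (carrier (G Mod H)) g"
      unfolding unitary_char_def
    proof (intro conjI ballI)
      fix X Y assume "X \<in> carrier (G Mod H)" "Y \<in> carrier (G Mod H)"
      then obtain x y where xy: "x \<in> carrier G" "y \<in> carrier G" "X = H #> x" "Y = H #> y"
        by (auto simp: carrier_FactGroup)
      have "g (X \<otimes>\<^bsub>G Mod H\<^esub> Y) = f (x \<otimes> y)" unfolding xy(3,4) mult[OF xy(1,2)] using g xy by simp
      then show "g (X \<otimes>\<^bsub>G Mod H\<^esub> Y) = g X * g Y" using f xy g unfolding unitary_char_def by simp
    next
      fix X assume "X \<in> carrier (G Mod H)"
      then obtain x where "x \<in> carrier G" "X = H #> x" by (auto simp: carrier_FactGroup)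
      then show "cmod (g X) = 1" using f g unfolding unitary_char_def by simp
    qed
    obtain F' where F': "F' \<subseteq> \<P>" "finite F'" "F = (\<lambda>\<nu> x. \<nu> (H #> x)) ` F'"
      using finite_subset_image[OF F(2)] F(1) unfolding \<Q>_def by metis
    have "g (H #> x) = 1"
    proof (rule Q.char_freeD[OF free ug F'(1,2) e _ car[OF x]])
      fix X assume X: "X \<in> carrier (G Mod H)" "\<And>\<nu>. \<nu> \<in> F' \<Longrightarrow> \<nu> X < e"
      then obtain y where y: "y \<in> carrier G" "X = H #> y" by (auto simp: carrier_FactGroup)
      have "\<nu> y < e" if "\<nu> \<in> F" for \<nu> using that X(2) y(2) unfolding F'(3) by auto
      then show "cmod (g X - 1) \<le> 1 / 4" using small[OF y(1)] g[OF y(1)] y(2) by simp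
    qed
    then show "f x = 1" using g[OF x] by simp
  qed
  show "finite ((\<lambda>x. H #> x) ` {x \<in> carrier G. \<forall>\<nu>\<in>\<Q>. \<nu> x = 0})"
    by (rule finite_subset[OF _ fin]) (auto simp: \<Q>_def car)
qed

lemma pseudonorm_kernel:
  assumes P: "\<And>\<nu>. \<nu> \<in> \<P> \<Longrightarrow> pseudonorm_on (carrier G) \<nu>"
  shows "subgroup {x \<in> carrier G. \<forall>\<nu>\<in>\<P>. \<nu> x = 0} G"
proof (rule subgroupI)
  show "{x \<in> carrier G. \<forall>\<nu>\<in>\<P>. \<nu> x = 0} \<noteq> {}" using pseudonormD(1)[OF P] by blast
  show "inv a \<in> {x \<in> carrier G. \<forall>\<nu>\<in>\<P>. \<nu> x = 0}" if "a \<in> {x \<in> carrier G. \<forall>\<nu>\<in>\<P>. \<nu> x = 0}" for a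
  proof -
    have "\<nu> (inv a) = 0" if \<nu>: "\<nu> \<in> \<P>" for \<nu>
      using \<open>a \<in> _\<close> \<nu> pseudonormD(3)[OF P[OF \<nu>], of a] by auto
    then show ?thesis using \<open>a \<in> _\<close> by simp
  qed
  show "a \<otimes> b \<in> {x \<in> carrier G. \<forall>\<nu>\<in>\<P>. \<nu> x = 0}"
    if ab: "a \<in> {x \<in> carrier G. \<forall>\<nu>\<in>\<P>. \<nu> x = 0}" "b \<in> {x \<in> carrier G. \<forall>\<nu>\<in>\<P>. \<nu> x = 0}" for a b
  proof -
    have "\<nu> (a \<otimes> b) = 0" if \<nu>: "\<nu> \<in> \<P>" for \<nu>
    proof -
      have "\<nu> (a \<otimes> b) \<le> \<nu> a + \<nu> b" using ab by (intro pseudonormD(4)[OF P[OF \<nu>]]) auto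
      moreover have "\<nu> (a \<otimes> b) \<ge> 0" using ab by (intro pseudonormD(2)[OF P[OF \<nu>]]) auto
      moreover have "\<nu> a = 0" "\<nu> b = 0" using ab \<nu> by auto
      ultimately show ?thesis by linarith
    qed
    then show ?thesis using ab by simp
  qed
qed auto

text \<open>Independence permits extending the embedding of one member trivially over the span of
  the others; divisibility of \<open>circle_fun\<close> then carries it to all of G.\<close>

lemma independent_embeddings:
  assumes ind: "independent_family \<C>" and emb: "\<And>A. A \<in> \<C> \<Longrightarrow> circle_embeddable A"
  shows "\<exists>J. \<forall>A\<in>\<C>. J A \<in> hom G circle_fun \<and> mean_dense A (J A) \<and>
    (\<forall>a\<in>A. J A a = \<one>\<^bsub>circle_fun\<^esub> \<longrightarrow> a = \<one>) \<and> (\<forall>B\<in>\<C>. B \<noteq> A \<longrightarrow> (\<forall>b\<in>B. J A b = \<one>\<^bsub>circle_fun\<^esub>))"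
proof -
  have sub: "\<And>A. A \<in> \<C> \<Longrightarrow> subgroup A G" using ind unfolding independent_family_def by blast
  define \<Phi> where "\<Phi> A J \<longleftrightarrow> J \<in> hom G circle_fun \<and> mean_dense A J \<and>
    (\<forall>a\<in>A. J a = \<one>\<^bsub>circle_fun\<^esub> \<longrightarrow> a = \<one>) \<and> (\<forall>B\<in>\<C>. B \<noteq> A \<longrightarrow> (\<forall>b\<in>B. J b = \<one>\<^bsub>circle_fun\<^esub>))" for A J
  have "\<exists>J. \<Phi> A J" if A: "A \<in> \<C>" for A
  proof -
    let ?D = "generate G (\<Union>(\<C> - {A}))"
    have sA: "subgroup A G" and sD: "subgroup ?D G" using sub A by (auto intro: subgroup_span)
    obtain j where j: "j \<in> hom (G\<lparr>carrier := A\<rparr>) circle_fun" "\<forall>a\<in>A. j a = \<one>\<^bsub>circle_fun\<^esub> \<longrightarrow> a = \<one>" "mean_dense A j"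
      using emb[OF A] unfolding circle_embeddable_def by blast
    have triv: "(\<lambda>_. \<one>\<^bsub>circle_fun\<^esub>) \<in> hom (G\<lparr>carrier := ?D\<rparr>) circle_fun" by (auto simp: hom_def)
    have agree: "j x = \<one>\<^bsub>circle_fun\<^esub>" if x: "x \<in> A" "x \<in> ?D" for x
    proof -
      have "x = \<one>" using x A ind unfolding independent_family_def by blast
      then show ?thesis using hom_eq_one[OF is_group CF.is_group sA j(1)] by simp
    qed
    obtain \<theta> where \<theta>: "\<theta> \<in> hom (G\<lparr>carrier := A <#> ?D\<rparr>) circle_fun"
      "\<And>a. a \<in> A \<Longrightarrow> \<theta> a = j a" "\<And>b. b \<in> ?D \<Longrightarrow> \<theta> b = \<one>\<^bsub>circle_fun\<^esub>"
      using hom_glue[OF sA sD comm_group_circle_fun j(1) triv agree] by blast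
    obtain J where J: "J \<in> hom G circle_fun" "\<And>h. h \<in> A <#> ?D \<Longrightarrow> J h = \<theta> h"
      using hom_extend[OF mult_subgroups[OF sA sD] comm_group_circle_fun \<theta>(1) divisible_circle_fun] by blast
    note inc = set_mult_incl[OF sA sD]
    have JA: "J a = j a" if "a \<in> A" for a using J(2) \<theta>(2) inc that by auto
    have "J b = \<one>\<^bsub>circle_fun\<^esub>" if "B \<in> \<C>" "B \<noteq> A" "b \<in> B" for B b
    proof -
      have "b \<in> ?D" using that by (auto intro: generate.incl)
      then show ?thesis using J(2) \<theta>(3) inc by auto
    qed
    moreover have "mean_dense A J" using j(3) JA unfolding mean_dense_def by simp
    ultimately have "\<Phi> A J" unfolding \<Phi>_def using J(1) JA j(2) by auto
    then show ?thesis by blast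
  qed
  then obtain J where "\<And>A. A \<in> \<C> \<Longrightarrow> \<Phi> A (J A)" by metis
  then show ?thesis unfolding \<Phi>_def by blast
qed

lemma finite_if_finite_cosets:
  assumes W: "subgroup W G" and H: "subgroup H G" and fin: "finite (W \<inter> H)" "finite ((\<lambda>x. H #> x) ` W)"
  shows "finite W"
proof -
  have "finite {w \<in> W. H #> w = X}" if X: "X \<in> (\<lambda>x. H #> x) ` W" for X
  proof -
    obtain v where v: "v \<in> W" "X = H #> v" using X by (rule imageE)
    have vG: "v \<in> carrier G" using W v(1) by (rule subgroup.mem_carrier)
    have "{w \<in> W. H #> w = X} \<subseteq> (\<lambda>h. h \<otimes> v) ` (W \<inter> H)"
    proof
      fix w assume w: "w \<in> {w \<in> W. H #> w = X}"
      then have wG: "w \<in> carrier G" using subgroup.mem_carrier[OF W] by blast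
      have "w \<in> H #> v" using rcos_self[OF wG H] w v(2) by simp
      then obtain h where h: "h \<in> H" "w = h \<otimes> v" by (auto simp: r_coset_def)
      have "h = w \<otimes> inv v" using h vG subgroup.mem_carrier[OF H] by (simp add: m_assoc)
      then have "h \<in> W" using w v(1) W by (simp add: subgroup.m_closed subgroup.m_inv_closed)
      then show "w \<in> (\<lambda>h. h \<otimes> v) ` (W \<inter> H)" using h by blast
    qed
    then show ?thesis using fin(1) by (rule finite_subset[OF _ finite_imageI])
  qed
  then have "finite (\<Union>X\<in>(\<lambda>x. H #> x) ` W. {w \<in> W. H #> w = X})" using fin(2) by (rule finite_UN_I[rotated])
  moreover have "(\<Union>X\<in>(\<lambda>x. H #> x) ` W. {w \<in> W. H #> w = X}) = W" by blast
  ultimately show ?thesis by simp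
qed

text \<open>The group \<open>D A\<close> of \<open>d\<close>-th powers is invisible to
  \<open>\<Q>\<close> and to the embeddings of the other members, yet dense for \<open>J A\<close>;
  so \<open>f\<close> is trivial on it. An element small for \<open>\<Q>\<close> can be multiplied
  by such elements until the embeddings occurring in \<open>F\<close> are small as well, without
  changing \<open>f\<close>. Thus smallness for \<open>\<Q>\<close> alone controls
  \<open>f\<close>.\<close>

lemma char_free_union:
  assumes d: "d > (0::nat)" and ind: "independent_family \<C>"
    and J: "\<And>A. A \<in> \<C> \<Longrightarrow> J A \<in> hom G circle_fun" "\<And>A. A \<in> \<C> \<Longrightarrow> mean_dense A (J A)"
      "\<And>A B b. A \<in> \<C> \<Longrightarrow> B \<in> \<C> \<Longrightarrow> A \<noteq> B \<Longrightarrow> b \<in> B \<Longrightarrow> J A b = \<one>\<^bsub>circle_fun\<^esub>"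
    and Q: "\<And>\<nu>. \<nu> \<in> \<Q> \<Longrightarrow> pseudonorm_on (carrier G) \<nu>" "\<And>\<nu> x. \<nu> \<in> \<Q> \<Longrightarrow> x \<in> carrier G \<Longrightarrow> \<nu> (x [^] d) = 0"
      "char_free (carrier G) \<Q>"
  shows "char_free (carrier G) (\<Q> \<union> (\<lambda>A x. mean (J A x)) ` \<C>)"
proof (rule char_freeI)
  fix f F e x
  assume f: "unitary_char G (carrier G) f" and F: "F \<subseteq> \<Q> \<union> (\<lambda>A x. mean (J A x)) ` \<C>" "finite F" and e: "(e::real) > 0"
    and small: "\<And>x. x \<in> carrier G \<Longrightarrow> (\<And>\<nu>. \<nu> \<in> F \<Longrightarrow> \<nu> x < e) \<Longrightarrow> cmod (f x - 1) \<le> 1 / 4"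
    and x: "x \<in> carrier G"
  have sub: "\<And>A. A \<in> \<C> \<Longrightarrow> subgroup A G" using ind unfolding independent_family_def by blast
  have JC: "J A y \<in> carrier circle_fun" if "A \<in> \<C>" "y \<in> carrier G" for A y
    using J(1)[OF that(1)] that(2) by (auto simp: hom_def)
  have Jm: "J A (y \<otimes> z) = J A y \<otimes>\<^bsub>circle_fun\<^esub> J A z" if "A \<in> \<C>" "y \<in> carrier G" "z \<in> carrier G" for A y z
    using J(1)[OF that(1)] that by (auto simp: hom_def)
  have J1: "J A \<one> = \<one>\<^bsub>circle_fun\<^esub>" if "A \<in> \<C>" for A
    using hom_one[OF J(1)[OF that] is_group CF.is_group] .
  have Jon: "J A \<in> hom (G\<lparr>carrier := B\<rparr>) circle_fun" if "A \<in> \<C>" "subgroup B G" for A B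
    using J(1)[OF that(1)] subgroup.mem_carrier[OF that(2)] by (auto simp: hom_def)
  define D where "D A = (\<lambda>a. a [^] d) ` A" for A
  have sD: "subgroup (D A) G" if "A \<in> \<C>" for A unfolding D_def by (rule subgroup_pow_image[OF sub[OF that]])
  have DA: "D A \<subseteq> A" if "A \<in> \<C>" for A
    unfolding D_def using subgroup_pow_closed[OF sub[OF that]] by blast
  have denseD: "mean_dense (D A) (J A)" if "A \<in> \<C>" for A
    unfolding D_def by (rule mean_dense_pow[OF sub[OF that] Jon[OF that sub[OF that]] J(2)[OF that] d])
  have QD: "\<nu> a = 0" if "\<nu> \<in> \<Q>" "A \<in> \<C>" "a \<in> D A" for \<nu> a A
    using that Q(2)[OF that(1)] subgroup.mem_carrier[OF sub[OF that(2)]] unfolding D_def by blast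
  have fD: "f a = 1" if A: "A \<in> \<C>" and a: "a \<in> D A" for A a
  proof (rule unitary_char_trivial_of_mean_dense[OF sD[OF A] Jon[OF A sD[OF A]] denseD[OF A]
        unitary_char_mono[OF f subgroup.subset[OF sD[OF A]]] e _ a])
    fix y assume y: "y \<in> D A" "mean (J A y) < e"
    have "\<nu> y < e" if \<nu>: "\<nu> \<in> F" for \<nu>
    proof (cases "\<nu> \<in> \<Q>")
      case True
      then show ?thesis using QD[OF True A y(1)] e by simp
    next
      case False
      then obtain B where B: "B \<in> \<C>" "\<nu> = (\<lambda>x. mean (J B x))" using \<nu> F(1) by blast
      show ?thesis
      proof (cases "B = A")
        case True
        then show ?thesis using y(2) B(2) by simp
      next
        case False
        then have "J B y = \<one>\<^bsub>circle_fun\<^esub>" using J(3)[OF B(1) A False] y(1) DA[OF A] by blast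
        then show ?thesis using B(2) e by (simp add: one_circle_fun mean_one)
      qed
    qed
    then show "cmod (f y - 1) \<le> 1 / 4" using small subgroup.mem_carrier[OF sD[OF A] y(1)] by blast
  qed
  \<comment> \<open>The correction \<open>c\<close> is built one member at a time. The factor added
    for \<open>A\<close> changes no other embedding, so earlier approximations persist, and
    \<open>J A\<close> is still trivial on \<open>c\<close> when the turn of \<open>A\<close>
    comes.\<close>
  have approx: "\<exists>c. c \<in> (\<lambda>g. g [^] d) ` carrier G \<and> f c = 1 \<and> (\<forall>A\<in>\<D>. mdist (J A c) (J A x) < e) \<and>
      (\<forall>A\<in>\<C> - \<D>. J A c = \<one>\<^bsub>circle_fun\<^esub>)" if x: "x \<in> carrier G" and \<D>: "finite \<D>" "\<D> \<subseteq> \<C>" for x \<D>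
    using \<D>
  proof (induction \<D>)
    case empty
    have "\<one> \<in> (\<lambda>g. g [^] d) ` carrier G" by (rule image_eqI[of _ _ \<one>]) auto
    moreover have "f \<one> = 1" by (rule unitary_char_one[OF subgroup_self f])
    ultimately show ?case using J1 by (intro exI[of _ \<one>]) auto
  next
    case (insert A \<D>)
    then obtain c where c: "c \<in> (\<lambda>g. g [^] d) ` carrier G" "f c = 1" "\<forall>A\<in>\<D>. mdist (J A c) (J A x) < e"
      "\<forall>A\<in>\<C> - \<D>. J A c = \<one>\<^bsub>circle_fun\<^esub>" by auto
    have A: "A \<in> \<C>" using insert.prems by simp
    obtain a where a: "a \<in> D A" "mdist (J A a) (J A x) < e"
      using denseD[OF A] JC[OF A x] e unfolding mean_dense_def by blast
    note sG = subgroup_pow_image[OF subgroup_self, of d]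
    have cG: "c \<in> carrier G" using sG c(1) by (rule subgroup.mem_carrier)
    have aG: "a \<in> carrier G" using sD[OF A] a(1) by (rule subgroup.mem_carrier)
    have "a \<in> (\<lambda>g. g [^] d) ` carrier G" using a(1) subgroup.mem_carrier[OF sub[OF A]] unfolding D_def by blast
    then have 1: "c \<otimes> a \<in> (\<lambda>g. g [^] d) ` carrier G" by (rule subgroup.m_closed[OF sG c(1)])
    have 2: "f (c \<otimes> a) = 1"
      using f cG aG c(2) fD[OF A a(1)] unfolding unitary_char_def by simp
    have JA: "J A (c \<otimes> a) = J A a" using Jm[OF A cG aG] c(4) A insert.hyps JC[OF A aG] by simp
    have JB: "J B (c \<otimes> a) = J B c" if "B \<in> \<C>" "B \<noteq> A" for B
      using Jm[OF that(1) cG aG] J(3)[OF that(1) A that(2)] a(1) DA[OF A] JC[OF that(1) cG] by auto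
    have "\<forall>B\<in>insert A \<D>. mdist (J B (c \<otimes> a)) (J B x) < e"
      using JA JB a(2) c(3) insert.prems by (metis insert_iff insert_subset subsetD)
    moreover have "\<forall>B\<in>\<C> - insert A \<D>. J B (c \<otimes> a) = \<one>\<^bsub>circle_fun\<^esub>"
      using JB c(4) by auto
    ultimately show ?case using 1 2 by blast
  qed
  obtain \<D> where \<D>: "\<D> \<subseteq> \<C>" "finite \<D>" "F - \<Q> = (\<lambda>A x. mean (J A x)) ` \<D>"
  proof -
    have "F - \<Q> \<subseteq> (\<lambda>A x. mean (J A x)) ` \<C>" using F(1) by blast
    then show ?thesis using finite_subset_image[of "F - \<Q>"] F(2) that by (metis finite_Diff)
  qed
  show "f x = 1"
  proof (rule char_freeD[OF Q(3) f, of "F \<inter> \<Q>" e])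
    fix x assume x: "x \<in> carrier G" "\<And>\<nu>. \<nu> \<in> F \<inter> \<Q> \<Longrightarrow> \<nu> x < e"
    obtain c where c: "c \<in> (\<lambda>g. g [^] d) ` carrier G" "f c = 1" "\<forall>A\<in>\<D>. mdist (J A c) (J A x) < e"
      using approx[OF x(1) \<D>(2,1)] by blast
    obtain g where g: "g \<in> carrier G" "c = g [^] d" using c(1) by blast
    have cG: "c \<in> carrier G" using g by simp
    \<comment> \<open>\<open>f\<close> takes the same value at \<open>z\<close> and at
      \<open>x\<close>, but \<open>z\<close> is small for every norm in \<open>F\<close>.\<close>
    define z where "z = x \<otimes> inv c"
    have zG: "z \<in> carrier G" using x cG by (simp add: z_def)
    have xz: "x = z \<otimes> c" using x cG by (simp add: z_def m_assoc)
    have "\<nu> z < e" if \<nu>: "\<nu> \<in> F" for \<nu>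
    proof (cases "\<nu> \<in> \<Q>")
      case True
      have "\<nu> z \<le> \<nu> x + \<nu> (inv c)"
        unfolding z_def by (rule pseudonormD(4)[OF Q(1)[OF True]]) (use x cG in auto)
      also have "\<nu> (inv c) = 0"
        using pseudonormD(3)[OF Q(1)[OF True] cG] Q(2)[OF True g(1)] g(2) by simp
      finally show ?thesis using x(2)[of \<nu>] True \<nu> by simp
    next
      case False
      then have "\<nu> \<in> (\<lambda>A x. mean (J A x)) ` \<D>" using \<nu> \<D>(3) by blast
      then obtain A where A: "A \<in> \<D>" "\<nu> = (\<lambda>x. mean (J A x))" by blast
      have AC: "A \<in> \<C>" using A(1) \<D>(1) by blast
      have "J A x = J A z \<otimes>\<^bsub>circle_fun\<^esub> J A c" using Jm[OF AC zG cG] xz by simp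
      then have "mdist (J A x) (J A c) = mean (J A z)"
        using JC[OF AC zG] JC[OF AC cG] by (simp add: mdist_def CF.m_assoc)
      then show ?thesis
        using c(3) A mdist_commute[OF JC[OF AC x(1)] JC[OF AC cG]] by auto
    qed
    then have "cmod (f z - 1) \<le> 1 / 4" using small zG by blast
    moreover have "f x = f z * f c" using f zG cG xz unfolding unitary_char_def by blast
    ultimately show "cmod (f x - 1) \<le> 1 / 4" using c(2) by simp
  qed (use F e x in auto)
qed


text \<open>A torsion group stays countable, torsion and unbounded when a finite group is added, and
  the cyclic case has an embedding of its own. So one member of the family can take over a finite
  leftover.\<close>

lemma circle_embeddable_absorb:
  assumes A: "subgroup A G" "torsion_unbounded A \<or> infinite_cyclic A"
    and W: "subgroup W G" "finite W" "A \<inter> W \<subseteq> {\<one>}"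
  shows "circle_embeddable (A <#> W)"
  using A(2)
proof
  assume "infinite_cyclic A"
  then obtain x where "x \<in> carrier G" "\<And>n::nat. n > 0 \<Longrightarrow> x [^] n \<noteq> \<one>" "A = generate G {x}"
    unfolding infinite_cyclic_def by blast
  then show ?thesis using circle_embeddable_cyclic[of x W] W by simp
next
  assume tu: "torsion_unbounded A"
  note inc = set_mult_incl[OF A(1) W(1)]
  show ?thesis
  proof (rule circle_embeddable_torsion)
    show "subgroup (A <#> W) G" by (rule mult_subgroups[OF A(1) W(1)])
    have "A <#> W = (\<lambda>(a, w). a \<otimes> w) ` (A \<times> W)" by (auto simp: set_mult_def)
    moreover have "countable (A \<times> W)"
      using tu W(2) unfolding torsion_unbounded_def by (simp add: countable_finite)
    ultimately show "countable (A <#> W)" by simp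
    show "\<exists>n>0. x [^] (n::nat) = \<one>" if x: "x \<in> A <#> W" for x
    proof -
      obtain a w where aw: "a \<in> A" "w \<in> W" "x = a \<otimes> w" using x by (auto simp: mem_set_mult)
      have car: "a \<in> carrier G" "w \<in> carrier G"
        using aw A(1) W(1) by (auto dest: subgroup.mem_carrier)
      obtain n :: nat where n: "n > 0" "a [^] n = \<one>"
        using tu aw(1) unfolding torsion_unbounded_def by blast
      have cW: "card W > 0" using W(2) aw(2) by (auto simp: card_gt_0_iff)
      have "a [^] (n * card W) = \<one>" using n car by (simp flip: nat_pow_pow)
      moreover have "w [^] (card W * n) = \<one>"
        using finite_subgroup_exponent[OF W(1,2) aw(2)] car by (simp flip: nat_pow_pow)
      ultimately have "x [^] (n * card W) = \<one>"
        using car by (simp add: aw(3) pow_mult_distrib m_comm mult.commute)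
      then show ?thesis using n(1) cW by (intro exI[of _ "n * card W"]) simp
    qed
    show "\<exists>x\<in>A <#> W. x [^] n \<noteq> \<one>" if "n > 0" for n :: nat
      using tu that inc(1) unfolding torsion_unbounded_def by blast
  qed
qed

lemma circle_embeddable_good:
  assumes "subgroup A G" "torsion_unbounded A \<or> infinite_cyclic A"
  shows "circle_embeddable A"
proof -
  have "A <#> {\<one>} = A" using subgroup.mem_carrier[OF assms(1)] by (auto simp: mem_set_mult)
  then show ?thesis using circle_embeddable_absorb[OF assms triv_subgroup] by simp
qed

lemma char_free_family_exists:
  assumes unb: "\<not> bounded_group G"
  shows "\<exists>\<P>. (\<forall>\<nu>\<in>\<P>. pseudonorm_on (carrier G) \<nu>) \<and> char_free (carrier G) \<P> \<and>
    (\<forall>x\<in>carrier G. (\<forall>\<nu>\<in>\<P>. \<nu> x = 0) \<longrightarrow> x = \<one>)"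
proof -
  define good where "good A \<longleftrightarrow> torsion_unbounded A \<or> infinite_cyclic A" for A
  obtain \<C> where \<C>: "independent_family \<C>" "\<And>A. A \<in> \<C> \<Longrightarrow> good A"
    "\<And>M. subgroup M G \<Longrightarrow> good M \<Longrightarrow> M \<inter> generate G (\<Union>\<C>) \<subseteq> {\<one>} \<Longrightarrow> M \<subseteq> {\<one>}"
    using maximal_independent_family[of good] by metis
  have sub: "\<And>A. A \<in> \<C> \<Longrightarrow> subgroup A G" using \<C>(1) unfolding independent_family_def by blast
  define C where "C = generate G (\<Union>\<C>)"
  have sC: "subgroup C G" unfolding C_def using sub by (rule subgroup_span)
  have max: "M \<subseteq> {\<one>}" if "subgroup M G" "torsion_unbounded M \<or> infinite_cyclic M" "M \<inter> C \<subseteq> {\<one>}" for M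
    using \<C>(3)[of M] that unfolding good_def C_def by blast
  \<comment> \<open>Unboundedness of G enters here: with an empty family \<open>C\<close> would be
    trivial, and maximality would bound the exponent of the whole group.\<close>
  have "\<C> \<noteq> {}"
  proof
    assume "\<C> = {}"
    then have "C = {\<one>}" unfolding C_def by (simp add: generate_empty)
    then obtain e :: nat where e: "e > 0" "\<forall>w\<in>carrier G. w [^] e = \<one>"
      using bounded_of_maximal[OF max subgroup_self] by blast
    then have "(\<lambda>g. g [^] e) ` carrier G = {\<one>}" by (auto intro!: image_eqI[of _ _ \<one>])
    then show False using unb e(1) unfolding bounded_group_def by (metis Suc_leI One_nat_def)
  qed
  then obtain A0 where A0: "A0 \<in> \<C>" by blast
  obtain d :: nat where d: "d > 0"
    "\<And>W. subgroup W G \<Longrightarrow> W \<subseteq> (\<lambda>g. g [^] d) ` carrier G \<Longrightarrow> W \<inter> C \<subseteq> {\<one>} \<Longrightarrow> finite W"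
    using finite_disjoint_of_maximal[OF sC max] by blast
  define H where "H = (\<lambda>g. g [^] d) ` carrier G"
  have sH: "subgroup H G" unfolding H_def by (rule subgroup_pow_image[OF subgroup_self])
  interpret Q: comm_group "G Mod H" by (rule abelian_FactGroup[OF sH])
  interpret N: normal H G by (rule subgroup_imp_normal[OF sH])
  have "X [^]\<^bsub>G Mod H\<^esub> d = \<one>\<^bsub>G Mod H\<^esub>" if X: "X \<in> carrier (G Mod H)" for X
  proof -
    obtain x where x: "x \<in> carrier G" "X = H #> x" using X by (auto simp: carrier_FactGroup)
    have "X [^]\<^bsub>G Mod H\<^esub> d = H #> (x [^] d)" unfolding x(2) by (rule N.FactGroup_pow[OF x(1)])
    moreover have "x [^] d \<in> H" unfolding H_def using x(1) by blast
    ultimately show ?thesis using coset_join2[OF _ sH] x(1) by simp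
  qed
  then obtain \<P>0 where \<P>0: "\<forall>\<nu>\<in>\<P>0. Q.pseudonorm_on (carrier (G Mod H)) \<nu>" "Q.char_free (carrier (G Mod H)) \<P>0"
    "finite {X \<in> carrier (G Mod H). \<forall>\<nu>\<in>\<P>0. \<nu> X = 0}"
    using Q.bounded_char_free[OF d(1) Q.subgroup_self] by blast
  define \<Q> where "\<Q> = (\<lambda>\<nu> x. \<nu> (H #> x)) ` \<P>0"
  have Q: "\<And>\<nu>. \<nu> \<in> \<Q> \<Longrightarrow> pseudonorm_on (carrier G) \<nu>" "\<And>\<nu> h. \<nu> \<in> \<Q> \<Longrightarrow> h \<in> H \<Longrightarrow> \<nu> h = 0"
    "char_free (carrier G) \<Q>" "finite ((\<lambda>x. H #> x) ` {x \<in> carrier G. \<forall>\<nu>\<in>\<Q>. \<nu> x = 0})"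
    unfolding \<Q>_def
    using char_free_pullback[OF sH _ \<P>0(2,3)] \<P>0(1) by blast+
  \<comment> \<open>The elements that the norms from the quotient do not see. They fall into
    finitely many cosets of \<open>H\<close>.\<close>
  define P where "P = {x \<in> carrier G. \<forall>\<nu>\<in>\<Q>. \<nu> x = 0}"
  have sP: "subgroup P G" unfolding P_def by (rule pseudonorm_kernel[OF Q(1)])
  obtain W where W: "subgroup W G" "W \<subseteq> P" "W \<inter> C \<subseteq> {\<one>}"
    "\<And>V. subgroup V G \<Longrightarrow> V \<subseteq> P \<Longrightarrow> V \<inter> C \<subseteq> {\<one>} \<Longrightarrow> W \<subseteq> V \<Longrightarrow> V = W"
    using maximal_disjoint_subgroup[OF sC sP] by metis
  \<comment> \<open>The part of \<open>W\<close> inside \<open>H\<close> is finite by the choice of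
    \<open>d\<close>, and \<open>W\<close> meets only finitely many cosets of \<open>H\<close> since
    it lies in \<open>P\<close>.\<close>
  have finW: "finite W"
  proof (rule finite_if_finite_cosets[OF W(1) sH])
    show "finite (W \<inter> H)"
      using W(3) by (intro d(2) subgroups_Inter_pair[OF W(1) sH]) (auto simp: H_def)
    show "finite ((\<lambda>x. H #> x) ` W)"
      using Q(4) W(2) unfolding P_def[symmetric] by (meson finite_subset image_mono)
  qed
  \<comment> \<open>\<open>W\<close> is the leftover on which neither the quotient norms nor the
    given family need separate points. Merged into \<open>A0\<close>, it comes under an injective
    embedding.\<close>
  define \<C>' where "\<C>' = insert (A0 <#> W) (\<C> - {A0})"
  define R where "R = generate G (\<Union>(\<C> - {A0}))"
  have sR: "subgroup R G" unfolding R_def using sub by (intro subgroup_span) auto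
  have sA0: "subgroup A0 G" by (rule sub[OF A0])
  note incAW = set_mult_incl[OF sA0 W(1)]
  have RC: "R \<subseteq> C" unfolding R_def C_def by (rule mono_generate) blast
  have A0C: "A0 \<subseteq> C" unfolding C_def using A0 by (auto intro: generate.incl)
  have "(A0 <#> W) \<inter> R \<subseteq> {\<one>}"
  proof
    fix x assume x: "x \<in> (A0 <#> W) \<inter> R"
    then obtain a w where aw: "a \<in> A0" "w \<in> W" "x = a \<otimes> w" by (auto simp: mem_set_mult)
    have car: "a \<in> carrier G" "w \<in> carrier G" using aw sA0 W(1) by (auto dest: subgroup.mem_carrier)
    have "w = inv a \<otimes> x" using car by (simp add: aw(3) m_assoc[symmetric])
    moreover have "inv a \<otimes> x \<in> C"
      using aw(1) x A0C RC by (intro subgroup.m_closed[OF sC] subgroup.m_inv_closed[OF sC]) auto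
    ultimately have "w = \<one>" using W(3) aw(2) by blast
    then have "x \<in> A0" using aw car by simp
    then show "x \<in> {\<one>}" using x A0 \<C>(1) unfolding R_def independent_family_def by blast
  qed
  then have ind': "independent_family \<C>'"
    unfolding \<C>'_def R_def
    by (intro independent_insert independent_subset[OF \<C>(1)] mult_subgroups[OF sA0 W(1)]) auto
  have "A0 \<inter> W \<subseteq> {\<one>}" using W(3) A0C by blast
  then have emb: "circle_embeddable A" if "A \<in> \<C>'" for A
    using that circle_embeddable_absorb[OF sA0 _ W(1) finW] circle_embeddable_good[OF sub] \<C>(2) A0
    unfolding \<C>'_def good_def by auto
  have sub': "\<And>A. A \<in> \<C>' \<Longrightarrow> subgroup A G" using ind' unfolding independent_family_def by blast
  define C' where "C' = generate G (\<Union>\<C>')"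
  have sC': "subgroup C' G" unfolding C'_def using sub' by (rule subgroup_span)
  have memC': "A \<subseteq> C'" if "A \<in> \<C>'" for A unfolding C'_def using that by (auto intro: generate.incl)
  have AWC': "A0 <#> W \<subseteq> C'" by (rule memC') (simp add: \<C>'_def)
  have WC': "W \<subseteq> C'" using AWC' incAW(2) by blast
  have CC': "C \<subseteq> C'"
    unfolding C_def
  proof (rule generate_subgroup_incl[OF _ sC'])
    have "A \<subseteq> C'" if "A \<in> \<C>" for A
    proof (cases "A = A0")
      case True
      then show ?thesis using AWC' incAW(1) by blast
    next
      case False
      then show ?thesis using that by (intro memC') (simp add: \<C>'_def)
    qed
    then show "\<Union>\<C> \<subseteq> C'" by blast
  qed
  \<comment> \<open>If \<open>V\<close> meets \<open>C'\<close> trivially, then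
    \<open>V <#> W\<close> still meets \<open>C\<close> trivially, so by maximality it equals
    \<open>W\<close>, which lies in \<open>C'\<close>.\<close>
  have essential: "V \<subseteq> {\<one>}" if V: "subgroup V G" "V \<subseteq> P" "V \<inter> C' \<subseteq> {\<one>}" for V
  proof -
    note inc = set_mult_incl[OF V(1) W(1)]
    have "(V <#> W) \<inter> C \<subseteq> {\<one>}"
    proof
      fix x assume x: "x \<in> (V <#> W) \<inter> C"
      then obtain v w where vw: "v \<in> V" "w \<in> W" "x = v \<otimes> w" by (auto simp: mem_set_mult)
      have car: "v \<in> carrier G" "w \<in> carrier G" using vw V(1) W(1) by (auto dest: subgroup.mem_carrier)
      have "v = x \<otimes> inv w" using car by (simp add: vw(3) m_assoc)
      moreover have "x \<otimes> inv w \<in> C'"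
        using x vw(2) CC' WC' by (intro subgroup.m_closed[OF sC'] subgroup.m_inv_closed[OF sC']) auto
      ultimately have "v = \<one>" using V(3) vw(1) by blast
      then have "x \<in> W" using vw car by simp
      then show "x \<in> {\<one>}" using x W(3) by blast
    qed
    then have "V <#> W = W"
      using W(2) V(2) inc(2) by (intro W(4) mult_subgroups[OF V(1) W(1)] set_mult_least[OF sP])
    then have "V \<subseteq> C'" using inc(1) WC' by blast
    then show ?thesis using V(3) by blast
  qed
  obtain J where allJ: "\<forall>A\<in>\<C>'. J A \<in> hom G circle_fun \<and> mean_dense A (J A) \<and>
    (\<forall>a\<in>A. J A a = \<one>\<^bsub>circle_fun\<^esub> \<longrightarrow> a = \<one>) \<and> (\<forall>B\<in>\<C>'. B \<noteq> A \<longrightarrow> (\<forall>b\<in>B. J A b = \<one>\<^bsub>circle_fun\<^esub>))"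
    using independent_embeddings[OF ind' emb] by (rule exE)
  have J: "J A \<in> hom G circle_fun" "mean_dense A (J A)" if "A \<in> \<C>'" for A using allJ that by auto
  have Jinj: "a = \<one>" if "A \<in> \<C>'" "a \<in> A" "J A a = \<one>\<^bsub>circle_fun\<^esub>" for A a using allJ that by blast
  have Jtriv: "J A b = \<one>\<^bsub>circle_fun\<^esub>" if "A \<in> \<C>'" "B \<in> \<C>'" "A \<noteq> B" "b \<in> B" for A B b using allJ that by metis
  define \<P> where "\<P> = \<Q> \<union> (\<lambda>A x. mean (J A x)) ` \<C>'"
  have "pseudonorm_on (carrier G) (\<lambda>x. mean (J A x))" if "A \<in> \<C>'" for A
    by (rule pseudonorm_mean[OF subgroup_self]) (use J(1)[OF that] in simp)
  then have pn: "\<forall>\<nu>\<in>\<P>. pseudonorm_on (carrier G) \<nu>" unfolding \<P>_def using Q(1) by auto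
  have "char_free (carrier G) \<P>"
    unfolding \<P>_def
  proof (rule char_free_union[OF d(1) ind' J Jtriv Q(1) _ Q(3)])
    show "\<nu> (x [^] d) = 0" if "\<nu> \<in> \<Q>" "x \<in> carrier G" for \<nu> x
      using Q(2)[OF that(1)] that(2) unfolding H_def by blast
  qed
  moreover have "x = \<one>" if x: "x \<in> carrier G" "\<forall>\<nu>\<in>\<P>. \<nu> x = 0" for x
  proof -
    have "x \<in> {x \<in> carrier G. \<forall>\<nu>\<in>\<P>. \<nu> x = 0}" using x by blast
    \<comment> \<open>The embeddings may have kernels away from \<open>C'\<close>. But the common
      kernel lies in \<open>P\<close> and meets \<open>C'\<close> trivially, and no nontrivial
      subgroup does both.\<close>
    moreover have "{x \<in> carrier G. \<forall>\<nu>\<in>\<P>. \<nu> x = 0} \<subseteq> {\<one>}"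
    proof (rule essential)
      show "subgroup {x \<in> carrier G. \<forall>\<nu>\<in>\<P>. \<nu> x = 0} G" using pn by (intro pseudonorm_kernel) blast
      show "{x \<in> carrier G. \<forall>\<nu>\<in>\<P>. \<nu> x = 0} \<subseteq> P" unfolding P_def \<P>_def by blast
      show "{x \<in> carrier G. \<forall>\<nu>\<in>\<P>. \<nu> x = 0} \<inter> C' \<subseteq> {\<one>}"
      proof
        fix y assume "y \<in> {x \<in> carrier G. \<forall>\<nu>\<in>\<P>. \<nu> x = 0} \<inter> C'"
        then have y: "y \<in> carrier G" "\<forall>\<nu>\<in>\<P>. \<nu> y = 0" "y \<in> C'" by auto
        have Jy: "J A y = \<one>\<^bsub>circle_fun\<^esub>" if A: "A \<in> \<C>'" for A
        proof -
          have "(\<lambda>x. mean (J A x)) \<in> \<P>" unfolding \<P>_def using A by (intro UnI2 imageI)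
          then have "mean (J A y) = 0" using y(2) by auto
          moreover have "J A y \<in> carrier circle_fun" using J(1)[OF A] y(1) by (auto simp: hom_def)
          ultimately show ?thesis using mean_pos[of "J A y"] by (auto simp: one_circle_fun)
        qed
        have "y = \<one>"
        proof (rule span_separated[OF comm_group_circle_fun])
          show "subgroup A G" if "A \<in> \<C>'" for A by (rule sub'[OF that])
          show "J A \<in> hom G circle_fun" if "A \<in> \<C>'" for A by (rule J(1)[OF that])
          show "a = \<one>" if "A \<in> \<C>'" "a \<in> A" "J A a = \<one>\<^bsub>circle_fun\<^esub>" for A a by (rule Jinj[OF that])
          show "J A b = \<one>\<^bsub>circle_fun\<^esub>" if "A \<in> \<C>'" "B \<in> \<C>'" "A \<noteq> B" "b \<in> B" for A B b
            by (rule Jtriv[OF that])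
          show "y \<in> generate G (\<Union>\<C>')" using y(3) unfolding C'_def .
          show "J A y = \<one>\<^bsub>circle_fun\<^esub>" if "A \<in> \<C>'" for A by (rule Jy[OF that])
        qed
        then show "y \<in> {\<one>}" by blast
      qed
    qed
    ultimately show ?thesis by blast
  qed
  ultimately show ?thesis using pn by blast
qed

end

theorem theorem3p1:
  fixes G :: "('a, 'b) monoid_scheme"
  assumes "comm_group G"
    and "\<not> bounded_group G"
  shows "\<exists>\<tau>. topological_abelian_group G \<tau> \<and> Hausdorff_space \<tau> \<and>
           minimally_almost_periodic G \<tau>"
proof -
  interpret comm_group G by (rule assms(1))
  obtain \<P> where \<P>: "\<forall>\<nu>\<in>\<P>. pseudonorm_on (carrier G) \<nu>" "char_free (carrier G) \<P>"
    "\<forall>x\<in>carrier G. (\<forall>\<nu>\<in>\<P>. \<nu> x = 0) \<longrightarrow> x = \<one>\<^bsub>G\<^esub>"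
    using char_free_family_exists[OF assms(2)] by blast
  show ?thesis
  proof (intro exI[of _ "pseudonorm_topology \<P>"] conjI)
    show "topological_abelian_group G (pseudonorm_topology \<P>)"
      using \<P>(1) by (intro topological_abelian_group_pseudonorm) blast
    show "Hausdorff_space (pseudonorm_topology \<P>)"
      using \<P>(1,3) by (intro Hausdorff_pseudonorm) blast+
    show "minimally_almost_periodic G (pseudonorm_topology \<P>)"
      by (rule minimally_almost_periodic_pseudonorm[OF \<P>(2)])
  qed
qed

end
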